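(* Let $G$ be a countable amenable group and suppose $\varphi:X\to\tilde{\mathcal O}$ is a measure-theoretic factor map from a measure-preserving $G$-action $(X,\mu,G)$ on a standard probability space to a multiorder $(\tilde{\mathcal O},\nu,G)$. Let $S(x)=1^{\varphi(x)}(x)$ for $x\in X$ be the successor map on $X$ and let $\tilde S(\prec)=1^{\prec}(\prec)$ be the successor map on $\tilde{\mathcal O}$. Assume that $h(\mu,S)<\infty$ (and hence also $h(\nu,\tilde S)<\infty$). Then $$h(\mu,G)-h(\mu,S)=h(\nu,G)-h(\nu,\tilde S).$$
   Context: A countable amenable group means an infinite countable discrete group $G$ (unit $e$) in which there is a Følner sequence, i.e. a sequence of finite subsets $F_n\subset G$ with $\lim_n |F_n\cap gF_n|/|F_n|=1$ for every $g\in G$. A linear order $\prec$ on $G$ is of type $\mathbb Z$ if every order interval $[a,b]^{\prec}=\{a,b\}\cup\{g\in G: a\prec g\prec b\}$ ($a\prec b$) is finite and $G$ has no minimal or maximal element. The set $\tilde{\mathcal O}$ of all orders of type $\mathbb Z$ on $G$ is a Borel subset of $\{0,1\}^{G\times G}$ (relations identified with their indicator functions, product topology), with the inherited Borel sigma-algebra. $G$ acts on $\tilde{\mathcal O}$ by: $\prec'=g(\prec)$ where $a\prec' b\iff ag\prec bg$. A multiorder on $G$ is the measure-preserving action $(\tilde{\mathcal O},\nu,G)$, where $\nu$ is a $G$-invariant Borel probability measure on $\tilde{\mathcal O}$. For $\prec\,\in\tilde{\mathcal O}$, $1^{\prec}\in G$ denotes the successor of $e$ in $\prec$; $1^{\varphi(x)}(x)$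 and $1^{\prec}(\prec)$ denote the images of $x$ and of $\prec$ under the action of this group element. It is a preliminary fact that $S$ and $\tilde S$ are invertible and preserve $\mu$ and $\nu$ respectively, that they have the same orbits as the respective $G$-actions, and that $\varphi$ is a factor map from $(X,\mu,S)$ to $(\tilde{\mathcal O},\nu,\tilde S)$. $h(\mu,G)$ denotes the Kolmogorov–Sinai entropy of the $G$-action, i.e. the supremum over finite measurable partitions $\mathcal P$ of $h(\mu,G,\mathcal P)=\lim_n\frac1{|F_n|}H(\mu,\bigvee_{g\in F_n}g^{-1}(\mathcal P))$, where $(F_n)$ is any Følner sequence and $H$ is Shannon entropy; $h(\mu,S)$ is the Kolmogorov–Sinai entropy of the $\mathbb Z$-action generated by $S$; similarly for $\nu$. Values of $h(\cdot,G)$ may be $+\infty$. *)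

theory Defs
  imports "HOL-Probability.Probability"
begin

text \<open>
  The acting group is a type of class \<^class>\<open>group_add\<close>, which is not assumed commutative: the product
  \<open>gh\<close> is written \<^term>\<open>g + h\<close> and the unit \<open>e\<close> is \<^term>\<open>0\<close>.
\<close>

section \<open>Foelner sequences\<close>

definition folner :: "(nat \<Rightarrow> 'g::group_add set) \<Rightarrow> bool" where
  "folner F \<longleftrightarrow>
     (\<forall>n. finite (F n)) \<and>
     (\<forall>g. (\<lambda>n. real (card (F n \<inter> (\<lambda>h. g + h) ` F n)) / real (card (F n))) \<longlonglongrightarrow> 1)"

section \<open>Standard probability spaces, actions and factor maps\<close>

definition standard_borel :: "'x measure \<Rightarrow> bool" where
  "standard_borel M \<longleftrightarrow>
     (\<exists>T. completely_metrizable_space T \<and> second_countable T \<and> topspace T = space M \<and>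
          sets M = sigma_sets (topspace T) {U. openin T U})"

text \<open>Both usual conventions are admitted: a Borel probability on a standard Borel space, and the
  completion of such a measure.\<close>

definition standard_prob_space :: "'x measure \<Rightarrow> bool" where
  "standard_prob_space M \<longleftrightarrow>
     prob_space M \<and> (\<exists>B. standard_borel B \<and> (M = B \<or> M = completion B))"

definition measure_preserving_action :: "'x measure \<Rightarrow> ('g::group_add \<Rightarrow> 'x \<Rightarrow> 'x) \<Rightarrow> bool" where
  "measure_preserving_action M T \<longleftrightarrow>
     (\<forall>g. T g \<in> M \<rightarrow>\<^sub>M M \<and> distr M M (T g) = M) \<and>
     (\<forall>x\<in>space M. T 0 x = x) \<and>
     (\<forall>g h. \<forall>x\<in>space M. T (g + h) x = T g (T h x))"

definition factor_map ::
  "'x measure \<Rightarrow> ('g::group_add \<Rightarrow> 'x \<Rightarrow> 'x) \<Rightarrow> 'y measure \<Rightarrow> ('g \<Rightarrow> 'y \<Rightarrow> 'y) \<Rightarrow> ('x \<Rightarrow> 'y) \<Rightarrow> bool"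
where
  "factor_map M T N U \<phi> \<longleftrightarrow>
     \<phi> \<in> M \<rightarrow>\<^sub>M N \<and> distr M N \<phi> = N \<and> (\<forall>g. AE x in M. \<phi> (T g x) = U g (\<phi> x))"

section \<open>Multiorders\<close>

definition strict_linear_order :: "('g \<Rightarrow> 'g \<Rightarrow> bool) \<Rightarrow> bool" where
  "strict_linear_order r \<longleftrightarrow> irreflp r \<and> transp r \<and> totalp r"

definition order_interval :: "('g \<Rightarrow> 'g \<Rightarrow> bool) \<Rightarrow> 'g \<Rightarrow> 'g \<Rightarrow> 'g set" where
  "order_interval r a b = {a, b} \<union> {g. r a g \<and> r g b}"

definition Z_orders :: "('g \<Rightarrow> 'g \<Rightarrow> bool) set" where
  "Z_orders = {r. strict_linear_order r \<and>
     (\<forall>a b. r a b \<longrightarrow> finite (order_interval r a b)) \<and>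
     (\<nexists>m. \<forall>a. \<not> r a m) \<and> (\<nexists>m. \<forall>a. \<not> r m a)}"

definition order_act :: "'g::group_add \<Rightarrow> ('g \<Rightarrow> 'g \<Rightarrow> bool) \<Rightarrow> ('g \<Rightarrow> 'g \<Rightarrow> bool)" where
  "order_act g r = (\<lambda>a b. r (a + g) (b + g))"

text \<open>\<^typ>\<open>'g \<Rightarrow> 'g \<Rightarrow> bool\<close> carries the (iterated) product topology of the discrete
  topology on \<^typ>\<open>bool\<close>, that is, the topology of \<open>{0,1}\<^bsup>G \<times> G\<^esup>\<close>.\<close>

definition multiorder :: "('g::group_add \<Rightarrow> 'g \<Rightarrow> bool) measure \<Rightarrow> bool" where
  "multiorder \<nu> \<longleftrightarrow>
     sets \<nu> = sets (restrict_space borel Z_orders) \<and> prob_space \<nu> \<and>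
     measure_preserving_action \<nu> order_act"

definition unit_succ :: "('g::group_add \<Rightarrow> 'g \<Rightarrow> bool) \<Rightarrow> 'g" where
  "unit_succ r = (THE s. r 0 s \<and> (\<nexists>g. r 0 g \<and> r g s))"

definition successor_map ::
  "('g::group_add \<Rightarrow> 'x \<Rightarrow> 'x) \<Rightarrow> ('x \<Rightarrow> ('g \<Rightarrow> 'g \<Rightarrow> bool)) \<Rightarrow> 'x \<Rightarrow> 'x" where
  "successor_map T \<phi> x = T (unit_succ (\<phi> x)) x"

definition order_successor_map :: "('g::group_add \<Rightarrow> 'g \<Rightarrow> bool) \<Rightarrow> ('g \<Rightarrow> 'g \<Rightarrow> bool)" where
  "order_successor_map r = order_act (unit_succ r) r"

section \<open>Entropy\<close>

definition finite_measurable_partition :: "'x measure \<Rightarrow> 'x set set \<Rightarrow> bool" where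
  "finite_measurable_partition M P \<longleftrightarrow> partition_on (space M) P \<and> finite P \<and> P \<subseteq> sets M"

definition preimage_partition :: "'x measure \<Rightarrow> ('x \<Rightarrow> 'x) \<Rightarrow> 'x set set \<Rightarrow> 'x set set" where
  "preimage_partition M f P = (\<lambda>A. f -` A \<inter> space M) ` P - {{}}"

definition partition_join :: "'x measure \<Rightarrow> 'i set \<Rightarrow> ('i \<Rightarrow> 'x set set) \<Rightarrow> 'x set set" where
  "partition_join M I P = {space M \<inter> (\<Inter>i\<in>I. A i) | A. \<forall>i\<in>I. A i \<in> P i} - {{}}"

text \<open>Null cells contribute \<open>0\<close>, as in the convention \<open>0 log 0 = 0\<close>.\<close>

definition partition_entropy :: "'x measure \<Rightarrow> 'x set set \<Rightarrow> real" where
  "partition_entropy M P = - (\<Sum>A\<in>P. measure M A * ln (measure M A))"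

text \<open>The limit is the common value along all Foelner sequences; it is determined as soon as the
  group has a Foelner sequence.\<close>

definition action_partition_entropy ::
  "'x measure \<Rightarrow> ('g::group_add \<Rightarrow> 'x \<Rightarrow> 'x) \<Rightarrow> 'x set set \<Rightarrow> real" where
  "action_partition_entropy M T P =
     (THE L. \<forall>F. folner F \<longrightarrow>
        (\<lambda>n. partition_entropy M (partition_join M (F n) (\<lambda>g. preimage_partition M (T g) P))
              / real (card (F n))) \<longlonglongrightarrow> L)"

definition action_entropy :: "'x measure \<Rightarrow> ('g::group_add \<Rightarrow> 'x \<Rightarrow> 'x) \<Rightarrow> ereal" where
  "action_entropy M T =
     (SUP P\<in>{P. finite_measurable_partition M P}. ereal (action_partition_entropy M T P))"

text \<open>For the \<open>\<int>\<close>-action generated by \<open>S\<close> the sets \<open>{0,\<dots>,n-1}\<close> are used; they only involve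
  forward iterates, so \<open>S\<close> may be invertible merely up to a null set.\<close>

definition map_partition_entropy :: "'x measure \<Rightarrow> ('x \<Rightarrow> 'x) \<Rightarrow> 'x set set \<Rightarrow> real" where
  "map_partition_entropy M S P =
     lim (\<lambda>n. partition_entropy M (partition_join M {..<n} (\<lambda>i. preimage_partition M (S ^^ i) P))
              / real n)"

definition map_entropy :: "'x measure \<Rightarrow> ('x \<Rightarrow> 'x) \<Rightarrow> ereal" where
  "map_entropy M S =
     (SUP P\<in>{P. finite_measurable_partition M P}. ereal (map_partition_entropy M S P))"

end

theory Submission
  imports Defs
begin

text \<open>
  Condition everything on the order. Enumerating a finite set \<open>F \<subseteq> G\<close> in the order \<open>\<phi>(x)\<close>, the chain rule
  writes the relative entropy of \<open>P\<^sup>F\<close> as a sum over \<open>g \<in> F\<close> of the entropy of \<open>g\<^sup>-\<^sup>1P\<close> given the part of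
  \<open>P\<^sup>F\<close> lying ahead of \<open>g\<close>; after translating by \<open>g\<close> this is the entropy of \<open>P\<close> given its values at the
  elements of \<open>Fg\<^sup>-\<^sup>1\<close> above the unit, which are forward iterates of \<open>S\<close>. As every element above the unit is such an
  iterate and a bounded number of iterates stays, up to small probability, in a finite subset of
  \<open>G\<close>, the relative entropies of the \<open>G\<close>-action and of \<open>S\<close> agree for each \<open>P\<close>. Both entropies of \<open>\<mu>\<close> are
  the corresponding entropy of \<open>\<nu>\<close> plus the supremum of this common relative entropy.

  Relative entropy is always an infimum over finite partitions \<open>Q\<close> of the space of orders of
  \<open>h(P \<or> Q) - h(Q)\<close>, so no conditioning on a \<open>\<sigma>\<close>-algebra occurs; partitions are encoded by
  finite-valued random variables.
\<close>

section \<open>Entropy of finite-valued random variables\<close>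

text \<open>No step compares the two relative entropies for one and the same \<open>Q\<close>.
  Passing between the group and \<open>S\<close> requires knowing the order on a finite set, the
  first iterates of the successor, or the values of \<open>Q\<close> along an orbit seen from
  another of its points. Each of these is, at least approximately, a finite-valued function of the
  order and is absorbed into a new \<open>Q\<close>. Only the infimum over \<open>Q\<close> survives
  such changes; this infimum, \<open>relent\<close>, is the quantity that enters both addition
  formulas. The final cancellation is legitimate even if the entropy of the group action is
  infinite: the common summand and the entropy of the successor map on orders are nonnegative, and
  their sum is the finite number h(\<mu>, S). Equivariance of \<phi> holds only almost everywhere,
  and the good set \<Omega> is not made invariant. Iterates of \<open>S\<close> and translates are
  always expressed through the order at the starting point, so that equivariance is invoked at that
  point alone, for all group elements at once.\<close>

definition pr :: "'x measure \<Rightarrow> ('x \<Rightarrow> 'a) \<Rightarrow> 'x \<Rightarrow> real" where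
  "pr M X x = measure M {y \<in> space M. X y = X x}"

text \<open>The mean of the information function replaces the sum over cells: conditional entropies
  become integrals of pointwise differences, and these can be rearranged along an order that depends
  on the point.\<close>

definition ent :: "'x measure \<Rightarrow> ('x \<Rightarrow> 'a) \<Rightarrow> real" where
  "ent M X = (\<integral>x. - ln (pr M X x) \<partial>M)"

text \<open>This is the conditional entropy H(X | Y), with the chain rule taken as
  definition.\<close>

definition cent :: "'x measure \<Rightarrow> ('x \<Rightarrow> 'a) \<Rightarrow> ('x \<Rightarrow> 'b) \<Rightarrow> real" where
  "cent M X Y = ent M (\<lambda>x. (X x, Y x)) - ent M Y"

lemma simple_function_pr:
  assumes "simple_function M X"
  shows "simple_function M (pr M X)"
proof -
  have "pr M X = (\<lambda>v. measure M {y \<in> space M. X y = v}) \<circ> X"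
    by (auto simp: pr_def fun_eq_iff)
  then show ?thesis
    using simple_function_compose[OF assms] by simp
qed

section \<open>Conditional mutual information of finite-valued variables\<close>

context information_space
begin

lemma simple_distributed_prob:
  assumes "simple_function M W"
  shows "simple_distributed M W (\<lambda>v. prob {y \<in> space M. W y = v})"
proof -
  have "W -` {v} \<inter> space M = {y \<in> space M. W y = v}" for v
    by auto
  then show ?thesis
    by (intro simple_distributedI[OF assms]) simp_all
qed

text \<open>The sum is I(X; Y | Z) written with point probabilities, the form in which
  \<open>submodular\<close> can split it into information functions.\<close>

lemma conditional_mutual_information_sum_nonneg:
  assumes X: "simple_function M X" and Y: "simple_function M Y" and Z: "simple_function M Z"
  shows "0 \<le> (\<Sum>(x, y, z)\<in>(\<lambda>x. (X x, Y x, Z x)) ` space M.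
      prob {w \<in> space M. (X w, Y w, Z w) = (x, y, z)} *
        log b (prob {w \<in> space M. (X w, Y w, Z w) = (x, y, z)} /
          (prob {w \<in> space M. (X w, Z w) = (x, z)} *
            (prob {w \<in> space M. (Y w, Z w) = (y, z)} / prob {w \<in> space M. Z w = z}))))"
proof -
  note sd = simple_distributed_prob simple_function_Pair X Y Z
  show ?thesis
    using conditional_mutual_information_nonneg[OF X Y Z]
    by (subst (asm) conditional_mutual_information_eq) (rule sd)+
qed

end

context prob_space
begin

lemma simple_integrable:
  assumes "simple_function M (f :: 'a \<Rightarrow> real)"
  shows "integrable M f"
proof (rule integrable_const_bound[where B = "Max ((\<lambda>x. \<bar>f x\<bar>) ` space M)"])
  have "finite ((\<lambda>x. \<bar>f x\<bar>) ` space M)"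
    using finite_imageI[OF simple_functionD(1)[OF assms], of abs] by (simp add: image_image)
  then show "AE x in M. norm (f x) \<le> Max ((\<lambda>x. \<bar>f x\<bar>) ` space M)"
    by (intro AE_I2) auto
qed (rule borel_measurable_simple_function[OF assms])

lemma simple_level_sets:
  assumes "simple_function M X"
  shows "{y \<in> space M. X y = v} \<in> sets M"
proof -
  have "{y \<in> space M. X y = v} = X -` {v} \<inter> space M" by auto
  then show ?thesis
    using simple_functionD(2)[OF assms, of "{v}"] by simp
qed

lemma expectation_simple:
  assumes X: "simple_function M X"
  shows "expectation (\<lambda>x. g (X x)) = (\<Sum>v\<in>X ` space M. g v * prob {y \<in> space M. X y = v})"
proof -
  have fin: "finite (X ` space M)"
    using X by (rule simple_functionD)
  have "expectation (\<lambda>x. g (X x)) =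
      expectation (\<lambda>x. \<Sum>v\<in>X ` space M. g v * indicator {y \<in> space M. X y = v} x)"
  proof (rule Bochner_Integration.integral_cong)
    fix x assume x: "x \<in> space M"
    have "(\<Sum>v\<in>X ` space M. g v * indicator {y \<in> space M. X y = v} x) =
        (\<Sum>v\<in>X ` space M. if v = X x then g v else 0)"
      using x by (intro sum.cong) auto
    then show "g (X x) = (\<Sum>v\<in>X ` space M. g v * indicator {y \<in> space M. X y = v} x)"
      using x fin by simp
  qed simp
  also have "\<dots> = (\<Sum>v\<in>X ` space M. g v * prob {y \<in> space M. X y = v})"
    by (subst Bochner_Integration.integral_sum)
       (auto intro!: integrable_mult_right integrable_real_indicator simple_level_sets X
         simp: emeasure_eq_measure Int_absorb2)
  finally show ?thesis .
qed

lemma ent_eq_sum: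
  assumes "simple_function M X"
  shows "ent M X = (\<Sum>v\<in>X ` space M. - (prob {y \<in> space M. X y = v} * ln (prob {y \<in> space M. X y = v})))"
  unfolding ent_def pr_def
  using expectation_simple[OF assms, of "\<lambda>v. - ln (prob {y \<in> space M. X y = v})"]
  by (simp add: mult.commute)

lemma integrable_info:
  assumes "simple_function M X"
  shows "integrable M (\<lambda>x. - ln (pr M X x))"
  using simple_function_compose[OF simple_function_pr[OF assms], of "\<lambda>p. - ln p"]
  by (intro simple_integrable) (simp add: comp_def)

lemma AE_pr_pos:
  assumes X: "simple_function M X"
  shows "AE x in M. 0 < pr M X x"
proof -
  define N where "N = (\<Union>v\<in>{v\<in>X ` space M. prob {y \<in> space M. X y = v} = 0}. {y \<in> space M. X y = v})"
  have "N \<in> null_sets M"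
    unfolding N_def using simple_functionD(1)[OF X] simple_level_sets[OF X]
    by (intro null_sets.finite_UN) (auto simp: emeasure_eq_measure)
  moreover have "{x \<in> space M. \<not> 0 < pr M X x} \<subseteq> N"
    by (auto simp: N_def pr_def not_less measure_le_0_iff)
  ultimately show ?thesis
    by (rule AE_I')
qed

end

text \<open>The set \<open>\<Omega>\<close> stands for the points at which almost sure identities hold everywhere.\<close>

locale full_measure_set = prob_space +
  fixes \<Omega> :: "'a set"
  assumes Omega_sets [measurable]: "\<Omega> \<in> sets M" and Omega_full: "prob \<Omega> = 1"
begin

text \<open>Refinement of the generated partitions on \<Omega>, stated without naming a function
  that computes \<open>X\<close> from \<open>Y\<close>, so that it applies directly to variables
  with different value types.\<close>

definition determines :: "('a \<Rightarrow> 'b) \<Rightarrow> ('a \<Rightarrow> 'c) \<Rightarrow> bool" where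
  "determines Y X \<longleftrightarrow> (\<forall>x\<in>\<Omega>. \<forall>y\<in>\<Omega>. Y x = Y y \<longrightarrow> X x = X y)"

lemma determinesI:
  "(\<And>x y. x \<in> \<Omega> \<Longrightarrow> y \<in> \<Omega> \<Longrightarrow> Y x = Y y \<Longrightarrow> X x = X y) \<Longrightarrow> determines Y X"
  unfolding determines_def by blast

lemma determinesD:
  "determines Y X \<Longrightarrow> x \<in> \<Omega> \<Longrightarrow> y \<in> \<Omega> \<Longrightarrow> Y x = Y y \<Longrightarrow> X x = X y"
  unfolding determines_def by blast

lemma Omega_space: "x \<in> \<Omega> \<Longrightarrow> x \<in> space M"
  by (rule subsetD[OF sets.sets_into_space[OF Omega_sets]])

lemma AE_Omega: "AE x in M. x \<in> \<Omega>"
  using AE_prob_1[OF Omega_full] .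

lemma prob_Omega:
  assumes "A \<in> sets M"
  shows "prob A = prob (A \<inter> \<Omega>)"
proof (rule finite_measure_eq_AE)
  show "AE x in M. x \<in> A \<longleftrightarrow> x \<in> A \<inter> \<Omega>"
    using AE_Omega by eventually_elim simp
qed (intro assms sets.Int Omega_sets)+

lemma pr_mono:
  assumes "simple_function M X" "simple_function M Y" "x \<in> \<Omega>"
    "\<And>y. y \<in> \<Omega> \<Longrightarrow> Y y = Y x \<Longrightarrow> X y = X x"
  shows "pr M Y x \<le> pr M X x"
proof -
  have "prob ({y \<in> space M. Y y = Y x} \<inter> \<Omega>) \<le> prob ({y \<in> space M. X y = X x} \<inter> \<Omega>)"
    using assms(4) by (intro finite_measure_mono sets.Int simple_level_sets assms Omega_sets) blast
  then show ?thesis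
    unfolding pr_def prob_Omega[OF simple_level_sets[OF assms(1)]]
      prob_Omega[OF simple_level_sets[OF assms(2)]] .
qed

lemma ent_mono:
  assumes X: "simple_function M X" and Y: "simple_function M Y" and "determines Y X"
  shows "ent M X \<le> ent M Y"
  unfolding ent_def
proof (rule integral_mono_AE)
  show "AE x in M. - ln (pr M X x) \<le> - ln (pr M Y x)"
    using AE_Omega AE_pr_pos[OF X] AE_pr_pos[OF Y]
  proof eventually_elim
    case (elim x)
    then have "pr M Y x \<le> pr M X x"
      by (intro pr_mono X Y determinesD[OF assms(3)])
    then show ?case
      using elim by simp
  qed
qed (intro integrable_info X Y)+

lemma ent_cong:
  assumes "simple_function M X" "simple_function M Y" "determines Y X" "determines X Y"
  shows "ent M X = ent M Y"
  using assms by (intro antisym ent_mono)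

lemma cent_eq_expectation:
  assumes X: "simple_function M X" and Y: "simple_function M Y"
  shows "cent M X Y = expectation (\<lambda>x. - ln (pr M (\<lambda>x. (X x, Y x)) x) - - ln (pr M Y x))"
  unfolding cent_def ent_def
  by (rule Bochner_Integration.integral_diff[symmetric])
     (intro integrable_info X Y simple_function_Pair)+

text \<open>The difference of the two sides is the conditional mutual information I(X; Y | Z).
  Almost everywhere the four probabilities involved are positive, so its logarithm splits into four
  information functions.\<close>

lemma submodular:
  assumes X: "simple_function M X" and Y: "simple_function M Y" and Z: "simple_function M Z"
  shows "cent M X (\<lambda>x. (Y x, Z x)) \<le> cent M X Z"
proof -
  interpret information_space M "exp 1"
    by unfold_locales simp
  let ?XYZ = "\<lambda>x. (X x, Y x, Z x)"
  have XYZ: "simple_function M ?XYZ" and YZ: "simple_function M (\<lambda>x. (Y x, Z x))"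
    and XZ: "simple_function M (\<lambda>x. (X x, Z x))"
    by (intro simple_function_Pair X Y Z)+
  define h where "h = (\<lambda>(x, y, z). log (exp 1) (prob {w \<in> space M. ?XYZ w = (x, y, z)} /
    (prob {w \<in> space M. (X w, Z w) = (x, z)} *
      (prob {w \<in> space M. (Y w, Z w) = (y, z)} / prob {w \<in> space M. Z w = z}))))"
  let ?I = "\<lambda>x. (- ln (pr M (\<lambda>x. (X x, Z x)) x) - - ln (pr M Z x)) -
    (- ln (pr M ?XYZ x) - - ln (pr M (\<lambda>x. (Y x, Z x)) x))"
  have "0 \<le> (\<Sum>v\<in>?XYZ ` space M. h v * prob {w \<in> space M. ?XYZ w = v})"
    using conditional_mutual_information_sum_nonneg[OF X Y Z]
    unfolding h_def case_prod_beta prod.collapse by (simp only: mult.commute)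
  also have "\<dots> = expectation (\<lambda>x. h (?XYZ x))"
    by (rule expectation_simple[OF XYZ, symmetric])
  also have "\<dots> = expectation ?I"
  proof (rule integral_cong_AE)
    show "AE x in M. h (?XYZ x) = ?I x"
      using AE_pr_pos[OF XZ] AE_pr_pos[OF Z] AE_pr_pos[OF XYZ] AE_pr_pos[OF YZ]
    proof eventually_elim
      case (elim x)
      have "h (?XYZ x) = log (exp 1) (pr M ?XYZ x /
          (pr M (\<lambda>x. (X x, Z x)) x * (pr M (\<lambda>x. (Y x, Z x)) x / pr M Z x)))"
        by (simp only: h_def pr_def prod.case)
      then show ?case
        using elim by (simp add: log_def ln_div ln_mult)
    qed
    show "(\<lambda>x. h (?XYZ x)) \<in> borel_measurable M"
      by (rule borel_measurable_simple_function[OF simple_function_compose1[OF XYZ]])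
    show "?I \<in> borel_measurable M"
      by (intro borel_measurable_diff borel_measurable_integrable[OF integrable_info] XYZ XZ YZ Z)
  qed
  also have "\<dots> = cent M X Z - cent M X (\<lambda>x. (Y x, Z x))"
    unfolding cent_eq_expectation[OF X Z] cent_eq_expectation[OF X YZ]
    by (rule Bochner_Integration.integral_diff)
       (intro Bochner_Integration.integrable_diff integrable_info XYZ XZ YZ Z)+
  finally show ?thesis by simp
qed

lemma ent_nonneg:
  assumes "simple_function M X"
  shows "0 \<le> ent M X"
proof -
  have "0 \<le> - ln p" if "0 \<le> p" "p \<le> 1" for p :: real
    using that by (cases "p = 0") auto
  then show ?thesis
    unfolding ent_def pr_def by (intro integral_nonneg_AE AE_I2) auto
qed

lemma cent_mono_left:
  assumes "simple_function M X" "simple_function M X'" "simple_function M Y"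
    "determines (\<lambda>x. (X' x, Y x)) X"
  shows "cent M X Y \<le> cent M X' Y"
  using assms(4) unfolding cent_def
  by (intro diff_right_mono ent_mono simple_function_Pair assms) (unfold determines_def prod.inject, blast+)

lemma cent_cong:
  assumes "simple_function M X" "simple_function M X'" "simple_function M Y" "simple_function M Y'"
    "determines (\<lambda>x. (X' x, Y x)) X" "determines (\<lambda>x. (X x, Y x)) X'" "determines Y Y'" "determines Y' Y"
  shows "cent M X Y = cent M X' Y'"
proof -
  have "ent M (\<lambda>x. (X x, Y x)) = ent M (\<lambda>x. (X' x, Y' x))"
    using assms(5-8) by (intro ent_cong simple_function_Pair assms(1-4)) (unfold determines_def prod.inject, blast+)
  moreover have "ent M Y = ent M Y'"
    by (intro ent_cong assms)
  ultimately show ?thesis by (simp add: cent_def)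
qed

text \<open>When \<open>Y\<close> determines \<open>Z\<close>, conditioning on \<open>Y\<close> is
  the same as conditioning on the pair, and submodularity drops \<open>Y\<close> from that
  pair.\<close>

lemma cent_antimono:
  assumes X: "simple_function M X" and Y: "simple_function M Y" and Z: "simple_function M Z"
    and YZ: "determines Y Z"
  shows "cent M X Y \<le> cent M X Z"
proof -
  have "cent M X Y = cent M X (\<lambda>x. (Y x, Z x))"
    using YZ by (intro cent_cong X Y Z simple_function_Pair) (unfold determines_def prod.inject, blast+)
  also have "\<dots> \<le> cent M X Z"
    by (rule submodular[OF X Y Z])
  finally show ?thesis .
qed

lemma cent_nonneg:
  assumes "simple_function M X" "simple_function M Y"
  shows "0 \<le> cent M X Y"
  unfolding cent_def diff_ge_0_iff_ge
  by (intro ent_mono simple_function_Pair assms) (unfold determines_def prod.inject, blast+)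

lemma ent_const [simp]: "ent M (\<lambda>x. c) = 0"
  using prob_space by (simp add: ent_def pr_def)

lemma cent_const:
  assumes "simple_function M X"
  shows "cent M X (\<lambda>x. c) = ent M X"
proof -
  have "ent M (\<lambda>x. (X x, c)) = ent M X"
    by (intro ent_cong simple_function_Pair assms) (unfold determines_def prod.inject, blast+)
  then show ?thesis by (simp add: cent_def)
qed

lemma cent_le_ent:
  assumes "simple_function M X" "simple_function M Y"
  shows "cent M X Y \<le> ent M X"
  using cent_antimono[OF assms, of "\<lambda>_. ()"] cent_const[OF assms(1), of "()"]
  by (simp add: determinesI)

lemma cent_chain:
  assumes X: "simple_function M X" and Y: "simple_function M Y" and Z: "simple_function M Z"
  shows "cent M (\<lambda>x. (X x, Y x)) Z = cent M X (\<lambda>x. (Y x, Z x)) + cent M Y Z"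
proof -
  have "ent M (\<lambda>x. ((X x, Y x), Z x)) = ent M (\<lambda>x. (X x, Y x, Z x))"
    by (intro ent_cong simple_function_Pair assms) (unfold determines_def prod.inject, blast+)
  then show ?thesis by (simp add: cent_def)
qed

end

section \<open>Joint variables over fixed and random index sets\<close>

definition joint :: "('i \<Rightarrow> 'x \<Rightarrow> 'b) \<Rightarrow> ('x \<Rightarrow> 'i set) \<Rightarrow> 'x \<Rightarrow> 'i \<Rightarrow> 'b option" where
  "joint P A x = (\<lambda>i. if i \<in> A x then Some (P i x) else None)"

text \<open>The entry \<open>None\<close> outside \<open>A x\<close> makes the value reveal the
  index set itself, and lets joint variables over varying subsets share one value type.\<close>

lemma joint_eq_iff: "joint P A x = joint P A y \<longleftrightarrow> A x = A y \<and> (\<forall>i\<in>A x. P i x = P i y)"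
proof
  assume eq: "joint P A x = joint P A y"
  have "(i \<in> A x \<longleftrightarrow> i \<in> A y) \<and> (i \<in> A x \<longrightarrow> P i x = P i y)" for i
    using fun_cong[OF eq, of i] by (auto simp: joint_def split: if_splits)
  then show "A x = A y \<and> (\<forall>i\<in>A x. P i x = P i y)"
    by blast
qed (auto simp: joint_def fun_eq_iff)

lemma simple_function_joint_const:
  assumes "finite F" "\<And>i. i \<in> F \<Longrightarrow> simple_function M (P i)"
  shows "simple_function M (joint P (\<lambda>_. F))"
  using assms
proof (induction F)
  case empty
  have "joint P (\<lambda>_. {}) = (\<lambda>_ _. None)"
    by (simp add: joint_def fun_eq_iff)
  then show ?case by simp
next
  case (insert a F)
  have eq: "joint P (\<lambda>_. insert a F) = (\<lambda>(p, f). f(a := Some p)) \<circ> (\<lambda>x. (P a x, joint P (\<lambda>_. F) x))"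
    by (auto simp: joint_def fun_eq_iff)
  have "simple_function M (\<lambda>x. (P a x, joint P (\<lambda>_. F) x))"
    using insert by (intro simple_function_Pair) auto
  then show ?case
    unfolding eq by (rule simple_function_compose)
qed

lemma simple_function_joint:
  assumes "finite F" "\<And>i. i \<in> F \<Longrightarrow> simple_function M (P i)" "simple_function M A"
    "\<And>x. x \<in> space M \<Longrightarrow> A x \<subseteq> F"
  shows "simple_function M (joint P A)"
proof -
  have "simple_function M (\<lambda>x. (A x, joint P (\<lambda>_. F) x))"
    by (intro simple_function_Pair simple_function_joint_const assms)
  from simple_function_compose1[OF this, of "\<lambda>(B, f) i. if i \<in> B then f i else None"]
  have "simple_function M (\<lambda>x i. if i \<in> A x then joint P (\<lambda>_. F) x i else None)"
    by simp
  also have "?this \<longleftrightarrow> ?thesis"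
    using assms(4) by (intro simple_function_cong) (auto simp: joint_def fun_eq_iff)
  finally show ?thesis .
qed

text \<open>Remove an element \<open>m\<close> with nothing below it: all other elements lie above
  \<open>m\<close>, so its term is \<open>d F - d (F - {m})\<close>, and \<open>m\<close> lies above
  no other element, so the remaining terms are those of \<open>F - {m}\<close>.\<close>

lemma sum_telescope_linear_order:
  fixes d :: "'i set \<Rightarrow> real"
  assumes "finite F" "asymp_on F r" "transp_on F r" "totalp_on F r"
  shows "(\<Sum>g\<in>F. d (insert g {h \<in> F. r g h}) - d {h \<in> F. r g h}) = d F - d {}"
  using assms
proof (induction "card F" arbitrary: F)
  case 0
  then show ?case by simp
next
  case (Suc n)
  then have "F \<noteq> {}" by auto
  with Suc.prems obtain m where m: "m \<in> F" "\<And>x. x \<in> F \<Longrightarrow> x \<noteq> m \<Longrightarrow> \<not> r x m"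
    using Finite_Set.bex_min_element[of F r] by blast
  let ?F = "F - {m}"
  have irr: "\<not> r m m"
    using Suc.prems(2) m(1) by (auto dest: asymp_onD)
  have below: "{h \<in> F. r m h} = ?F"
    using Suc.prems(4) m irr by (auto simp: totalp_on_def)
  have above: "{h \<in> F. r g h} = {h \<in> ?F. r g h}" if "g \<in> ?F" for g
    using m that by auto
  have "(\<Sum>g\<in>?F. d (insert g {h \<in> ?F. r g h}) - d {h \<in> ?F. r g h}) = d ?F - d {}"
    using Suc.prems Suc.hyps(2) m(1)
    by (intro Suc.hyps(1)) (auto intro: asymp_on_subset transp_on_subset totalp_on_subset)
  then have "(\<Sum>g\<in>?F. d (insert g {h \<in> F. r g h}) - d {h \<in> F. r g h}) = d ?F - d {}"
    using above by simp
  then show ?case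
    using m(1) Suc.prems(1) by (simp add: sum.remove[of F m] below insert_absorb)
qed

section \<open>Elementary bounds for the terms - p ln p\<close>

lemma entropy_term_le_sqrt:
  assumes "0 \<le> (p::real)"
  shows "- (p * ln p) \<le> 2 * sqrt p"
proof (cases "p = 0")
  case False
  with assms have p: "0 < p" by simp
  \<comment> \<open>Applying ln t \<le> t - 1 at 1 / sqrt p instead of 1 / p gives a bound that
    vanishes with p.\<close>
  have "ln (1 / sqrt p) \<le> 1 / sqrt p - 1"
    using p by (intro ln_le_minus_one) simp
  also have "ln (1 / sqrt p) = - ln p / 2"
    using p by (simp add: ln_div ln_sqrt)
  finally have "- ln p \<le> 2 / sqrt p"
    by simp
  then have "p * - ln p \<le> p * (2 / sqrt p)"
    using p by (intro mult_left_mono) auto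
  also have "p * (2 / sqrt p) = 2 * sqrt p"
    using p by (simp add: field_simps)
  finally show ?thesis by simp
qed simp

text \<open>Meant for a value of probability close to 1, where the square root bound is
  useless.\<close>

lemma entropy_term_le_complement:
  assumes "0 \<le> (p::real)"
  shows "- (p * ln p) \<le> 1 - p"
proof (cases "p = 0")
  case False
  with assms have p: "0 < p" by simp
  have "p * ln (1 / p) \<le> p * (1 / p - 1)"
    using p by (intro mult_left_mono ln_le_minus_one) auto
  then show ?thesis
    using p by (simp add: ln_div algebra_simps)
qed simp

section \<open>Chain rule along a random order, Shearer and Fano inequalities\<close>

context full_measure_set
begin

lemma pr_Omega:
  assumes "simple_function M X"
  shows "pr M X x = prob {y \<in> \<Omega>. X y = X x}"
proof -
  have "{y \<in> space M. X y = X x} \<inter> \<Omega> = {y \<in> \<Omega>. X y = X x}"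
    using Omega_space by auto
  then show ?thesis
    using prob_Omega[OF simple_level_sets[OF assms]] by (simp add: pr_def)
qed

text \<open>Pointwise, the conditional information functions telescope along the order attached to the
  point, because the conditioning variable \<open>Z\<close> determines that order.\<close>

lemma cent_random_order:
  assumes F: "finite F" and P: "\<And>g. g \<in> F \<Longrightarrow> simple_function M (P g)"
    and Z: "simple_function M Z"
    and R: "\<And>g. g \<in> F \<Longrightarrow> simple_function M (\<lambda>x. {h \<in> F. R x g h})"
    and ZR: "\<And>g. g \<in> F \<Longrightarrow> determines Z (\<lambda>x. {h \<in> F. R x g h})"
    and ord: "\<And>x. x \<in> \<Omega> \<Longrightarrow> asymp_on F (R x) \<and> transp_on F (R x) \<and> totalp_on F (R x)"
  shows "cent M (joint P (\<lambda>_. F)) Z =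
    (\<Sum>g\<in>F. cent M (P g) (\<lambda>x. (joint P (\<lambda>x. {h \<in> F. R x g h}) x, Z x)))"
proof -
  let ?J = "joint P (\<lambda>_. F)" and ?K = "\<lambda>g. joint P (\<lambda>x. {h \<in> F. R x g h})"
  let ?I = "\<lambda>g x. - ln (pr M (\<lambda>x. (P g x, ?K g x, Z x)) x) - - ln (pr M (\<lambda>x. (?K g x, Z x)) x)"
  have J: "simple_function M ?J"
    by (intro simple_function_joint_const F P)
  have K: "simple_function M (?K g)" if "g \<in> F" for g
    by (rule simple_function_joint[OF F P R]) (use that in auto)
  have KZ: "simple_function M (\<lambda>x. (?K g x, Z x))" if "g \<in> F" for g
    by (intro simple_function_Pair K that Z)
  have PKZ: "simple_function M (\<lambda>x. (P g x, ?K g x, Z x))" if "g \<in> F" for g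
    by (intro simple_function_Pair P KZ that)
  have JZ: "simple_function M (\<lambda>x. (?J x, Z x))"
    by (intro simple_function_Pair J Z)
  have int: "integrable M (?I g)" if "g \<in> F" for g
    by (intro Bochner_Integration.integrable_diff integrable_info KZ PKZ that)
  have "(\<Sum>g\<in>F. cent M (P g) (\<lambda>x. (?K g x, Z x))) = (\<Sum>g\<in>F. expectation (?I g))"
    by (intro sum.cong refl cent_eq_expectation P KZ)
  also have "\<dots> = expectation (\<lambda>x. \<Sum>g\<in>F. ?I g x)"
    by (intro Bochner_Integration.integral_sum[symmetric] int)
  also have "\<dots> = expectation (\<lambda>x. - ln (pr M (\<lambda>x. (?J x, Z x)) x) - - ln (pr M Z x))"
  proof (rule integral_cong_AE)
    show "AE x in M. (\<Sum>g\<in>F. ?I g x) = - ln (pr M (\<lambda>x. (?J x, Z x)) x) - - ln (pr M Z x)"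
      using AE_Omega
    proof eventually_elim
      case (elim x)
      define d where "d U = - ln (prob {y \<in> \<Omega>. Z y = Z x \<and> (\<forall>h\<in>U. P h y = P h x)})" for U
      have "?I g x = d (insert g {h \<in> F. R x g h}) - d {h \<in> F. R x g h}" if "g \<in> F" for g
      proof -
        have same: "{h \<in> F. R y g h} = {h \<in> F. R x g h}" if "y \<in> \<Omega>" "Z y = Z x" for y
          using determinesD[OF ZR[OF \<open>g \<in> F\<close>] that(1) elim that(2)] .
        have "{y \<in> \<Omega>. (?K g y, Z y) = (?K g x, Z x)} =
            {y \<in> \<Omega>. Z y = Z x \<and> (\<forall>h\<in>{h \<in> F. R x g h}. P h y = P h x)}"
          unfolding prod.inject joint_eq_iff using same by blast
        moreover have "{y \<in> \<Omega>. (P g y, ?K g y, Z y) = (P g x, ?K g x, Z x)} =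
            {y \<in> \<Omega>. Z y = Z x \<and> (\<forall>h\<in>insert g {h \<in> F. R x g h}. P h y = P h x)}"
          unfolding prod.inject joint_eq_iff using same by blast
        ultimately show ?thesis
          by (simp only: pr_Omega[OF KZ[OF that]] pr_Omega[OF PKZ[OF that]] d_def)
      qed
      then have "(\<Sum>g\<in>F. ?I g x) =
          (\<Sum>g\<in>F. d (insert g {h \<in> F. R x g h}) - d {h \<in> F. R x g h})"
        by (intro sum.cong refl)
      also have "\<dots> = d F - d {}"
        using ord[OF elim] by (intro sum_telescope_linear_order F) auto
      also have "d {} = - ln (pr M Z x)"
        by (simp add: pr_Omega[OF Z] d_def)
      also have "d F = - ln (pr M (\<lambda>x. (?J x, Z x)) x)"
      proof -
        have "{y \<in> \<Omega>. (?J y, Z y) = (?J x, Z x)} =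
            {y \<in> \<Omega>. Z y = Z x \<and> (\<forall>h\<in>F. P h y = P h x)}"
          unfolding prod.inject joint_eq_iff by blast
        then show ?thesis
          by (simp only: pr_Omega[OF JZ] d_def)
      qed
      finally show ?case .
    qed
    show "(\<lambda>x. \<Sum>g\<in>F. ?I g x) \<in> borel_measurable M"
      by (intro borel_measurable_sum borel_measurable_integrable int)
    show "(\<lambda>x. - ln (pr M (\<lambda>x. (?J x, Z x)) x) - - ln (pr M Z x)) \<in> borel_measurable M"
      by (intro borel_measurable_diff borel_measurable_integrable[OF integrable_info] JZ Z)
  qed
  also have "\<dots> = cent M ?J Z"
    by (rule cent_eq_expectation[OF J Z, symmetric])
  finally show ?thesis ..
qed

text \<open>Expand everything by the chain rule along the fixed order \<open>r\<close>, and let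
  \<open>c a\<close> be the term of \<open>a\<close> in the expansion over \<open>F\<close>. Inside
  a subset \<open>A f\<close> fewer elements lie above \<open>a\<close>, so its terms dominate the
  \<open>c a\<close>. Summed over \<open>f\<close>, each \<open>a\<close> outside \<open>B\<close>
  is counted at least \<open>k\<close> times, while the elements of \<open>B\<close> carry at most
  \<open>L\<close> each.\<close>

lemma cent_shearer:
  assumes F: "finite F" and P: "\<And>g. g \<in> F \<Longrightarrow> simple_function M (P g)"
    and Z: "simple_function M Z"
    and ord: "asymp_on F r" "transp_on F r" "totalp_on F r"
    and J: "finite J" and A: "\<And>f. f \<in> J \<Longrightarrow> A f \<subseteq> F" and B: "B \<subseteq> F"
    and cover: "\<And>a. a \<in> F - B \<Longrightarrow> k \<le> card {f \<in> J. a \<in> A f}"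
    and L: "\<And>a. a \<in> F \<Longrightarrow> ent M (P a) \<le> L"
  shows "real k * (cent M (joint P (\<lambda>_. F)) Z - real (card B) * L) \<le>
    (\<Sum>f\<in>J. cent M (joint P (\<lambda>_. A f)) Z)"
proof -
  let ?up = "\<lambda>A a. joint P (\<lambda>_. {h \<in> A. r a h})"
  have up: "simple_function M (?up A a)" if "A \<subseteq> F" for A a
    using that F by (intro simple_function_joint_const) (auto intro: P finite_subset)
  define c where "c a = cent M (P a) (\<lambda>x. (?up F a x, Z x))" for a
  have c_nonneg: "0 \<le> c a" if "a \<in> F" for a
    unfolding c_def by (intro cent_nonneg P that simple_function_Pair up Z) simp
  have c_le: "c a \<le> L" if "a \<in> F" for a
    unfolding c_def using that
    by (intro order_trans[OF cent_le_ent L] P simple_function_Pair up Z) auto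
  have chain: "cent M (joint P (\<lambda>_. A)) Z = (\<Sum>a\<in>A. cent M (P a) (\<lambda>x. (?up A a x, Z x)))"
    if "A \<subseteq> F" for A
  proof (rule cent_random_order)
    show "asymp_on A r \<and> transp_on A r \<and> totalp_on A r"
      using ord that by (auto intro: asymp_on_subset transp_on_subset totalp_on_subset)
  qed (use that F in \<open>auto intro: P Z finite_subset determinesI\<close>)
  have ge: "(\<Sum>a\<in>A f. c a) \<le> cent M (joint P (\<lambda>_. A f)) Z" if "f \<in> J" for f
    unfolding chain[OF A[OF that]]
  proof (rule sum_mono)
    fix a assume a: "a \<in> A f"
    with A that have "a \<in> F" by auto
    \<comment> \<open>The values above \<open>a\<close> in \<open>F\<close> determine those above
      \<open>a\<close> in \<open>A f\<close>, so \<open>c a\<close> conditions on more.\<close>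
    then show "c a \<le> cent M (P a) (\<lambda>x. (?up (A f) a x, Z x))"
      unfolding c_def
      using A[OF that]
      by (intro cent_antimono P simple_function_Pair up Z determinesI)
         (unfold prod.inject joint_eq_iff, auto)
  qed
  have "real k * (cent M (joint P (\<lambda>_. F)) Z - real (card B) * L) \<le> real k * (\<Sum>a\<in>F - B. c a)"
  proof (rule mult_left_mono)
    have "cent M (joint P (\<lambda>_. F)) Z = (\<Sum>a\<in>F. c a)"
      unfolding c_def by (rule chain) simp
    also have "\<dots> = (\<Sum>a\<in>F - B. c a) + (\<Sum>a\<in>B. c a)"
      using B F by (metis sum.subset_diff)
    also have "(\<Sum>a\<in>B. c a) \<le> real (card B) * L"
      using B c_le by (intro sum_bounded_above) auto
    finally show "cent M (joint P (\<lambda>_. F)) Z - real (card B) * L \<le> (\<Sum>a\<in>F - B. c a)"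
      by simp
  qed simp
  also have "\<dots> = (\<Sum>a\<in>F - B. real k * c a)"
    by (rule sum_distrib_left)
  also have "\<dots> \<le> (\<Sum>a\<in>F - B. real (card {f \<in> J. a \<in> A f}) * c a)"
    using c_nonneg cover by (intro sum_mono mult_right_mono) auto
  also have "\<dots> \<le> (\<Sum>a\<in>F. real (card {f \<in> J. a \<in> A f}) * c a)"
    using F c_nonneg by (intro sum_mono2) auto
  also have "\<dots> = (\<Sum>a\<in>F. \<Sum>f\<in>J. if a \<in> A f then c a else 0)"
    using J by (intro sum.cong refl) (simp add: sum.If_cases Int_def)
  also have "\<dots> = (\<Sum>f\<in>J. \<Sum>a\<in>F. if a \<in> A f then c a else 0)"
    by (rule sum.swap)
  also have "\<dots> = (\<Sum>f\<in>J. \<Sum>a\<in>A f. c a)"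
    by (rule sum.cong[OF refl]) (simp add: F A sum.inter_restrict[symmetric] Int_absorb1)
  also have "\<dots> \<le> (\<Sum>f\<in>J. cent M (joint P (\<lambda>_. A f)) Z)"
    by (intro sum_mono ge)
  finally show ?thesis .
qed

text \<open>The correction \<open>W\<close> equals \<open>U\<close> where \<open>U'\<close> is wrong
  and \<open>None\<close> elsewhere. Together with \<open>U'\<close> it recovers \<open>U\<close>,
  so its entropy bounds the conditional entropy. The value \<open>None\<close> has probability at
  least 1 - \<delta>, and each other value at most \<delta>.\<close>

lemma cent_fano:
  assumes U: "simple_function M U" and U': "simple_function M U'"
    and \<delta>: "prob {x \<in> space M. U x \<noteq> U' x} \<le> \<delta>"
  shows "cent M U U' \<le> \<delta> + 2 * real (card (U ` space M)) * sqrt \<delta>"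
proof -
  let ?B = "{x \<in> space M. U x \<noteq> U' x}"
  define W where "W x = (if U x \<noteq> U' x then Some (U x) else None)" for x
  have W: "simple_function M W"
    unfolding W_def
    using simple_function_compose1[OF simple_function_Pair[OF U U'],
        of "\<lambda>(u, v). if u \<noteq> v then Some u else None"] by simp
  have B: "?B \<in> sets M"
    using simple_level_sets[OF simple_function_compose1[OF simple_function_Pair[OF U U'],
        of "\<lambda>(u, v). u \<noteq> v"], of True] by simp
  have fin: "finite (U ` space M)"
    using U by (rule simple_functionD)
  have "0 \<le> \<delta>"
    using \<delta> measure_nonneg order_trans by blast
  let ?e = "\<lambda>v. - (prob {y \<in> space M. W y = v} * ln (prob {y \<in> space M. W y = v}))"
  have "cent M U U' \<le> cent M W U'"
    using U W U' by (intro cent_mono_left determinesI) (auto simp: W_def split: if_splits)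
  also have "\<dots> \<le> ent M W"
    by (rule cent_le_ent[OF W U'])
  also have "ent M W = (\<Sum>v\<in>W ` space M. ?e v)"
    by (rule ent_eq_sum[OF W])
  \<comment> \<open>Values that are never attained contribute 0, so the sum may run over a set whose
    size depends on \<open>U\<close> alone.\<close>
  also have "\<dots> = (\<Sum>v\<in>insert None (Some ` U ` space M). ?e v)"
  proof (rule sum.mono_neutral_left)
    show "\<forall>v\<in>insert None (Some ` U ` space M) - W ` space M. ?e v = 0"
    proof
      fix v assume "v \<in> insert None (Some ` U ` space M) - W ` space M"
      then have "{y \<in> space M. W y = v} = {}" by auto
      then show "?e v = 0" by (metis measure_empty mult_zero_left neg_equal_zero)
    qed
  qed (use fin in \<open>auto simp: W_def\<close>)
  also have "\<dots> = ?e None + (\<Sum>v\<in>Some ` U ` space M. ?e v)"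
    using fin by (subst sum.insert) auto
  also have "?e None \<le> 1 - prob {y \<in> space M. W y = None}"
    by (rule entropy_term_le_complement) simp
  also have "\<dots> \<le> \<delta>"
  proof -
    have "{y \<in> space M. W y = None} = space M - ?B"
      by (auto simp: W_def)
    then show ?thesis
      using \<delta> prob_compl[OF B] by simp
  qed
  also have "(\<Sum>v\<in>Some ` U ` space M. ?e v) \<le> real (card (Some ` U ` space M)) * (2 * sqrt \<delta>)"
  proof (rule sum_bounded_above)
    fix v assume "v \<in> Some ` U ` space M"
    then have "prob {y \<in> space M. W y = v} \<le> prob ?B"
      by (intro finite_measure_mono B) (auto simp: W_def split: if_splits)
    with \<delta> have "sqrt (prob {y \<in> space M. W y = v}) \<le> sqrt \<delta>"
      by simp
    then show "?e v \<le> 2 * sqrt \<delta>"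
      using entropy_term_le_sqrt[of "prob {y \<in> space M. W y = v}"] by (smt (verit) measure_nonneg)
  qed
  also have "card (Some ` U ` space M) = card (U ` space M)"
    by (intro card_image) simp
  finally show ?thesis by simp
qed

text \<open>Here \<open>V\<close> need only determine a good approximation of \<open>U\<close>.
  Adding \<open>U\<close> to \<open>P\<close> and applying the chain rule gives H(P | V) \<le> H(P |
  U) + H(U | V), and the last term is at most H(U | U'), which Fano controls. The number \<delta>
  depends only on \<epsilon> and on how many values \<open>U\<close> takes, hence is chosen before
  \<open>V\<close>.\<close>

lemma cent_perturb:
  assumes P: "simple_function M P" and U: "simple_function M U" and "0 < \<epsilon>"
  obtains \<delta> where "0 < \<delta>"
    "\<And>V U'. simple_function M V \<Longrightarrow> simple_function M U' \<Longrightarrow> determines V U' \<Longrightarrow>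
      prob {x \<in> space M. U x \<noteq> U' x} \<le> \<delta> \<Longrightarrow> cent M P V \<le> cent M P U + \<epsilon>"
proof -
  define k where "k = real (card (U ` space M))"
  \<comment> \<open>With \<open>k\<close> the number of values of \<open>U\<close>, each of the two
    Fano terms \<delta> and 2 k sqrt \<delta> becomes at most \<epsilon> / 2; the summand 1 avoids a
    division by zero.\<close>
  define \<delta> where "\<delta> = min (\<epsilon> / 2) ((\<epsilon> / (4 * (k + 1)))\<^sup>2)"
  have k: "0 \<le> k" by (simp add: k_def)
  have "0 < \<delta>"
    using assms(3) k by (simp add: \<delta>_def)
  moreover have "cent M P V \<le> cent M P U + \<epsilon>"
    if V: "simple_function M V" and U': "simple_function M U'" and "determines V U'"
      and "prob {x \<in> space M. U x \<noteq> U' x} \<le> \<delta>" for V :: "'a \<Rightarrow> 'v" and U'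
  proof -
    have "cent M P V \<le> cent M (\<lambda>x. (P x, U x)) V"
      by (intro cent_mono_left P U V simple_function_Pair determinesI) simp
    also have "\<dots> = cent M P (\<lambda>x. (U x, V x)) + cent M U V"
      by (rule cent_chain[OF P U V])
    also have "cent M P (\<lambda>x. (U x, V x)) \<le> cent M P U"
      by (intro cent_antimono P U V simple_function_Pair determinesI) simp
    also have "cent M U V \<le> cent M U U'"
      by (rule cent_antimono[OF U V U' that(3)])
    also have "\<dots> \<le> \<delta> + 2 * k * sqrt \<delta>"
      unfolding k_def by (rule cent_fano[OF U U' that(4)])
    also have "\<dots> \<le> \<epsilon> / 2 + 2 * k * (\<epsilon> / (4 * (k + 1)))"
    proof (intro add_mono mult_left_mono)
      have "sqrt \<delta> \<le> sqrt ((\<epsilon> / (4 * (k + 1)))\<^sup>2)"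
        unfolding real_sqrt_le_iff \<delta>_def by (rule min.cobounded2)
      then show "sqrt \<delta> \<le> \<epsilon> / (4 * (k + 1))"
        using k assms(3) by simp
    qed (use k in \<open>auto simp: \<delta>_def\<close>)
    also have "\<dots> \<le> \<epsilon>"
      using k assms(3) by (simp add: field_simps)
    finally show ?thesis by simp
  qed
  ultimately show thesis
    by (rule that)
qed

end

section \<open>Entropy of actions of amenable groups\<close>

lemma folner_finite: "folner F \<Longrightarrow> finite (F n)"
  by (auto simp: folner_def)

text \<open>An empty \<open>F n\<close> makes the quotient 0, since division by 0 yields 0, whereas
  the quotients tend to 1.\<close>

lemma folner_card_pos:
  assumes "folner (F :: nat \<Rightarrow> 'g::group_add set)"
  shows "eventually (\<lambda>n. 0 < card (F n)) sequentially"
proof -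
  have "(\<lambda>n. real (card (F n \<inter> (\<lambda>h. 0 + h) ` F n)) / real (card (F n))) \<longlonglongrightarrow> 1"
    using assms unfolding folner_def by blast
  then have "eventually (\<lambda>n. real (card (F n \<inter> (\<lambda>h. 0 + h) ` F n)) / real (card (F n)) > 0) sequentially"
    by (rule order_tendstoD) simp
  then show ?thesis
    by eventually_elim (auto simp: zero_less_divide_iff split: if_splits)
qed

text \<open>For a single \<open>k\<close> the points in question form \<open>F n\<close> minus its
  left translate by \<open>k\<close>, whose proportion tends to 0 by the Foelner condition; a union
  bound handles finite \<open>K\<close>. The elements \<open>- k + a\<close> are exactly the
  \<open>f\<close> for which \<open>a\<close> lies in the right translate of \<open>K\<close> by
  \<open>f\<close>.\<close>

lemma folner_boundary:
  fixes F :: "nat \<Rightarrow> 'g::group_add set"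
  assumes F: "folner F" and K: "finite K"
  shows "(\<lambda>n. real (card {a \<in> F n. \<exists>k\<in>K. - k + a \<notin> F n}) / real (card (F n))) \<longlonglongrightarrow> 0"
proof (rule tendsto_sandwich[where f = "\<lambda>_. 0"])
  have "(\<lambda>n. 1 - real (card (F n \<inter> (\<lambda>h. k + h) ` F n)) / real (card (F n))) \<longlonglongrightarrow> 1 - 1" for k
    using F unfolding folner_def by (intro tendsto_diff tendsto_const) blast
  then have "(\<lambda>n. \<Sum>k\<in>K. 1 - real (card (F n \<inter> (\<lambda>h. k + h) ` F n)) / real (card (F n)))
      \<longlonglongrightarrow> (\<Sum>k\<in>K. 1 - 1)"
    by (intro tendsto_sum)
  then show "(\<lambda>n. \<Sum>k\<in>K. 1 - real (card (F n \<inter> (\<lambda>h. k + h) ` F n)) / real (card (F n))) \<longlonglongrightarrow> 0"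
    by simp
  show "eventually (\<lambda>n. real (card {a \<in> F n. \<exists>k\<in>K. - k + a \<notin> F n}) / real (card (F n)) \<le>
      (\<Sum>k\<in>K. 1 - real (card (F n \<inter> (\<lambda>h. k + h) ` F n)) / real (card (F n)))) sequentially"
    using folner_card_pos[OF F]
  proof eventually_elim
    case (elim n)
    note fin = folner_finite[OF F, of n]
    have shift: "{a \<in> F n. - k + a \<notin> F n} = F n - F n \<inter> (\<lambda>h. k + h) ` F n" for k
    proof -
      have "a \<in> (\<lambda>h. k + h) ` F n \<longleftrightarrow> - k + a \<in> F n" for a
      proof
        assume "- k + a \<in> F n"
        then have "k + (- k + a) \<in> (\<lambda>h. k + h) ` F n" by (rule imageI)
        then show "a \<in> (\<lambda>h. k + h) ` F n" by (simp add: add.assoc[symmetric])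
      qed (auto simp: add.assoc[symmetric])
      then show ?thesis by auto
    qed
    have "{a \<in> F n. \<exists>k\<in>K. - k + a \<notin> F n} = (\<Union>k\<in>K. {a \<in> F n. - k + a \<notin> F n})"
      by auto
    then have "real (card {a \<in> F n. \<exists>k\<in>K. - k + a \<notin> F n}) \<le>
        real (\<Sum>k\<in>K. card {a \<in> F n. - k + a \<notin> F n})"
      using card_UN_le[OF K, of "\<lambda>k. {a \<in> F n. - k + a \<notin> F n}"] by (simp only: of_nat_le_iff)
    also have "\<dots> = (\<Sum>k\<in>K. real (card (F n)) - real (card (F n \<inter> (\<lambda>h. k + h) ` F n)))"
      unfolding of_nat_sum
    proof (rule sum.cong[OF refl])
      fix k
      show "real (card {a \<in> F n. - k + a \<notin> F n}) =
          real (card (F n)) - real (card (F n \<inter> (\<lambda>h. k + h) ` F n))"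
        using fin by (simp add: shift card_Diff_subset of_nat_diff card_mono)
    qed
    finally have "real (card {a \<in> F n. \<exists>k\<in>K. - k + a \<notin> F n}) / real (card (F n)) \<le>
        (\<Sum>k\<in>K. real (card (F n)) - real (card (F n \<inter> (\<lambda>h. k + h) ` F n))) / real (card (F n))"
      by (intro divide_right_mono) auto
    also have "\<dots> = (\<Sum>k\<in>K. 1 - real (card (F n \<inter> (\<lambda>h. k + h) ` F n)) / real (card (F n)))"
      using elim by (simp add: sum_divide_distrib diff_divide_distrib)
    finally show ?case .
  qed
qed (auto intro!: always_eventually)

section \<open>Invariance of entropy under measure-preserving maps\<close>

lemma ent_comp:
  assumes f: "f \<in> M \<rightarrow>\<^sub>M N" and d: "distr M N f = N" and X: "simple_function N X"
  shows "ent M (\<lambda>x. X (f x)) = ent N X"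
proof -
  have lev: "{y \<in> space N. X y = v} \<in> sets N" for v
  proof -
    have "{y \<in> space N. X y = v} = X -` {v} \<inter> space N" by auto
    then show ?thesis using simple_functionD(2)[OF X, of "{v}"] by simp
  qed
  have "pr M (\<lambda>x. X (f x)) x = pr N X (f x)" for x
  proof -
    have "pr N X (f x) = measure (distr M N f) {y \<in> space N. X y = X (f x)}"
      by (simp add: d pr_def)
    also have "\<dots> = measure M (f -` {y \<in> space N. X y = X (f x)} \<inter> space M)"
      by (rule measure_distr[OF f lev])
    also have "f -` {y \<in> space N. X y = X (f x)} \<inter> space M = {y \<in> space M. X (f y) = X (f x)}"
      using measurable_space[OF f] by auto
    finally show ?thesis by (simp add: pr_def)
  qed
  then have "ent M (\<lambda>x. X (f x)) = (\<integral>x. - ln (pr N X (f x)) \<partial>M)"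
    by (simp add: ent_def)
  also have "\<dots> = (\<integral>x. - ln (pr N X x) \<partial>distr M N f)"
    by (intro integral_distr[symmetric] f borel_measurable_simple_function
        simple_function_compose1[OF simple_function_pr[OF X]])
  finally show ?thesis by (simp add: d ent_def)
qed

lemma cent_comp:
  assumes f: "f \<in> M \<rightarrow>\<^sub>M N" "distr M N f = N" and X: "simple_function N X" and Y: "simple_function N Y"
  shows "cent M (\<lambda>x. X (f x)) (\<lambda>x. Y (f x)) = cent N X Y"
  unfolding cent_def
  using ent_comp[OF f simple_function_Pair[OF X Y]] ent_comp[OF f Y] by simp

text \<open>The name of an orbit piece: a variable generating the join over g in \<open>F\<close> of
  the preimages of the partition given by \<open>P\<close>. Any family of maps is allowed, so that
  index type \<open>nat\<close> covers the iterates of a single map.\<close>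

definition gjoint :: "('g \<Rightarrow> 'x \<Rightarrow> 'x) \<Rightarrow> ('x \<Rightarrow> 'b) \<Rightarrow> 'g set \<Rightarrow> 'x \<Rightarrow> 'g \<Rightarrow> 'b option" where
  "gjoint T P F = joint (\<lambda>g x. P (T g x)) (\<lambda>_. F)"

lemma gjoint_eq_iff: "gjoint T P F x = gjoint T P F y \<longleftrightarrow> (\<forall>g\<in>F. P (T g x) = P (T g y))"
  by (simp add: gjoint_def joint_eq_iff)

text \<open>The infimum over all finite sets gives a value independent of any Foelner sequence;
  \<open>gent_tendsto\<close> shows that it is the Foelner limit.\<close>

definition gent :: "'x measure \<Rightarrow> ('g \<Rightarrow> 'x \<Rightarrow> 'x) \<Rightarrow> ('x \<Rightarrow> 'b) \<Rightarrow> real" where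
  "gent M T P = (INF K\<in>{K. finite K \<and> K \<noteq> {}}. ent M (gjoint T P K) / real (card K))"

section \<open>Entropy of a finite-valued variable under the group\<close>

locale full_measure_action = full_measure_set M \<Omega> for M :: "'x measure" and \<Omega> +
  fixes T :: "'g::{group_add,countable} \<Rightarrow> 'x \<Rightarrow> 'x"
  assumes action: "measure_preserving_action M T"
begin

lemma T_measurable: "T g \<in> M \<rightarrow>\<^sub>M M" and T_distr: "distr M M (T g) = M"
  using action by (auto simp: measure_preserving_action_def)

lemma T_space: "x \<in> space M \<Longrightarrow> T g x \<in> space M"
  using measurable_space[OF T_measurable] .

lemma T_zero: "x \<in> space M \<Longrightarrow> T 0 x = x"
  and T_add: "x \<in> space M \<Longrightarrow> T (g + h) x = T g (T h x)"
  using action by (auto simp: measure_preserving_action_def)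

lemma simple_T: "simple_function M P \<Longrightarrow> simple_function M (\<lambda>x. P (T g x))"
  by (rule simple_function_comp[OF T_measurable])

lemma simple_gjoint: "finite F \<Longrightarrow> simple_function M P \<Longrightarrow> simple_function M (gjoint T P F)"
  unfolding gjoint_def by (intro simple_function_joint_const simple_T)

lemma cent_translate:
  assumes K: "finite K" and P: "simple_function M P" and Q: "simple_function M Q"
  shows "cent M (gjoint T P ((\<lambda>k. k + f) ` K)) (\<lambda>x. Q (T f x)) = cent M (gjoint T P K) Q"
proof -
  have "cent M (gjoint T P ((\<lambda>k. k + f) ` K)) (\<lambda>x. Q (T f x)) =
      cent M (\<lambda>x. gjoint T P K (T f x)) (\<lambda>x. Q (T f x))"
    by (intro cent_cong determinesI simple_gjoint simple_T[where P = "gjoint T P K"] simple_T[OF Q] P finite_imageI K refl)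
       (simp_all add: gjoint_eq_iff T_add Omega_space)
  also have "\<dots> = cent M (gjoint T P K) Q"
    by (intro cent_comp T_measurable T_distr simple_gjoint K P Q)
  finally show ?thesis .
qed

text \<open>Shearer's inequality is applied to the right translates of \<open>K\<close> by the
  elements of \<open>F\<close>, cut down to \<open>F\<close>. A point \<open>a\<close> off the
  boundary lies in the translate by each \<open>- k + a\<close>; these are \<open>card K\<close>
  different elements of \<open>F\<close>. Every translate then contributes at most H(P^K | Q) by
  invariance.\<close>

lemma cent_gjoint_le:
  assumes F: "finite F" and K: "finite K" and P: "simple_function M P" and Q: "simple_function M Q"
  shows "real (card K) * (cent M (gjoint T P F) (gjoint T Q F) -
      real (card {a \<in> F. \<exists>k\<in>K. - k + a \<notin> F}) * ent M P) \<le>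
    real (card F) * cent M (gjoint T P K) Q"
proof -
  let ?A = "\<lambda>f. (\<lambda>k. k + f) ` K \<inter> F" and ?B = "{a \<in> F. \<exists>k\<in>K. - k + a \<notin> F}"
  \<comment> \<open>Shearer's inequality accepts any fixed linear order; countability of the group
    provides one through its enumeration.\<close>
  let ?r = "\<lambda>a b :: 'g. to_nat a < to_nat b"
  have "real (card K) * (cent M (gjoint T P F) (gjoint T Q F) - real (card ?B) * ent M P) \<le>
      (\<Sum>f\<in>F. cent M (gjoint T P (?A f)) (gjoint T Q F))"
    unfolding gjoint_def[of T P]
  proof (rule cent_shearer[where r = ?r])
    show "asymp_on F ?r" "transp_on F ?r" "totalp_on F ?r"
      by (auto intro!: asymp_onI transp_onI totalp_onI simp: not_less le_less)
    show "simple_function M (gjoint T Q F)"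
      by (intro simple_gjoint F Q)
    show "card K \<le> card {f \<in> F. a \<in> ?A f}" if a: "a \<in> F - ?B" for a
    proof -
      have "card K = card ((\<lambda>k. - k + a) ` K)"
        by (rule card_image[symmetric]) (auto simp: inj_on_def)
      also have "\<dots> \<le> card {f \<in> F. a \<in> ?A f}"
      proof (rule card_mono)
        show "(\<lambda>k. - k + a) ` K \<subseteq> {f \<in> F. a \<in> ?A f}"
        proof
          fix f assume "f \<in> (\<lambda>k. - k + a) ` K"
          then obtain k where k: "k \<in> K" "f = - k + a" by auto
          then have "k + f = a" by (simp add: add.assoc[symmetric])
          then have "a \<in> (\<lambda>k. k + f) ` K" using k(1) by blast
          then show "f \<in> {f \<in> F. a \<in> ?A f}" using a k by auto
        qed
      qed (use F in simp)
      finally show ?thesis .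
    qed
    show "ent M (\<lambda>x. P (T a x)) \<le> ent M P" for a
      using ent_comp[OF T_measurable T_distr P] by simp
  qed (use F P in \<open>auto intro: simple_T\<close>)
  also have "\<dots> \<le> (\<Sum>f\<in>F. cent M (gjoint T P K) Q)"
  proof (rule sum_mono)
    fix f assume f: "f \<in> F"
    let ?Kf = "(\<lambda>k. k + f) ` K"
    have "cent M (gjoint T P (?A f)) (gjoint T Q F) \<le> cent M (gjoint T P ?Kf) (gjoint T Q F)"
      by (intro cent_mono_left simple_gjoint P Q F finite_imageI finite_Int disjI1 K determinesI)
         (auto simp: gjoint_eq_iff)
    \<comment> \<open>Of the \<open>Q\<close>-values over \<open>F\<close> only the one at
      \<open>f\<close> is kept, since after translation to the unit the bound must be the same for
      every \<open>f\<close>.\<close>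
    also have "\<dots> \<le> cent M (gjoint T P ?Kf) (\<lambda>x. Q (T f x))"
      using f by (intro cent_antimono simple_gjoint simple_T P Q F finite_imageI K determinesI)
         (simp add: gjoint_eq_iff)
    also have "\<dots> = cent M (gjoint T P K) Q"
      by (rule cent_translate[OF K P Q])
    finally show "cent M (gjoint T P (?A f)) (gjoint T Q F) \<le> cent M (gjoint T P K) Q" .
  qed
  finally show ?thesis by simp
qed

lemma eventually_cent_gjoint_le:
  assumes F: "folner F" and K: "finite K" "K \<noteq> {}" and P: "simple_function M P"
    and Q: "simple_function M Q" and "0 < \<epsilon>"
  shows "eventually (\<lambda>n. cent M (gjoint T P (F n)) (gjoint T Q (F n)) / real (card (F n)) <
    cent M (gjoint T P K) Q / real (card K) + \<epsilon>) sequentially"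
proof -
  have "(\<lambda>n. cent M (gjoint T P K) Q / real (card K) +
      real (card {a \<in> F n. \<exists>k\<in>K. - k + a \<notin> F n}) / real (card (F n)) * ent M P) \<longlonglongrightarrow>
      cent M (gjoint T P K) Q / real (card K) + 0 * ent M P"
    by (intro tendsto_intros folner_boundary F K)
  then have "eventually (\<lambda>n. cent M (gjoint T P K) Q / real (card K) +
      real (card {a \<in> F n. \<exists>k\<in>K. - k + a \<notin> F n}) / real (card (F n)) * ent M P <
      cent M (gjoint T P K) Q / real (card K) + \<epsilon>) sequentially"
    by (rule order_tendstoD(2)) (use \<open>0 < \<epsilon>\<close> in simp)
  then show ?thesis
    using folner_card_pos[OF F]
  proof eventually_elim
    case (elim n)
    have k: "0 < real (card K)"
      using K by (simp add: card_gt_0_iff)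
    have "real (card K) * (cent M (gjoint T P (F n)) (gjoint T Q (F n)) -
      real (card {a \<in> F n. \<exists>k\<in>K. - k + a \<notin> F n}) * ent M P) \<le>
      real (card (F n)) * cent M (gjoint T P K) Q"
      by (intro cent_gjoint_le folner_finite F K P Q)
    with k elim(2) have "cent M (gjoint T P (F n)) (gjoint T Q (F n)) / real (card (F n)) \<le>
      cent M (gjoint T P K) Q / real (card K) +
      real (card {a \<in> F n. \<exists>k\<in>K. - k + a \<notin> F n}) / real (card (F n)) * ent M P"
      by (simp add: field_simps)
    with elim(1) show ?case by linarith
  qed
qed

lemma bdd_below_ent_gjoint:
  assumes "simple_function M P"
  shows "bdd_below ((\<lambda>K. ent M (gjoint T P K) / real (card K)) ` {K. finite K \<and> K \<noteq> {}})"
  using assms by (intro bdd_belowI[where m = 0]) (auto intro!: divide_nonneg_nonneg ent_nonneg simple_gjoint)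

text \<open>The lower estimate is the definition as an infimum. For the upper one a nearly optimal
  \<open>K\<close> is compared with large Foelner sets by \<open>eventually_cent_gjoint_le\<close>,
  with a constant \<open>Q\<close> so that the conditioning disappears.\<close>

lemma gent_tendsto:
  assumes F: "folner F" and P: "simple_function M P"
  shows "(\<lambda>n. ent M (gjoint T P (F n)) / real (card (F n))) \<longlonglongrightarrow> gent M T P"
proof (rule order_tendstoI)
  fix a assume "a < gent M T P"
  show "eventually (\<lambda>n. a < ent M (gjoint T P (F n)) / real (card (F n))) sequentially"
    using folner_card_pos[OF F]
  proof eventually_elim
    case (elim n)
    have "gent M T P \<le> ent M (gjoint T P (F n)) / real (card (F n))"
      unfolding gent_def using elim
      by (intro cINF_lower bdd_below_ent_gjoint P) (auto simp: card_gt_0_iff)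
    with \<open>a < gent M T P\<close> show ?case by simp
  qed
next
  fix a assume "gent M T P < a"
  then obtain K where K: "finite K" "K \<noteq> {}" "ent M (gjoint T P K) / real (card K) < a"
    unfolding gent_def
    by (subst (asm) cINF_less_iff[OF _ bdd_below_ent_gjoint[OF P]]) auto
  have const: "cent M (gjoint T P F) (gjoint T (\<lambda>_. ()) F') = ent M (gjoint T P F)"
    if "finite F" for F F' :: "'g set"
  proof -
    have "gjoint T (\<lambda>_. ()) F' = (\<lambda>_ i. if i \<in> F' then Some () else None)"
      by (simp add: gjoint_def joint_def fun_eq_iff)
    then show ?thesis
      using cent_const[OF simple_gjoint[OF that P]] by simp
  qed
  have "eventually (\<lambda>n. cent M (gjoint T P (F n)) (gjoint T (\<lambda>_. ()) (F n)) / real (card (F n)) <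
    cent M (gjoint T P K) (\<lambda>_. ()) / real (card K) + (a - ent M (gjoint T P K) / real (card K))) sequentially"
    using K by (intro eventually_cent_gjoint_le F P) auto
  then show "eventually (\<lambda>n. ent M (gjoint T P (F n)) / real (card (F n)) < a) sequentially"
    using K by (simp add: const folner_finite[OF F] cent_const simple_gjoint P)
qed

lemma gent_nonneg:
  assumes "simple_function M P"
  shows "0 \<le> gent M T P"
  unfolding gent_def using assms
  by (intro cINF_greatest) (auto intro!: divide_nonneg_nonneg ent_nonneg simple_gjoint exI[of _ "{0}"])

lemma gent_diff_tendsto:
  assumes F: "folner F" and P: "simple_function M P" and Q: "simple_function M Q"
  shows "(\<lambda>n. cent M (gjoint T P (F n)) (gjoint T Q (F n)) / real (card (F n)))
    \<longlonglongrightarrow> gent M T (\<lambda>x. (P x, Q x)) - gent M T Q"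
proof -
  have "ent M (gjoint T (\<lambda>x. (P x, Q x)) (F n)) = ent M (\<lambda>x. (gjoint T P (F n) x, gjoint T Q (F n) x))" for n
    by (intro ent_cong determinesI simple_gjoint simple_function_Pair P Q folner_finite F)
       (auto simp: gjoint_eq_iff)
  then have "cent M (gjoint T P (F n)) (gjoint T Q (F n)) / real (card (F n)) =
      ent M (gjoint T (\<lambda>x. (P x, Q x)) (F n)) / real (card (F n)) -
      ent M (gjoint T Q (F n)) / real (card (F n))" for n
    by (simp add: cent_def diff_divide_distrib)
  then show ?thesis
    by (simp only:) (intro tendsto_diff gent_tendsto F P Q simple_function_Pair)
qed

text \<open>Conditioning on \<open>Q\<close> alone, rather than on its values over \<open>K\<close>,
  is what is wanted later: \<open>Q\<close> will itself encode a whole block together with the order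
  on \<open>K\<close>.\<close>

lemma gent_diff_le:
  fixes F :: "nat \<Rightarrow> 'g set"
  assumes F: "folner F" and P: "simple_function M P" and Q: "simple_function M Q"
    and K: "finite K" "K \<noteq> {}"
  shows "gent M T (\<lambda>x. (P x, Q x)) - gent M T Q \<le> cent M (gjoint T P K) Q / real (card K)"
proof (rule field_le_epsilon)
  fix \<epsilon> :: real assume "0 < \<epsilon>"
  show "gent M T (\<lambda>x. (P x, Q x)) - gent M T Q \<le> cent M (gjoint T P K) Q / real (card K) + \<epsilon>"
    by (rule tendsto_upperbound[OF gent_diff_tendsto[OF F P Q]])
       (auto intro: eventually_mono[OF eventually_cent_gjoint_le[OF F K P Q \<open>0 < \<epsilon>\<close>]])
qed

lemma gent_diff_approx:
  fixes F :: "nat \<Rightarrow> 'g set"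
  assumes F: "folner F" and P: "simple_function M P" and Q: "simple_function M Q" and "0 < \<epsilon>"
  obtains K where "finite K" "K \<noteq> {}"
    "cent M (gjoint T P K) (gjoint T Q K) \<le>
      real (card K) * (gent M T (\<lambda>x. (P x, Q x)) - gent M T Q + \<epsilon>)"
proof -
  have "eventually (\<lambda>n. cent M (gjoint T P (F n)) (gjoint T Q (F n)) / real (card (F n)) <
      gent M T (\<lambda>x. (P x, Q x)) - gent M T Q + \<epsilon>) sequentially"
    using \<open>0 < \<epsilon>\<close> by (intro order_tendstoD(2)[OF gent_diff_tendsto[OF F P Q]]) simp
  with folner_card_pos[OF F] have "eventually (\<lambda>n. 0 < card (F n) \<and>
      cent M (gjoint T P (F n)) (gjoint T Q (F n)) / real (card (F n)) <
      gent M T (\<lambda>x. (P x, Q x)) - gent M T Q + \<epsilon>) sequentially"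
    by eventually_elim simp
  then obtain n where n: "0 < card (F n)"
      "cent M (gjoint T P (F n)) (gjoint T Q (F n)) / real (card (F n)) <
      gent M T (\<lambda>x. (P x, Q x)) - gent M T Q + \<epsilon>"
    by (auto simp: eventually_sequentially)
  show thesis
    by (rule that[of "F n"]) (use n in \<open>auto simp: card_gt_0_iff field_simps\<close>)
qed

end

section \<open>Orders of type \<open>\<int>\<close> and the successor map\<close>

definition order_succ :: "('g \<Rightarrow> 'g \<Rightarrow> bool) \<Rightarrow> 'g \<Rightarrow> 'g \<Rightarrow> bool" where
  "order_succ r a s \<longleftrightarrow> r a s \<and> (\<nexists>g. r a g \<and> r g s)"

lemma Z_orders_irrefl: "r \<in> Z_orders \<Longrightarrow> \<not> r a a"
  and Z_orders_trans: "r \<in> Z_orders \<Longrightarrow> r a b \<Longrightarrow> r b c \<Longrightarrow> r a c"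
  and Z_orders_total: "r \<in> Z_orders \<Longrightarrow> a \<noteq> b \<Longrightarrow> r a b \<or> r b a"
  and Z_orders_finite: "r \<in> Z_orders \<Longrightarrow> r a b \<Longrightarrow> finite (order_interval r a b)"
  and Z_orders_above: "r \<in> Z_orders \<Longrightarrow> \<exists>b. r a b"
  and Z_orders_below: "r \<in> Z_orders \<Longrightarrow> \<exists>b. r b a"
  by (auto simp: Z_orders_def strict_linear_order_def irreflp_def totalp_on_def dest: transpD)

lemma Z_orders_asym: "r \<in> Z_orders \<Longrightarrow> r a b \<Longrightarrow> \<not> r b a"
  using Z_orders_trans[of r a b a] Z_orders_irrefl[of r a] by blast

text \<open>Reversal exchanges successors and predecessors, so facts about predecessors need no
  separate proof.\<close>

lemma Z_orders_converse:
  assumes r: "r \<in> Z_orders"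
  shows "r\<inverse>\<inverse> \<in> Z_orders"
proof -
  have "order_interval r\<inverse>\<inverse> a b = order_interval r b a" for a b
    unfolding order_interval_def by auto
  moreover have "Ex (r\<inverse>\<inverse> m) \<longleftrightarrow> (\<exists>a. r a m)" for m
    by auto
  ultimately show ?thesis
    using r unfolding Z_orders_def strict_linear_order_def by simp
qed

lemma order_succ_converse: "order_succ r\<inverse>\<inverse> a b \<longleftrightarrow> order_succ r b a"
  by (auto simp: order_succ_def)

text \<open>Choose any \<open>b\<close> above \<open>a\<close>. The elements above \<open>a\<close>
  and up to \<open>b\<close> form a finite nonempty set, and a minimal one among them is the
  successor.\<close>

lemma ex_order_succ:
  assumes r: "r \<in> Z_orders"
  shows "\<exists>s. order_succ r a s"
proof -
  obtain b where b: "r a b"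
    using Z_orders_above[OF r] by auto
  let ?A = "{g. r a g \<and> (r g b \<or> g = b)}"
  have "?A \<subseteq> order_interval r a b"
    by (auto simp: order_interval_def)
  then have "finite ?A"
    using Z_orders_finite[OF r b] finite_subset by blast
  moreover have "asymp_on ?A r"
    by (intro asymp_onI Z_orders_asym[OF r])
  moreover have "transp_on ?A r"
    by (intro transp_onI) (rule Z_orders_trans[OF r])
  moreover have "?A \<noteq> {}"
    using b by auto
  ultimately obtain m where m: "m \<in> ?A" "\<And>x. x \<in> ?A \<Longrightarrow> x \<noteq> m \<Longrightarrow> \<not> r x m"
    using Finite_Set.bex_min_element[of ?A r] by blast
  have "order_succ r a m"
    unfolding order_succ_def
  proof (intro conjI notI)
    show "r a m" using m(1) by simp
    assume "\<exists>g. r a g \<and> r g m"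
    then obtain g where g: "r a g" "r g m" by auto
    then have "g \<in> ?A"
      using m(1) Z_orders_trans[OF r, of g m b] by auto
    with m(2) g Z_orders_irrefl[OF r] show False by auto
  qed
  then show ?thesis ..
qed

lemma order_succ_unique:
  assumes r: "r \<in> Z_orders" and "order_succ r a s" "order_succ r a t"
  shows "s = t"
  using assms Z_orders_total[OF r, of s t] unfolding order_succ_def by blast

lemma ex1_order_succ: "r \<in> Z_orders \<Longrightarrow> \<exists>!s. order_succ r a s"
  using ex_order_succ[of r a] order_succ_unique[of r a] by blast

lemma ex1_order_pred: "r \<in> Z_orders \<Longrightarrow> \<exists>!p. order_succ r p a"
  using ex1_order_succ[OF Z_orders_converse, of r a] by (simp add: order_succ_converse)

lemma unit_succ_eq_iff:
  assumes "r \<in> Z_orders"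
  shows "unit_succ r = s \<longleftrightarrow> order_succ r 0 s"
proof -
  have "unit_succ r = (THE s. order_succ r 0 s)"
    by (simp add: unit_succ_def order_succ_def)
  then show ?thesis
    using theI'[OF ex1_order_succ[OF assms, of 0]] order_succ_unique[OF assms, of 0] by auto
qed

lemma order_act_act: "order_act g (order_act h r) = order_act (g + h) r"
  by (simp add: order_act_def add.assoc)

lemma order_act_zero [simp]: "order_act 0 r = r"
  by (simp add: order_act_def)

lemma order_succ_act: "order_succ (order_act g r) a s \<longleftrightarrow> order_succ r (a + g) (s + g)"
proof -
  have "(\<exists>x. r (a + g) (x + g) \<and> r (x + g) (s + g)) \<longleftrightarrow> (\<exists>x. r (a + g) x \<and> r x (s + g))"
    by (metis diff_add_cancel)
  then show ?thesis
    by (simp add: order_succ_def order_act_def)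
qed

lemma Z_orders_act:
  fixes r :: "'g::group_add \<Rightarrow> 'g \<Rightarrow> bool"
  assumes r: "r \<in> Z_orders"
  shows "order_act g r \<in> Z_orders"
proof -
  have "finite (order_interval (order_act g r) a b)" if "order_act g r a b" for a b
  proof -
    have "order_interval (order_act g r) a b = (\<lambda>x. x + g) -` order_interval r (a + g) (b + g)"
      by (auto simp: order_interval_def order_act_def)
    then show ?thesis
      using that Z_orders_finite[OF r]
      by (auto intro!: finite_vimageI simp: order_act_def inj_on_def)
  qed
  moreover have "\<exists>y. r y (a + g)" "\<exists>y. r (a + g) y" for a
    using Z_orders_above[OF r] Z_orders_below[OF r] by auto
  then have "\<exists>y. r (y + g) (a + g)" "\<exists>y. r (a + g) (y + g)" for a
    by (metis diff_add_cancel)+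
  moreover have "r (a + g) (b + g) \<or> r (b + g) (a + g)" if "a \<noteq> b" for a b
    using that by (intro Z_orders_total[OF r]) simp
  ultimately show ?thesis
    using Z_orders_irrefl[OF r] Z_orders_trans[OF r]
    by (auto simp: Z_orders_def strict_linear_order_def order_act_def irreflp_def totalp_on_def transp_def)
qed

text \<open>The recursion imitates the iteration of \<open>S\<close>: having reached
  \<open>g\<close>, take the unit successor in the order translated by \<open>g\<close> and multiply
  it on the left, as composing the action requires.\<close>

primrec order_nth :: "('g::group_add \<Rightarrow> 'g \<Rightarrow> bool) \<Rightarrow> nat \<Rightarrow> 'g" where
  "order_nth r 0 = 0"
| "order_nth r (Suc i) = unit_succ (order_act (order_nth r i) r) + order_nth r i"

lemma order_succ_nth:
  assumes "r \<in> Z_orders"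
  shows "order_succ r (order_nth r i) (order_nth r (Suc i))"
proof -
  have "order_succ (order_act (order_nth r i) r) 0 (unit_succ (order_act (order_nth r i) r))"
    using unit_succ_eq_iff[OF Z_orders_act[OF assms]] by blast
  then show ?thesis
    by (simp add: order_succ_act)
qed

lemma order_nth_less:
  assumes r: "r \<in> Z_orders" and "i < j"
  shows "r (order_nth r i) (order_nth r j)"
  using assms(2)
proof (induction j)
  case (Suc j)
  have "r (order_nth r j) (order_nth r (Suc j))"
    using order_succ_nth[OF r] by (simp only: order_succ_def)
  with Suc show ?case
    using Z_orders_trans[OF r] by (metis less_Suc_eq)
qed simp

lemma order_nth_inj:
  assumes "r \<in> Z_orders"
  shows "inj (order_nth r)"
  using order_nth_less[OF assms] Z_orders_irrefl[OF assms]
  by (intro injI) (metis linorder_neqE_nat)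

text \<open>If \<open>k\<close> were skipped, all iterated successors of the unit would stay below
  \<open>k\<close>, and infinitely many distinct elements would lie in a finite interval.\<close>

lemma ex_order_nth:
  assumes r: "r \<in> Z_orders" and k: "r 0 k"
  shows "\<exists>i>0. order_nth r i = k"
proof (rule ccontr)
  assume neg: "\<not> ?thesis"
  have below: "r (order_nth r i) k" for i
  proof (induction i)
    case (Suc i)
    have "order_nth r (Suc i) \<noteq> k"
      using neg by blast
    moreover have "\<not> r k (order_nth r (Suc i))"
      using order_succ_nth[OF r, of i] Suc by (auto simp only: order_succ_def)
    ultimately show ?case
      using Z_orders_total[OF r] by blast
  qed (use k in simp)
  have "order_nth r i \<in> order_interval r 0 k" for i
    using below[of i] order_nth_less[OF r, of 0 i] by (cases i) (auto simp: order_interval_def simp del: order_nth.simps(2))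
  then have "range (order_nth r) \<subseteq> order_interval r 0 k"
    by auto
  then have "finite (range (order_nth r))"
    using Z_orders_finite[OF r k] finite_subset by blast
  with finite_imageD[OF _ order_nth_inj[OF r]] show False
    by simp
qed

lemma order_successor_map_pow: "(order_successor_map ^^ i) r = order_act (order_nth r i) r"
  by (induction i) (simp_all add: order_successor_map_def order_act_act)

text \<open>The equation says that \<open>p\<close> is the predecessor of the unit: the unit
  successor after translation by \<open>p\<close> is \<open>- p\<close> exactly if
  \<open>- p + p = 0\<close> succeeds \<open>p\<close> in \<open>r\<close>. Stated this way,
  measurability reduces to that of \<open>unit_succ\<close>.\<close>

definition order_predecessor_map :: "('g::group_add \<Rightarrow> 'g \<Rightarrow> bool) \<Rightarrow> ('g \<Rightarrow> 'g \<Rightarrow> bool)" where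
  "order_predecessor_map r = order_act (THE p. unit_succ (order_act p r) = - p) r"

lemma ex1_pred_shift:
  assumes "r \<in> Z_orders"
  shows "\<exists>!p. unit_succ (order_act p r) = - p"
  using ex1_order_pred[OF assms, of 0]
  by (simp add: unit_succ_eq_iff[OF Z_orders_act[OF assms]] order_succ_act)

lemma order_predecessor_successor:
  assumes r: "r \<in> Z_orders"
  shows "order_predecessor_map (order_successor_map r) = r"
proof -
  let ?s = "unit_succ r"
  have "(THE p. unit_succ (order_act p (order_act ?s r)) = - p) = - ?s"
    by (rule the1_equality[OF ex1_pred_shift[OF Z_orders_act[OF r]]]) (simp add: order_act_act)
  then show ?thesis
    by (simp add: order_predecessor_map_def order_successor_map_def order_act_act)
qed

lemma order_predecessor_successor_pow:
  assumes r: "r \<in> Z_orders"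
  shows "(order_predecessor_map ^^ j) ((order_successor_map ^^ j) r) = r"
proof (induction j)
  case (Suc j)
  have "(order_successor_map ^^ j) r \<in> Z_orders"
    unfolding order_successor_map_pow by (rule Z_orders_act[OF r])
  then have "order_predecessor_map ((order_successor_map ^^ Suc j) r) = (order_successor_map ^^ j) r"
    by (simp add: order_predecessor_successor)
  then show ?case
    using Suc by (simp only: funpow_Suc_right comp_apply)
qed simp

section \<open>Measurability on the space of orders\<close>

lemma measurable_funpow:
  assumes "f \<in> N \<rightarrow>\<^sub>M N"
  shows "(f ^^ i) \<in> N \<rightarrow>\<^sub>M N"
proof (induction i)
  case (Suc i)
  show ?case
    unfolding funpow.simps by (rule measurable_comp[OF Suc assms])
qed (simp add: measurable_id[unfolded id_def] id_def)

locale multiorder_measure =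
  fixes \<nu> :: "('g::{group_add,countable} \<Rightarrow> 'g \<Rightarrow> bool) measure"
  assumes multiorder: "multiorder \<nu>"
begin

lemma space_nu: "space \<nu> = Z_orders"
proof -
  have "space \<nu> = space (restrict_space borel Z_orders)"
    using multiorder by (intro sets_eq_imp_space_eq) (simp add: multiorder_def)
  then show ?thesis by (simp add: space_restrict_space)
qed

lemma order_act_measurable: "order_act g \<in> \<nu> \<rightarrow>\<^sub>M \<nu>"
  using multiorder by (simp add: multiorder_def measure_preserving_action_def)

lemma rel_sets: "{r \<in> space \<nu>. r a b} \<in> sets \<nu>"
proof -
  have "continuous_on UNIV (\<lambda>r :: 'g \<Rightarrow> 'g \<Rightarrow> bool. r a b)"
    by (rule continuous_on_product_then_coordinatewise[OF continuous_on_product_coordinates])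
  \<comment> \<open>The set \<open>{True}\<close> is an open ray of \<open>bool\<close>, hence open
    in its order topology.\<close>
  moreover have "{True} = {False<..}"
    by auto
  then have "open {True}"
    by (metis open_greaterThan)
  ultimately have "open ((\<lambda>r :: 'g \<Rightarrow> 'g \<Rightarrow> bool. r a b) -` {True})"
    by (intro open_vimage)
  then have "Z_orders \<inter> (\<lambda>r :: 'g \<Rightarrow> 'g \<Rightarrow> bool. r a b) -` {True} \<in> sets (restrict_space borel Z_orders)"
    by (subst sets_restrict_space) auto
  moreover have "Z_orders \<inter> (\<lambda>r :: 'g \<Rightarrow> 'g \<Rightarrow> bool. r a b) -` {True} = {r \<in> space \<nu>. r a b}"
    by (auto simp: space_nu)
  ultimately show ?thesis
    using multiorder by (simp add: multiorder_def)
qed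

lemma unit_succ_measurable: "unit_succ \<in> \<nu> \<rightarrow>\<^sub>M count_space UNIV"
proof (rule measurable_count_space_eq2_countable[THEN iffD2], intro conjI ballI)
  fix s :: 'g
  have "unit_succ -` {s} \<inter> space \<nu> = {r \<in> space \<nu>. r 0 s} -
      (\<Union>g. {r \<in> space \<nu>. r 0 g} \<inter> {r \<in> space \<nu>. r g s})"
  proof -
    have "unit_succ r = s \<longleftrightarrow> r 0 s \<and> (\<forall>g. \<not> (r 0 g \<and> r g s))" if "r \<in> space \<nu>" for r
      using that unit_succ_eq_iff[of r s] by (simp add: space_nu order_succ_def)
    then show ?thesis by blast
  qed
  also have "\<dots> \<in> sets \<nu>"
    by (intro sets.Diff sets.countable_UN'' sets.Int rel_sets countableI_type)
  finally show "unit_succ -` {s} \<inter> space \<nu> \<in> sets \<nu>" .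
qed auto

lemma order_act_by_measurable:
  "c \<in> \<nu> \<rightarrow>\<^sub>M count_space UNIV \<Longrightarrow> (\<lambda>r. order_act (c r) r) \<in> \<nu> \<rightarrow>\<^sub>M \<nu>"
  by (rule measurable_compose_countable[OF order_act_measurable])

lemma order_successor_map_measurable: "order_successor_map \<in> \<nu> \<rightarrow>\<^sub>M \<nu>"
  unfolding order_successor_map_def[abs_def] by (intro order_act_by_measurable unit_succ_measurable)

lemma order_nth_measurable: "(\<lambda>r. order_nth r i) \<in> \<nu> \<rightarrow>\<^sub>M count_space UNIV"
proof (induction i)
  case (Suc i)
  have "(\<lambda>r. unit_succ (order_act (order_nth r i) r)) \<in> \<nu> \<rightarrow>\<^sub>M count_space UNIV"
    by (rule measurable_compose[OF order_act_by_measurable[OF Suc] unit_succ_measurable])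
  then have "(\<lambda>r. unit_succ (order_act (order_nth r i) r) + order_nth r i) \<in> \<nu> \<rightarrow>\<^sub>M count_space UNIV"
    by (rule measurable_compose_countable[rotated, where f = "\<lambda>g r. g + order_nth r i"])
       (rule measurable_compose[OF Suc], simp)
  then show ?case by simp
qed simp

lemma order_predecessor_map_measurable: "order_predecessor_map \<in> \<nu> \<rightarrow>\<^sub>M \<nu>"
  unfolding order_predecessor_map_def[abs_def]
proof (rule order_act_by_measurable)
  show "(\<lambda>r. THE p. unit_succ (order_act p r) = - p) \<in> \<nu> \<rightarrow>\<^sub>M count_space UNIV"
  proof (rule measurable_count_space_eq2_countable[THEN iffD2], intro conjI ballI)
    fix p :: 'g
    have "(THE p. unit_succ (order_act p r) = - p) = p \<longleftrightarrow> unit_succ (order_act p r) = - p"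
      if "r \<in> Z_orders" for r
      using theI'[OF ex1_pred_shift[OF that]] ex1_pred_shift[OF that] by metis
    then have "(\<lambda>r. THE p. unit_succ (order_act p r) = - p) -` {p} \<inter> space \<nu> =
        (\<lambda>r. unit_succ (order_act p r)) -` {- p} \<inter> space \<nu>"
      by (auto simp: space_nu)
    also have "\<dots> \<in> sets \<nu>"
      by (rule measurable_sets[OF measurable_compose[OF order_act_measurable unit_succ_measurable]]) simp
    finally show "(\<lambda>r. THE p. unit_succ (order_act p r) = - p) -` {p} \<inter> space \<nu> \<in> sets \<nu>" .
  qed auto
qed

end

text \<open>Equivariance is exact on \<Omega>, for all \<open>g\<close> simultaneously, but \<Omega>
  need not be invariant: what is needed at \<open>T g x\<close> follows from the assumption at
  \<open>x\<close>.\<close>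

locale multiorder_factor = full_measure_action M \<Omega> T + multiorder_measure \<nu>
  for M :: "'x measure" and \<Omega> and T :: "'g::{group_add,countable} \<Rightarrow> 'x \<Rightarrow> 'x"
    and \<nu> :: "('g \<Rightarrow> 'g \<Rightarrow> bool) measure" +
  fixes \<phi> :: "'x \<Rightarrow> 'g \<Rightarrow> 'g \<Rightarrow> bool"
  assumes phi_measurable: "\<phi> \<in> M \<rightarrow>\<^sub>M \<nu>" and phi_distr: "distr M \<nu> \<phi> = \<nu>"
    and equivariant: "x \<in> \<Omega> \<Longrightarrow> \<phi> (T g x) = order_act g (\<phi> x)"
begin

abbreviation S :: "'x \<Rightarrow> 'x" where "S \<equiv> successor_map T \<phi>"

lemma phi_Z: "x \<in> space M \<Longrightarrow> \<phi> x \<in> Z_orders"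
  using measurable_space[OF phi_measurable] by (simp add: space_nu)

lemma S_pow: "x \<in> \<Omega> \<Longrightarrow> (S ^^ i) x = T (order_nth (\<phi> x) i) x"
  by (induction i) (simp_all add: T_zero T_add Omega_space successor_map_def equivariant)

lemma phi_S_pow: "x \<in> \<Omega> \<Longrightarrow> \<phi> ((S ^^ i) x) = (order_successor_map ^^ i) (\<phi> x)"
  by (simp add: S_pow equivariant order_successor_map_pow)

lemma unit_succ_phi_measurable: "(\<lambda>x. unit_succ (\<phi> x)) \<in> M \<rightarrow>\<^sub>M count_space UNIV"
  by (rule measurable_compose[OF phi_measurable unit_succ_measurable])

lemma S_measurable: "S \<in> M \<rightarrow>\<^sub>M M"
  unfolding successor_map_def[abs_def]
  by (rule measurable_compose_countable[OF T_measurable unit_succ_phi_measurable])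

lemma emeasure_Omega:
  assumes "A \<in> sets M"
  shows "emeasure M A = emeasure M (A \<inter> \<Omega>)"
  using prob_Omega[OF assms] by (simp add: emeasure_eq_measure)

text \<open>Cutting the domain according to the group element that \<open>S\<close> applies and the range according to
  the group element that leads back to the predecessor turns \<open>S\<close> into translations.\<close>

lemma S_distr: "distr M M S = M"
proof (rule measure_eqI)
  fix A assume "A \<in> sets (distr M M S)"
  then have A: "A \<in> sets M" by simp
  define B where "B g = {x \<in> space M. unit_succ (\<phi> x) = g}" for g
  define C where "C g = {y \<in> space M. unit_succ (\<phi> (T (- g) y)) = g}" for g
  have B: "B g \<in> sets M" for g
    using measurable_sets[OF unit_succ_phi_measurable, of "{g}"]
    by (simp add: B_def vimage_def Int_def conj_commute)
  have C: "C g \<in> sets M" for g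
    using measurable_sets[OF measurable_compose[OF T_measurable unit_succ_phi_measurable], of "{g}" "- g"]
    by (simp add: C_def vimage_def Int_def conj_commute)
  have TA: "T g -` A \<inter> space M \<in> sets M" for g
    by (rule measurable_sets[OF T_measurable A])
  have "emeasure M (S -` A \<inter> space M) = emeasure M (\<Union>g. B g \<inter> (T g -` A \<inter> space M))"
    by (rule arg_cong[where f = "emeasure M"]) (auto simp: B_def successor_map_def)
  also have "\<dots> = (\<integral>\<^sup>+ g. emeasure M (B g \<inter> (T g -` A \<inter> space M)) \<partial>count_space UNIV)"
    by (rule emeasure_UN_countable) (use B TA in \<open>auto simp: disjoint_family_on_def B_def\<close>)
  also have "\<dots> = (\<integral>\<^sup>+ g. emeasure M (A \<inter> C g \<inter> \<Omega>) \<partial>count_space UNIV)"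
  proof (rule nn_integral_cong)
    fix g
    have "B g \<inter> (T g -` A \<inter> space M) = T g -` (A \<inter> C g) \<inter> space M"
      by (auto simp: B_def C_def T_space T_add[symmetric] T_zero)
    then have "emeasure M (B g \<inter> (T g -` A \<inter> space M)) = emeasure (distr M M (T g)) (A \<inter> C g)"
      using emeasure_distr[OF T_measurable sets.Int[OF A C], of g g] by simp
    also have "\<dots> = emeasure M (A \<inter> C g \<inter> \<Omega>)"
      unfolding T_distr by (rule emeasure_Omega) (intro sets.Int A C)
    finally show "emeasure M (B g \<inter> (T g -` A \<inter> space M)) = emeasure M (A \<inter> C g \<inter> \<Omega>)" .
  qed
  also have "\<dots> = emeasure M (\<Union>g. A \<inter> C g \<inter> \<Omega>)"
  proof (rule emeasure_UN_countable[symmetric])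
    show "disjoint_family_on (\<lambda>g. A \<inter> C g \<inter> \<Omega>) UNIV"
      unfolding disjoint_family_on_def
    proof (intro ballI impI)
      fix g h :: 'g assume "g \<noteq> h"
      have "g = h" if "y \<in> C g" "y \<in> C h" "y \<in> \<Omega>" for y
      proof -
        have "unit_succ (order_act (- g) (\<phi> y)) = - (- g)" "unit_succ (order_act (- h) (\<phi> y)) = - (- h)"
          using that by (simp_all add: C_def equivariant)
        then have "- g = - h"
          using ex1_pred_shift[OF phi_Z[OF Omega_space[OF that(3)]]] by blast
        then show ?thesis by simp
      qed
      with \<open>g \<noteq> h\<close> show "A \<inter> C g \<inter> \<Omega> \<inter> (A \<inter> C h \<inter> \<Omega>) = {}"
        by auto
    qed
  qed (use A C Omega_sets in auto)
  also have "(\<Union>g. A \<inter> C g \<inter> \<Omega>) = A \<inter> \<Omega>"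
  proof -
    have "\<exists>g. y \<in> C g" if y: "y \<in> \<Omega>" for y
    proof -
      obtain p where "unit_succ (order_act p (\<phi> y)) = - p"
        using ex1_implies_ex[OF ex1_pred_shift[OF phi_Z[OF Omega_space[OF y]]]] by (elim exE)
      then have "y \<in> C (- p)"
        using that by (simp add: C_def equivariant Omega_space)
      then show ?thesis ..
    qed
    then show ?thesis by auto
  qed
  also have "emeasure M (A \<inter> \<Omega>) = emeasure M A"
    by (rule emeasure_Omega[OF A, symmetric])
  finally show "emeasure (distr M M S) A = emeasure M A"
    by (simp add: emeasure_distr[OF S_measurable A])
qed simp

lemma S_pow_measurable: "(S ^^ i) \<in> M \<rightarrow>\<^sub>M M"
  by (rule measurable_funpow[OF S_measurable])

lemma S_pow_distr: "distr M M (S ^^ i) = M"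
proof (induction i)
  case (Suc i)
  have "distr M M (S ^^ Suc i) = distr (distr M M (S ^^ i)) M S"
    unfolding funpow.simps by (rule distr_distr[OF S_measurable S_pow_measurable, symmetric])
  then show ?case
    by (simp only: Suc S_distr)
qed (simp add: distr_id[unfolded id_def] id_def)

end

section \<open>Entropy of the successor map\<close>

text \<open>The entropy of the map as that of \<open>P\<close> given ever longer pieces of its
  strict future. Unlike an average over blocks, this form has a single conditional entropy as its
  building block, which can be compared with the group elements above the unit.\<close>

definition sent :: "'x measure \<Rightarrow> ('x \<Rightarrow> 'x) \<Rightarrow> ('x \<Rightarrow> 'b) \<Rightarrow> real" where
  "sent M S P = (INF n. cent M P (gjoint (\<lambda>i. S ^^ i) P {1..n}))"

context multiorder_factor
begin

abbreviation iter :: "nat \<Rightarrow> 'x \<Rightarrow> 'x" where "iter \<equiv> \<lambda>i. S ^^ i"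

abbreviation fut :: "('x \<Rightarrow> 'b) \<Rightarrow> nat \<Rightarrow> 'x \<Rightarrow> nat \<Rightarrow> 'b option" where
  "fut P n \<equiv> gjoint iter P {1..n}"

lemma simple_iter: "simple_function M P \<Longrightarrow> simple_function M (\<lambda>x. P ((S ^^ i) x))"
  by (rule simple_function_comp[OF S_pow_measurable])

lemma simple_iter_joint: "finite F \<Longrightarrow> simple_function M P \<Longrightarrow> simple_function M (gjoint iter P F)"
  unfolding gjoint_def by (intro simple_function_joint_const simple_iter)

lemma iter_iter: "(S ^^ i) ((S ^^ j) x) = (S ^^ (i + j)) x"
  by (simp add: funpow_add)

lemma cent_iter:
  assumes "simple_function M X" "simple_function M Y"
  shows "cent M (\<lambda>x. X ((S ^^ j) x)) (\<lambda>x. Y ((S ^^ j) x)) = cent M X Y"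
  by (intro cent_comp S_pow_measurable S_pow_distr assms)

text \<open>In the expansion from the last time backwards, time \<open>j\<close> is conditioned on
  the times j+1 to N-1, which form a future of length N-1-j as seen from the point reached at time
  \<open>j\<close>. The variable \<open>Z\<close> stays attached to the starting point.\<close>

lemma cent_iter_chain:
  assumes P: "simple_function M P" and Z: "simple_function M Z"
  shows "cent M (gjoint iter P {..<N}) Z =
    (\<Sum>j<N. cent M (\<lambda>x. P ((S ^^ j) x)) (\<lambda>x. (fut P (N - 1 - j) ((S ^^ j) x), Z x)))"
proof -
  let ?P = "\<lambda>i x. P ((S ^^ i) x)"
  have "cent M (gjoint iter P {..<N}) Z =
      (\<Sum>j<N. cent M (?P j) (\<lambda>x. (joint ?P (\<lambda>_. {h \<in> {..<N}. j < h}) x, Z x)))"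
    unfolding gjoint_def
  proof (rule cent_random_order[where R = "\<lambda>_ g h. g < h"])
    show "asymp_on {..<N} (<) \<and> transp_on {..<N} (<) \<and> totalp_on {..<N} (<)"
      by (auto intro!: asymp_onI transp_onI totalp_onI)
  qed (auto intro: simple_iter P Z determinesI)
  also have "\<dots> = (\<Sum>j<N. cent M (?P j) (\<lambda>x. (fut P (N - 1 - j) ((S ^^ j) x), Z x)))"
  proof (rule sum.cong[OF refl])
    fix j assume "j \<in> {..<N}"
    then have set_eq: "{h \<in> {..<N}. j < h} = (\<lambda>i. i + j) ` {1..N - 1 - j}"
      by (auto simp: image_iff Bex_def intro!: exI[of _ "_ - j"])
    have eq: "joint ?P (\<lambda>_. {h \<in> {..<N}. j < h}) x = joint ?P (\<lambda>_. {h \<in> {..<N}. j < h}) y \<longleftrightarrow>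
        fut P (N - 1 - j) ((S ^^ j) x) = fut P (N - 1 - j) ((S ^^ j) y)" for x y
      unfolding joint_eq_iff gjoint_eq_iff iter_iter set_eq by blast
    have J: "simple_function M (joint ?P (\<lambda>_. {h \<in> {..<N}. j < h}))"
      by (intro simple_function_joint_const simple_iter P) simp
    have J': "simple_function M (\<lambda>x. fut P (N - 1 - j) ((S ^^ j) x))"
      by (intro simple_iter[where P = "fut P (N - 1 - j)"] simple_iter_joint P) simp
    show "cent M (?P j) (\<lambda>x. (joint ?P (\<lambda>_. {h \<in> {..<N}. j < h}) x, Z x)) =
        cent M (?P j) (\<lambda>x. (fut P (N - 1 - j) ((S ^^ j) x), Z x))"
      by (intro cent_cong simple_function_Pair J J' simple_iter[OF P] Z determinesI) (simp_all only: prod.inject eq)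
  qed
  finally show ?thesis .
qed

text \<open>Times before N-n still have \<open>n\<close> later times in the block and know their own
  \<open>Q\<close>-value, so their terms are bounded by the shifted conditional entropy. The at most
  \<open>n\<close> last times are charged the full entropy of \<open>P\<close>.\<close>

lemma cent_iter_joint_le:
  assumes P: "simple_function M P" and Q: "simple_function M Q"
  shows "cent M (gjoint iter P {..<N}) (gjoint iter Q {..<N}) \<le>
    real N * cent M P (\<lambda>x. (fut P n x, Q x)) + real n * ent M P"
proof -
  let ?B = "cent M P (\<lambda>x. (fut P n x, Q x))"
  have Z: "simple_function M (gjoint iter Q {..<N})"
    by (intro simple_iter_joint Q) simp
  have fut: "simple_function M (\<lambda>x. fut P m ((S ^^ j) x))" for m j
    by (intro simple_iter[where P = "fut P m"] simple_iter_joint P) simp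
  have B: "0 \<le> ?B"
    by (intro cent_nonneg P simple_function_Pair simple_iter_joint Q) simp
  have E: "0 \<le> ent M P"
    by (rule ent_nonneg[OF P])
  have "cent M (\<lambda>x. P ((S ^^ j) x)) (\<lambda>x. (fut P (N - 1 - j) ((S ^^ j) x), gjoint iter Q {..<N} x)) \<le>
      ?B + (if N - n \<le> j then ent M P else 0)" if j: "j < N" for j
  proof (cases "N - n \<le> j")
    case True
    have "cent M (\<lambda>x. P ((S ^^ j) x)) (\<lambda>x. (fut P (N - 1 - j) ((S ^^ j) x), gjoint iter Q {..<N} x)) \<le>
        ent M (\<lambda>x. P ((S ^^ j) x))"
      by (intro cent_le_ent simple_iter[OF P] simple_function_Pair fut Z)
    also have "\<dots> = ent M P"
      by (rule ent_comp[OF S_pow_measurable S_pow_distr P])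
    finally show ?thesis using True B by simp
  next
    case False
    have "cent M (\<lambda>x. P ((S ^^ j) x)) (\<lambda>x. (fut P (N - 1 - j) ((S ^^ j) x), gjoint iter Q {..<N} x)) \<le>
        cent M (\<lambda>x. P ((S ^^ j) x)) (\<lambda>x. (fut P n ((S ^^ j) x), Q ((S ^^ j) x)))"
      using False j
      by (intro cent_antimono simple_iter[OF P] simple_iter[OF Q] simple_function_Pair fut Z determinesI)
        (auto simp: gjoint_eq_iff)
    also have "\<dots> = ?B"
      by (rule cent_iter[OF P, where Y = "\<lambda>x. (fut P n x, Q x)"])
         (intro simple_function_Pair simple_iter_joint P Q, simp)
    finally show ?thesis using False by simp
  qed
  then have "cent M (gjoint iter P {..<N}) (gjoint iter Q {..<N}) \<le>
      (\<Sum>j<N. ?B + (if N - n \<le> j then ent M P else 0))"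
    unfolding cent_iter_chain[OF P Z] by (intro sum_mono) simp
  also have "\<dots> = real N * ?B + real (card {j \<in> {..<N}. N - n \<le> j}) * ent M P"
    by (simp add: sum.distrib sum.If_cases Int_def)
  also have "\<dots> \<le> real N * ?B + real n * ent M P"
  proof -
    have "{j \<in> {..<N}. N - n \<le> j} = {N - n..<N}" by auto
    then show ?thesis using E by (intro add_left_mono mult_right_mono) auto
  qed
  finally show ?thesis .
qed

lemma eventually_cent_iter_joint_le:
  assumes P: "simple_function M P" and Q: "simple_function M Q" and "0 < \<epsilon>"
  shows "eventually (\<lambda>N. cent M (gjoint iter P {..<N}) (gjoint iter Q {..<N}) / real N <
    cent M P (\<lambda>x. (fut P n x, Q x)) + \<epsilon>) sequentially"
proof -
  let ?B = "cent M P (\<lambda>x. (fut P n x, Q x))"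
  have "(\<lambda>N. ?B + real n * ent M P / real N) \<longlonglongrightarrow> ?B + 0"
    by (intro tendsto_add tendsto_const lim_const_over_n)
  then have "eventually (\<lambda>N. ?B + real n * ent M P / real N < ?B + \<epsilon>) sequentially"
    by (rule order_tendstoD(2)) (use \<open>0 < \<epsilon>\<close> in simp)
  then show ?thesis
    using eventually_gt_at_top[of 0]
  proof eventually_elim
    case (elim N)
    have "cent M (gjoint iter P {..<N}) (gjoint iter Q {..<N}) / real N \<le>
        (real N * ?B + real n * ent M P) / real N"
      by (intro divide_right_mono cent_iter_joint_le P Q) simp
    also have "\<dots> = ?B + real n * ent M P / real N"
      using elim(2) by (simp add: add_divide_distrib)
    finally show ?case using elim(1) by simp
  qed
qed

lemma bdd_below_cent_fut:
  assumes "simple_function M P"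
  shows "bdd_below (range (\<lambda>n. cent M P (fut P n)))"
  by (rule bdd_belowI[where m = 0]) (auto intro!: cent_nonneg simple_iter_joint assms)

text \<open>From below, each of the N terms of the chain rule is at least the infimum. From above, a
  nearly optimal future of length \<open>n\<close> bounds all but the last \<open>n\<close> terms,
  via the previous estimate with a constant \<open>Q\<close>.\<close>

lemma sent_tendsto:
  assumes P: "simple_function M P"
  shows "(\<lambda>N. ent M (gjoint iter P {..<N}) / real N) \<longlonglongrightarrow> sent M S P"
proof (rule order_tendstoI)
  fix a assume a: "a < sent M S P"
  show "eventually (\<lambda>N. a < ent M (gjoint iter P {..<N}) / real N) sequentially"
    using eventually_gt_at_top[of 0]
  proof eventually_elim
    case (elim N)
    have fut: "simple_function M (fut P m)" for m
      by (intro simple_iter_joint P) simp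
    have "sent M S P \<le> cent M (\<lambda>x. P ((S ^^ j) x)) (\<lambda>x. (fut P (N - 1 - j) ((S ^^ j) x), ()))" for j
    proof -
      have "sent M S P \<le> cent M P (fut P (N - 1 - j))"
        unfolding sent_def by (intro cINF_lower bdd_below_cent_fut P) simp
      also have "\<dots> = cent M (\<lambda>x. P ((S ^^ j) x)) (\<lambda>x. fut P (N - 1 - j) ((S ^^ j) x))"
        by (rule cent_iter[OF P fut, symmetric])
      also have "\<dots> = cent M (\<lambda>x. P ((S ^^ j) x)) (\<lambda>x. (fut P (N - 1 - j) ((S ^^ j) x), ()))"
        by (intro cent_cong simple_iter[OF P] simple_iter[OF fut]
            simple_function_Pair simple_function_const determinesI) simp_all
      finally show ?thesis .
    qed
    then have "(\<Sum>j<N. sent M S P) \<le> cent M (gjoint iter P {..<N}) (\<lambda>_. ())"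
      unfolding cent_iter_chain[OF P simple_function_const] by (intro sum_mono)
    also have "\<dots> = ent M (gjoint iter P {..<N})"
      by (intro cent_const simple_iter_joint P) simp
    finally have "sent M S P \<le> ent M (gjoint iter P {..<N}) / real N"
      using elim by (simp add: field_simps)
    with a show ?case by simp
  qed
next
  fix a assume "sent M S P < a"
  then obtain n where n: "cent M P (fut P n) < a"
    unfolding sent_def by (subst (asm) cINF_less_iff[OF _ bdd_below_cent_fut[OF P]]) auto
  have fut: "simple_function M (fut P n)"
    by (intro simple_iter_joint P) simp
  have triv: "cent M P (\<lambda>x. (fut P n x, ())) = cent M P (fut P n)"
    by (intro cent_cong P fut simple_function_Pair simple_function_const determinesI) simp_all
  have const: "cent M (gjoint iter P {..<N}) (gjoint iter (\<lambda>_. ()) {..<N}) = ent M (gjoint iter P {..<N})" for N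
  proof -
    have "gjoint iter (\<lambda>_. ()) {..<N} = (\<lambda>_ i. if i \<in> {..<N} then Some () else None)"
      by (simp add: gjoint_def joint_def fun_eq_iff)
    then show ?thesis
      using cent_const[OF simple_iter_joint[OF _ P, of "{..<N}"]] by simp
  qed
  have "eventually (\<lambda>N. cent M (gjoint iter P {..<N}) (gjoint iter (\<lambda>_. ()) {..<N}) / real N <
    cent M P (\<lambda>x. (fut P n x, ())) + (a - cent M P (fut P n))) sequentially"
    using n by (intro eventually_cent_iter_joint_le P simple_function_const) simp
  then show "eventually (\<lambda>N. ent M (gjoint iter P {..<N}) / real N < a) sequentially"
    unfolding triv const by simp
qed

lemma sent_diff_tendsto:
  assumes P: "simple_function M P" and Q: "simple_function M Q"
  shows "(\<lambda>N. cent M (gjoint iter P {..<N}) (gjoint iter Q {..<N}) / real N)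
    \<longlonglongrightarrow> sent M S (\<lambda>x. (P x, Q x)) - sent M S Q"
proof -
  have "ent M (gjoint iter (\<lambda>x. (P x, Q x)) {..<N}) =
      ent M (\<lambda>x. (gjoint iter P {..<N} x, gjoint iter Q {..<N} x))" for N
    by (intro ent_cong determinesI simple_iter_joint simple_function_Pair P Q finite_lessThan)
       (auto simp: gjoint_eq_iff)
  then have "cent M (gjoint iter P {..<N}) (gjoint iter Q {..<N}) / real N =
      ent M (gjoint iter (\<lambda>x. (P x, Q x)) {..<N}) / real N - ent M (gjoint iter Q {..<N}) / real N" for N
    by (simp add: cent_def diff_divide_distrib)
  then show ?thesis
    by (simp only:) (intro tendsto_diff sent_tendsto P Q simple_function_Pair)
qed

lemma sent_diff_le:
  assumes P: "simple_function M P" and Q: "simple_function M Q"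
  shows "sent M S (\<lambda>x. (P x, Q x)) - sent M S Q \<le> cent M P (\<lambda>x. (fut P n x, Q x))"
proof (rule field_le_epsilon)
  fix \<epsilon> :: real assume "0 < \<epsilon>"
  show "sent M S (\<lambda>x. (P x, Q x)) - sent M S Q \<le> cent M P (\<lambda>x. (fut P n x, Q x)) + \<epsilon>"
    by (rule tendsto_upperbound[OF sent_diff_tendsto[OF P Q]])
       (rule eventually_mono[OF eventually_cent_iter_joint_le[OF P Q \<open>0 < \<epsilon>\<close>] less_imp_le], simp_all)
qed

lemma simple_phi: "simple_function \<nu> q \<Longrightarrow> simple_function M (\<lambda>x. q (\<phi> x))"
  by (rule simple_function_comp[OF phi_measurable])

text \<open>Any finite-valued function of the order may be replaced by one with values in \<open>\<nat>\<close>, so that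
  infima over such functions range over a single type.\<close>

lemma nat_code:
  assumes "simple_function \<nu> q"
  obtains q' :: "('g \<Rightarrow> 'g \<Rightarrow> bool) \<Rightarrow> nat"
  where "simple_function \<nu> q'" "\<And>r s. r \<in> space \<nu> \<Longrightarrow> s \<in> space \<nu> \<Longrightarrow> q' r = q' s \<Longrightarrow> q r = q s"
proof
  let ?c = "to_nat_on (q ` space \<nu>)"
  have inj: "inj_on ?c (q ` space \<nu>)"
    by (rule inj_on_to_nat_on[OF countable_finite[OF simple_functionD(1)[OF assms]]])
  show "simple_function \<nu> (\<lambda>r. ?c (q r))"
    by (rule simple_function_compose1[OF assms])
  show "q r = q s" if "r \<in> space \<nu>" "s \<in> space \<nu>" "?c (q r) = ?c (q s)" for r s
    using inj_onD[OF inj that(3)] that(1,2) by simp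
qed

text \<open>A converse to \<open>sent_diff_le\<close>, at the price of a new function of the order.
  Some term of the chain rule over a long block is at most the average; it conditions on the
  \<open>Q\<close>-block of the starting point, which becomes a function of the order at time
  \<open>j\<close>.\<close>

lemma sent_diff_approx:
  assumes P: "simple_function M P" and q: "simple_function \<nu> q" and "0 < \<epsilon>"
  obtains n and q' :: "('g \<Rightarrow> 'g \<Rightarrow> bool) \<Rightarrow> nat" where "simple_function \<nu> q'"
    "cent M P (\<lambda>x. (fut P n x, q' (\<phi> x))) \<le>
      sent M S (\<lambda>x. (P x, q (\<phi> x))) - sent M S (\<lambda>x. q (\<phi> x)) + \<epsilon>"
proof -
  let ?Q = "\<lambda>x. q (\<phi> x)"
  let ?d = "sent M S (\<lambda>x. (P x, ?Q x)) - sent M S ?Q"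
  note Q = simple_phi[OF q]
  have "eventually (\<lambda>N. cent M (gjoint iter P {..<N}) (gjoint iter ?Q {..<N}) / real N < ?d + \<epsilon>) sequentially"
    using \<open>0 < \<epsilon>\<close> by (intro order_tendstoD(2)[OF sent_diff_tendsto[OF P Q]]) simp
  with eventually_gt_at_top[of 0] have "eventually (\<lambda>N. 0 < N \<and>
      cent M (gjoint iter P {..<N}) (gjoint iter ?Q {..<N}) / real N < ?d + \<epsilon>) sequentially"
    by eventually_elim simp
  then obtain N where N: "0 < N"
      "cent M (gjoint iter P {..<N}) (gjoint iter ?Q {..<N}) / real N < ?d + \<epsilon>"
    by (auto simp: eventually_sequentially)
  let ?Z = "gjoint iter ?Q {..<N}"
  have Z: "simple_function M ?Z"
    by (intro simple_iter_joint Q) simp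
  let ?t = "\<lambda>j. cent M (\<lambda>x. P ((S ^^ j) x)) (\<lambda>x. (fut P (N - 1 - j) ((S ^^ j) x), ?Z x))"
  have "\<exists>j<N. ?t j \<le> ?d + \<epsilon>"
  proof (rule ccontr)
    assume "\<not> ?thesis"
    then have "(\<Sum>j<N. ?d + \<epsilon>) \<le> (\<Sum>j<N. ?t j)"
      by (intro sum_mono) (auto simp: not_le intro: less_imp_le)
    also have "\<dots> = cent M (gjoint iter P {..<N}) ?Z"
      by (rule cent_iter_chain[OF P Z, symmetric])
    finally show False
      using N by (simp add: field_simps)
  qed
  then obtain j where j: "j < N" "?t j \<le> ?d + \<epsilon>" by auto
  \<comment> \<open>Going back \<open>j\<close> steps from the order at time \<open>j\<close>
    recovers the order at the starting point, whose \<open>N\<close> successor iterates give the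
    \<open>Q\<close>-block. This is the purpose of the predecessor map.\<close>
  define q1 where "q1 r = gjoint (\<lambda>i. order_successor_map ^^ i) q {..<N} ((order_predecessor_map ^^ j) r)" for r
  have "simple_function \<nu> q1"
    unfolding q1_def gjoint_def
    by (intro simple_function_comp[OF measurable_funpow[OF order_predecessor_map_measurable],
          where f = "joint (\<lambda>g r. q ((order_successor_map ^^ g) r)) (\<lambda>_. {..<N})"]
        simple_function_joint_const
        simple_function_comp[OF measurable_funpow[OF order_successor_map_measurable] q]) simp
  then obtain q' :: "('g \<Rightarrow> 'g \<Rightarrow> bool) \<Rightarrow> nat" where q': "simple_function \<nu> q'"
    "\<And>r s. r \<in> space \<nu> \<Longrightarrow> s \<in> space \<nu> \<Longrightarrow> q' r = q' s \<Longrightarrow> q1 r = q1 s"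
    by (rule nat_code) blast
  have fut: "simple_function M (fut P m)" for m
    by (intro simple_iter_joint P) simp
  have Y: "simple_function M (\<lambda>x. (fut P (N - 1 - j) x, q' (\<phi> x)))"
    by (intro simple_function_Pair fut simple_phi q')
  have q1_S: "q1 (\<phi> ((S ^^ j) x)) i = ?Z x i" if x: "x \<in> \<Omega>" for x i
    using phi_Z[OF Omega_space[OF x]] x
    by (simp add: q1_def phi_S_pow order_predecessor_successor_pow gjoint_def joint_def)
  have "cent M P (\<lambda>x. (fut P (N - 1 - j) x, q' (\<phi> x))) =
      cent M (\<lambda>x. P ((S ^^ j) x)) (\<lambda>x. (fut P (N - 1 - j) ((S ^^ j) x), q' (\<phi> ((S ^^ j) x))))"
    by (rule cent_iter[OF P Y, symmetric])
  also have "\<dots> \<le> ?t j"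
  proof (intro cent_antimono simple_iter[OF P] simple_function_Pair Z determinesI
      simple_iter[OF fut] simple_iter[OF simple_phi[OF q'(1)]])
    fix x y assume xy: "x \<in> \<Omega>" "y \<in> \<Omega>"
      "(fut P (N - 1 - j) ((S ^^ j) x), q' (\<phi> ((S ^^ j) x))) =
        (fut P (N - 1 - j) ((S ^^ j) y), q' (\<phi> ((S ^^ j) y)))"
    have "\<phi> ((S ^^ j) z) \<in> space \<nu>" if "z \<in> \<Omega>" for z
      by (rule measurable_space[OF phi_measurable measurable_space[OF S_pow_measurable Omega_space[OF that]]])
    then have "q1 (\<phi> ((S ^^ j) x)) = q1 (\<phi> ((S ^^ j) y))"
      using q'(2) xy by blast
    then have "?Z x = ?Z y"
      using q1_S[OF xy(1)] q1_S[OF xy(2)] by (simp add: fun_eq_iff)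
    with xy(3) show "(fut P (N - 1 - j) ((S ^^ j) x), ?Z x) = (fut P (N - 1 - j) ((S ^^ j) y), ?Z y)"
      by simp
  qed
  finally show thesis
    by (rule that[OF q'(1) order_trans[OF _ j(2)]])
qed

end

section \<open>Comparison of the two entropies relative to the order\<close>

context full_measure_set
begin

lemma exhaustion:
  assumes E: "\<And>m. E m \<in> sets M" and mono: "incseq E" and cover: "\<And>x. x \<in> \<Omega> \<Longrightarrow> \<exists>m. x \<in> E m"
    and "0 < (\<delta>::real)"
  obtains m where "prob (space M - E m) \<le> \<delta>"
proof -
  have "(\<lambda>m. prob (E m)) \<longlonglongrightarrow> prob (\<Union>m. E m)"
    by (rule finite_Lim_measure_incseq) (use E mono in auto)
  moreover have "prob (\<Union>m. E m) = 1"
  proof (rule antisym)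
    have "\<Omega> \<subseteq> (\<Union>m. E m)"
      using cover by blast
    then have "prob \<Omega> \<le> prob (\<Union>m. E m)"
      using E by (intro finite_measure_mono) auto
    then show "1 \<le> prob (\<Union>m. E m)"
      by (simp add: Omega_full)
  qed simp
  ultimately have "eventually (\<lambda>m. 1 - \<delta> < prob (E m)) sequentially"
    using \<open>0 < \<delta>\<close> by (intro order_tendstoD(1)[where y = 1]) auto
  then obtain m where "1 - \<delta> < prob (E m)"
    by (auto simp: eventually_sequentially)
  then have "prob (space M - E m) \<le> \<delta>"
    using prob_compl[OF E[of m]] by simp
  then show thesis by (rule that)
qed

lemma prob_neq_le:
  assumes U: "simple_function M U" and U': "simple_function M U'" and E: "E \<in> sets M"
    and eq: "\<And>x. x \<in> \<Omega> \<Longrightarrow> x \<in> E \<Longrightarrow> U x = U' x" and "prob (space M - E) \<le> \<delta>"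
  shows "prob {x \<in> space M. U x \<noteq> U' x} \<le> \<delta>"
proof -
  have B: "{x \<in> space M. U x \<noteq> U' x} \<in> sets M"
    using simple_level_sets[OF simple_function_compose1[OF simple_function_Pair[OF U U'],
        of "\<lambda>(u, v). u \<noteq> v"], of True] by simp
  have "prob {x \<in> space M. U x \<noteq> U' x} \<le> prob (space M - E)"
    unfolding prob_Omega[OF B] by (rule finite_measure_mono) (use E eq in auto)
  with assms(5) show ?thesis by simp
qed

end

section \<open>Finite-valued codes of an order\<close>

lemma simple_restrict_code:
  assumes c: "c \<in> N \<rightarrow>\<^sub>M count_space UNIV" and K: "finite K"
  shows "simple_function N (\<lambda>r. if c r \<in> K then Some (c r) else None)"
proof -
  have "(\<lambda>r. if c r \<in> K then Some (c r) else None) ` space N \<subseteq> insert None (Some ` K)"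
    by auto
  then have "finite ((\<lambda>r. if c r \<in> K then Some (c r) else None) ` space N)"
    by (rule finite_subset) (use K in simp)
  moreover have "(\<lambda>r. if c r \<in> K then Some (c r) else None) \<in> N \<rightarrow>\<^sub>M count_space UNIV"
    by (rule measurable_compose[OF c]) simp
  ultimately show ?thesis
    by (simp add: simple_function_eq_measurable)
qed

context multiorder_measure
begin

text \<open>There are two layers of \<open>option\<close>: the outer one comes from
  \<open>joint\<close> and marks indices outside 1..n, the inner one marks elements outside
  \<open>K\<close>, a truncation that keeps the code finite-valued.\<close>

definition nth_code :: "'g set \<Rightarrow> nat \<Rightarrow> ('g \<Rightarrow> 'g \<Rightarrow> bool) \<Rightarrow> nat \<Rightarrow> 'g option option" where
  "nth_code K n = joint (\<lambda>i r. if order_nth r i \<in> K then Some (order_nth r i) else None) (\<lambda>_. {1..n})"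

lemma nth_code_eq_Some_iff:
  "nth_code K n r i = Some (Some k) \<longleftrightarrow> i \<in> {1..n} \<and> order_nth r i = k \<and> k \<in> K"
  by (auto simp: nth_code_def joint_def)

lemma simple_nth_code: "finite K \<Longrightarrow> simple_function \<nu> (nth_code K n)"
  unfolding nth_code_def
  by (intro simple_function_joint_const simple_restrict_code order_nth_measurable) auto

lemma simple_rel: "simple_function \<nu> (\<lambda>r. r a b)"
proof -
  have "simple_function \<nu> (\<lambda>r. if r \<in> {r. r a b} then True else False)"
    by (rule simple_function_If_set) (use rel_sets[of a b] in \<open>auto simp: Int_def conj_commute\<close>)
  also have "(\<lambda>r. if r \<in> {r. r a b} then True else False) = (\<lambda>r. r a b)"
    by auto
  finally show ?thesis .
qed

definition rel_code :: "'g set \<Rightarrow> ('g \<Rightarrow> 'g \<Rightarrow> bool) \<Rightarrow> 'g \<times> 'g \<Rightarrow> bool option" where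
  "rel_code F = joint (\<lambda>(a, b) r. r a b) (\<lambda>_. F \<times> F)"

lemma simple_rel_code: "finite F \<Longrightarrow> simple_function \<nu> (rel_code F)"
  unfolding rel_code_def by (intro simple_function_joint_const) (auto intro: simple_rel)

lemma rel_code_eq_iff: "rel_code F r = rel_code F s \<longleftrightarrow> (\<forall>a\<in>F. \<forall>b\<in>F. r a b \<longleftrightarrow> s a b)"
  by (auto simp: rel_code_def joint_eq_iff)

lemma simple_upset:
  assumes "finite F"
  shows "simple_function \<nu> (\<lambda>r. {h \<in> F. r g h})"
proof -
  have eq: "(\<lambda>r. {h \<in> F. r g h}) = (\<lambda>f. {h \<in> F. f (g, h) = Some True}) \<circ> rel_code (insert g F)"
    by (auto simp: rel_code_def joint_def fun_eq_iff)
  show ?thesis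
    unfolding eq by (rule simple_function_compose[OF simple_rel_code]) (use assms in simp)
qed

end

section \<open>Iterates of \<open>S\<close> against group elements above the unit\<close>

context multiorder_factor
begin

abbreviation ahead :: "('x \<Rightarrow> 'b) \<Rightarrow> 'g set \<Rightarrow> 'x \<Rightarrow> 'g \<Rightarrow> 'b option" where
  "ahead P K \<equiv> joint (\<lambda>g x. P (T g x)) (\<lambda>x. {k \<in> K. \<phi> x 0 k})"

lemma simple_upset_phi: "finite F \<Longrightarrow> simple_function M (\<lambda>x. {h \<in> F. \<phi> x g h})"
  by (rule simple_phi[OF simple_upset])

lemma simple_ahead:
  assumes "finite K" "simple_function M P"
  shows "simple_function M (ahead P K)"
  by (rule simple_function_joint[OF assms(1) simple_T[OF assms(2)] simple_upset_phi[OF assms(1)]]) auto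

lemma phi_nu: "x \<in> space M \<Longrightarrow> \<phi> x \<in> space \<nu>"
  using phi_Z space_nu by simp

lemma phi_nu_Omega: "x \<in> \<Omega> \<Longrightarrow> \<phi> x \<in> space \<nu>"
  using phi_nu Omega_space by simp

text \<open>The first \<open>n\<close> iterates move a point by the first \<open>n\<close> elements
  above the unit. With probability near 1 these lie in a large finite \<open>K\<close>; then the
  future is read off from the values ahead in \<open>K\<close> and from a code saying which element
  is the i-th one. The exceptional event is absorbed by \<open>cent_perturb\<close>.\<close>

lemma ahead_le_fut:
  fixes P :: "'x \<Rightarrow> 'b"
  assumes P: "simple_function M P" and q: "simple_function \<nu> q" and "0 < \<epsilon>"
  obtains K and q' :: "('g \<Rightarrow> 'g \<Rightarrow> bool) \<Rightarrow> nat" where "finite K" "simple_function \<nu> q'"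
    "cent M P (\<lambda>x. (ahead P K x, q' (\<phi> x))) \<le> cent M P (\<lambda>x. (fut P n x, q (\<phi> x))) + \<epsilon>"
proof -
  let ?U = "\<lambda>x. (fut P n x, q (\<phi> x))"
  have U: "simple_function M ?U"
    by (intro simple_function_Pair simple_iter_joint P simple_phi q) simp
  obtain \<delta> where \<delta>: "0 < \<delta>" and perturb: "\<And>(V :: 'x \<Rightarrow> ('g \<Rightarrow> 'b option) \<times> nat) U'. simple_function M V \<Longrightarrow>
      simple_function M U' \<Longrightarrow> determines V U' \<Longrightarrow> prob {x \<in> space M. ?U x \<noteq> U' x} \<le> \<delta> \<Longrightarrow>
      cent M P V \<le> cent M P ?U + \<epsilon>"
    by (rule cent_perturb[OF P U \<open>0 < \<epsilon>\<close>]) blast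
  define E where "E m = {x \<in> space M. \<forall>i\<in>{1..n}. to_nat (order_nth (\<phi> x) i) \<le> m}" for m
  have E: "E m \<in> sets M" for m
  proof -
    have "{x \<in> space M. to_nat (order_nth (\<phi> x) i) \<le> m} \<in> sets M" for i
      using measurable_sets[OF measurable_compose[OF phi_measurable order_nth_measurable], of "{g. to_nat g \<le> m}" i]
      by (simp add: vimage_def Int_def conj_commute)
    then show ?thesis
      unfolding E_def by (intro sets.sets_Collect_finite_All) auto
  qed
  obtain m where m: "prob (space M - E m) \<le> \<delta>"
  proof (rule exhaustion[OF E _ _ \<delta>])
    show "incseq E"
      by (rule incseq_SucI) (auto simp: E_def le_SucI)
    fix x assume "x \<in> \<Omega>"
    then have "x \<in> E (\<Sum>i\<in>{1..n}. to_nat (order_nth (\<phi> x) i))"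
      by (auto simp: E_def Omega_space intro: member_le_sum)
    then show "\<exists>m. x \<in> E m" ..
  qed
  define K where "K = {g :: 'g. to_nat g \<le> m}"
  have K: "finite K"
    unfolding K_def by (rule finite_imageD[where f = to_nat]) (auto intro: finite_subset[of _ "{..m}"])
  obtain q' :: "('g \<Rightarrow> 'g \<Rightarrow> bool) \<Rightarrow> nat" where q': "simple_function \<nu> q'"
    "\<And>r s. r \<in> space \<nu> \<Longrightarrow> s \<in> space \<nu> \<Longrightarrow> q' r = q' s \<Longrightarrow> (q r, nth_code K n r) = (q s, nth_code K n s)"
    by (rule nat_code[OF simple_function_Pair[OF q simple_nth_code[OF K]]]) blast
  let ?V = "\<lambda>x. (ahead P K x, q' (\<phi> x))"
  \<comment> \<open>The decoder looks up which element is in i-th position and returns the value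
    recorded there.\<close>
  define h where "h j c = (\<lambda>i. case c i of Some (Some k) \<Rightarrow> j k | _ \<Rightarrow> None)"
    for j :: "'g \<Rightarrow> 'b option" and c :: "nat \<Rightarrow> 'g option option"
  let ?U' = "\<lambda>x. (h (ahead P K x) (nth_code K n (\<phi> x)), q (\<phi> x))"
  have V: "simple_function M ?V"
    by (intro simple_function_Pair simple_ahead K P simple_phi q')
  have U': "simple_function M ?U'"
    by (intro simple_function_Pair simple_phi q simple_function_compose2[where h = h]
        simple_ahead K P simple_phi[OF simple_nth_code])
  have "cent M P ?V \<le> cent M P ?U + \<epsilon>"
  proof (rule perturb[OF V U'])
    show "determines ?V ?U'"
    proof (rule determinesI)
      fix x y assume xy: "x \<in> \<Omega>" "y \<in> \<Omega>" "?V x = ?V y"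
      then have "(q (\<phi> x), nth_code K n (\<phi> x)) = (q (\<phi> y), nth_code K n (\<phi> y))"
        by (intro q'(2) phi_nu_Omega) auto
      with xy(3) show "?U' x = ?U' y" by simp
    qed
    show "prob {x \<in> space M. ?U x \<noteq> ?U' x} \<le> \<delta>"
    proof (rule prob_neq_le[OF U U' E _ m])
      fix x assume x: "x \<in> \<Omega>" "x \<in> E m"
      have "fut P n x i = h (ahead P K x) (nth_code K n (\<phi> x)) i" for i
      proof (cases "i \<in> {1..n}")
        case True
        with x(2) have "order_nth (\<phi> x) i \<in> K"
          by (simp add: E_def K_def)
        then have c: "nth_code K n (\<phi> x) i = Some (Some (order_nth (\<phi> x) i))"
          using True by (simp only: nth_code_eq_Some_iff)
        have "\<phi> x 0 (order_nth (\<phi> x) i)"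
          using order_nth_less[OF phi_Z[OF Omega_space[OF x(1)]], of 0 i] True by simp
        with True \<open>order_nth (\<phi> x) i \<in> K\<close> show ?thesis
          by (simp add: h_def c gjoint_def joint_def S_pow[OF x(1)])
      next
        case False
        then have "nth_code K n (\<phi> x) i = None" "fut P n x i = None"
          by (simp_all only: nth_code_def gjoint_def joint_def if_False)
        then show ?thesis
          by (simp add: h_def)
      qed
      then show "?U x = ?U' x" by auto
    qed
  qed
  with K q'(1) show thesis by (rule that)
qed

text \<open>This is where type \<int> enters: every \<open>k\<close> of \<open>K\<close> above the
  unit is reached after finitely many successor steps, so for large \<open>n\<close> all of them are
  among the first \<open>n\<close> iterates, up to small probability.\<close>

lemma fut_le_ahead:
  fixes P :: "'x \<Rightarrow> 'b"
  assumes P: "simple_function M P" and q: "simple_function \<nu> q" and K: "finite K" and "0 < \<epsilon>"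
  obtains n and q' :: "('g \<Rightarrow> 'g \<Rightarrow> bool) \<Rightarrow> nat" where "simple_function \<nu> q'"
    "cent M P (\<lambda>x. (fut P n x, q' (\<phi> x))) \<le> cent M P (\<lambda>x. (ahead P K x, q (\<phi> x))) + \<epsilon>"
proof -
  let ?U = "\<lambda>x. (ahead P K x, q (\<phi> x))"
  have U: "simple_function M ?U"
    by (intro simple_function_Pair simple_ahead K P simple_phi q)
  obtain \<delta> where \<delta>: "0 < \<delta>" and perturb: "\<And>(V :: 'x \<Rightarrow> (nat \<Rightarrow> 'b option) \<times> nat) U'. simple_function M V \<Longrightarrow>
      simple_function M U' \<Longrightarrow> determines V U' \<Longrightarrow> prob {x \<in> space M. ?U x \<noteq> U' x} \<le> \<delta> \<Longrightarrow>
      cent M P V \<le> cent M P ?U + \<epsilon>"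
    by (rule cent_perturb[OF P U \<open>0 < \<epsilon>\<close>]) blast
  define E where "E n = {x \<in> space M. \<forall>k\<in>K. \<phi> x 0 k \<longrightarrow> (\<exists>i\<in>{1..n}. order_nth (\<phi> x) i = k)}" for n
  have E: "E n \<in> sets M" for n
  proof -
    have "{x \<in> space M. order_nth (\<phi> x) i = k} \<in> sets M" for i k
      using measurable_sets[OF measurable_compose[OF phi_measurable order_nth_measurable], of "{k}" i]
      by (simp add: vimage_def Int_def conj_commute)
    moreover have "{x \<in> space M. \<phi> x 0 k} \<in> sets M" for k
      using simple_level_sets[OF simple_phi[OF simple_rel[of 0 k]], of True] by simp
    ultimately show ?thesis
      unfolding E_def
      by (intro sets.sets_Collect_finite_All sets.sets_Collect_imp sets.sets_Collect_finite_Ex K) auto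
  qed
  obtain n where n: "prob (space M - E n) \<le> \<delta>"
  proof (rule exhaustion[OF E _ _ \<delta>])
    show "incseq E"
      by (rule incseq_SucI) (force simp: E_def)
    fix x assume x: "x \<in> \<Omega>"
    have "\<exists>i. \<phi> x 0 k \<longrightarrow> 0 < i \<and> order_nth (\<phi> x) i = k" for k
      using ex_order_nth[OF phi_Z[OF Omega_space[OF x]], of k] by blast
    then obtain i where i: "\<And>k. \<phi> x 0 k \<Longrightarrow> 0 < i k \<and> order_nth (\<phi> x) (i k) = k"
      by metis
    \<comment> \<open>The sum serves merely as a common bound for the finitely many positions
      \<open>i k\<close>.\<close>
    have "x \<in> E (\<Sum>k\<in>K. i k)"
      unfolding E_def
    proof (intro CollectI conjI ballI impI)
      fix k assume k: "k \<in> K" "\<phi> x 0 k"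
      have "i k \<le> (\<Sum>k\<in>K. i k)"
        using k K by (intro member_le_sum) auto
      with i[OF k(2)] show "\<exists>j\<in>{1..\<Sum>k\<in>K. i k}. order_nth (\<phi> x) j = k"
        by (intro bexI[of _ "i k"]) auto
    qed (rule Omega_space[OF x])
    then show "\<exists>m. x \<in> E m" ..
  qed
  obtain q' :: "('g \<Rightarrow> 'g \<Rightarrow> bool) \<Rightarrow> nat" where q': "simple_function \<nu> q'"
    "\<And>r s. r \<in> space \<nu> \<Longrightarrow> s \<in> space \<nu> \<Longrightarrow> q' r = q' s \<Longrightarrow> (q r, nth_code K n r) = (q s, nth_code K n s)"
    by (rule nat_code[OF simple_function_Pair[OF q simple_nth_code[OF K]]]) blast
  let ?V = "\<lambda>x. (fut P n x, q' (\<phi> x))"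
  \<comment> \<open>The decoder inverts the code: it finds the position at which \<open>k\<close>
    occurs and returns the value at that iterate. If \<open>k\<close> does not occur, it declares
    \<open>k\<close> not to be ahead.\<close>
  define h where "h j c = (\<lambda>k. if \<exists>i. c i = Some (Some k) then j (SOME i. c i = Some (Some k)) else None)"
    for j :: "nat \<Rightarrow> 'b option" and c :: "nat \<Rightarrow> 'g option option"
  let ?U' = "\<lambda>x. (h (fut P n x) (nth_code K n (\<phi> x)), q (\<phi> x))"
  have fut: "simple_function M (fut P n)"
    by (intro simple_iter_joint P) simp
  have V: "simple_function M ?V"
    by (intro simple_function_Pair fut simple_phi q')
  have U': "simple_function M ?U'"
    by (intro simple_function_Pair simple_phi q simple_function_compose2[where h = h]
        fut simple_phi[OF simple_nth_code] K)
  have "cent M P ?V \<le> cent M P ?U + \<epsilon>"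
  proof (rule perturb[OF V U'])
    show "determines ?V ?U'"
    proof (rule determinesI)
      fix x y assume xy: "x \<in> \<Omega>" "y \<in> \<Omega>" "?V x = ?V y"
      then have "(q (\<phi> x), nth_code K n (\<phi> x)) = (q (\<phi> y), nth_code K n (\<phi> y))"
        by (intro q'(2) phi_nu_Omega) auto
      with xy(3) show "?U' x = ?U' y" by simp
    qed
    show "prob {x \<in> space M. ?U x \<noteq> ?U' x} \<le> \<delta>"
    proof (rule prob_neq_le[OF U U' E _ n])
      fix x assume x: "x \<in> \<Omega>" "x \<in> E n"
      let ?c = "nth_code K n (\<phi> x)"
      note Z = phi_Z[OF Omega_space[OF x(1)]]
      have "ahead P K x k = h (fut P n x) ?c k" for k
      proof (cases "\<exists>i. ?c i = Some (Some k)")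
        case True
        then have "?c (SOME i. ?c i = Some (Some k)) = Some (Some k)"
          by (rule someI_ex)
        then obtain i where i: "(SOME i. ?c i = Some (Some k)) = i"
            "i \<in> {1..n}" "order_nth (\<phi> x) i = k" "k \<in> K"
          unfolding nth_code_eq_Some_iff by blast
        have "\<phi> x 0 k"
          using order_nth_less[OF Z, of 0 i] i by simp
        with True i show ?thesis
          by (simp add: h_def gjoint_def joint_def S_pow[OF x(1)])
      next
        case False
        then have "\<not> (k \<in> K \<and> \<phi> x 0 k)"
          using x(2) unfolding nth_code_eq_Some_iff E_def by blast
        with False show ?thesis
          by (simp add: h_def joint_def)
      qed
      then show "?U x = ?U' x" by auto
    qed
  qed
  with q'(1) show thesis by (rule that)
qed

end

section \<open>Translation to the unit and comparison of the relative entropies\<close>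

context multiorder_factor
begin

text \<open>Right translation by \<open>g\<close> moves the part of the order above \<open>g\<close>
  to the part above the unit; thus what is ahead of the unit at \<open>T g x\<close> is what is
  ahead of \<open>g\<close> at \<open>x\<close>.\<close>

lemma ahead_translate:
  assumes "x \<in> \<Omega>"
  shows "ahead P K (T g x) = (\<lambda>k. if k \<in> K \<and> \<phi> x g (k + g) then Some (P (T (k + g) x)) else None)"
  using assms by (auto simp: joint_def equivariant order_act_def T_add[symmetric] Omega_space fun_eq_iff)

lemma cent_ahead_translate:
  assumes P: "simple_function M P" and q: "simple_function \<nu> q" and K: "finite K"
  shows "cent M P (\<lambda>x. (ahead P K x, q (\<phi> x))) =
    cent M (\<lambda>x. P (T g x)) (\<lambda>x. (ahead P K (T g x), q (\<phi> (T g x))))"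
proof -
  have "simple_function M (\<lambda>x. (ahead P K x, q (\<phi> x)))"
    by (intro simple_function_Pair simple_ahead K P simple_phi q)
  from cent_comp[OF T_measurable T_distr P this, of g] show ?thesis by simp
qed

abbreviation ahead_in :: "('x \<Rightarrow> 'b) \<Rightarrow> 'g set \<Rightarrow> 'g \<Rightarrow> 'x \<Rightarrow> 'g \<Rightarrow> 'b option" where
  "ahead_in P F g \<equiv> joint (\<lambda>h x. P (T h x)) (\<lambda>x. {h \<in> F. \<phi> x g h})"

lemma simple_ahead_in:
  assumes "finite F" "simple_function M P"
  shows "simple_function M (ahead_in P F g)"
  by (rule simple_function_joint[OF assms(1) simple_T[OF assms(2)] simple_upset_phi[OF assms(1)]]) auto

lemma cent_gjoint_chain:
  assumes P: "simple_function M P" and F: "finite F" and Z: "simple_function M Z"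
    and ZR: "determines Z (\<lambda>x. rel_code F (\<phi> x))"
  shows "cent M (gjoint T P F) Z =
    (\<Sum>g\<in>F. cent M (\<lambda>x. P (T g x)) (\<lambda>x. (ahead_in P F g x, Z x)))"
  unfolding gjoint_def
proof (rule cent_random_order[OF F simple_T[OF P] Z simple_upset_phi[OF F]])
  show "determines Z (\<lambda>x. {h \<in> F. \<phi> x g h})" if "g \<in> F" for g
  proof (rule determinesI)
    fix x y assume "x \<in> \<Omega>" "y \<in> \<Omega>" "Z x = Z y"
    then have "rel_code F (\<phi> x) = rel_code F (\<phi> y)"
      by (rule determinesD[OF ZR])
    with that show "{h \<in> F. \<phi> x g h} = {h \<in> F. \<phi> y g h}"
      by (auto simp: rel_code_eq_iff)
  qed
  show "asymp_on F (\<phi> x) \<and> transp_on F (\<phi> x) \<and> totalp_on F (\<phi> x)" if "x \<in> \<Omega>" for x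
  proof (intro conjI)
    note Z = phi_Z[OF Omega_space[OF that]]
    show "asymp_on F (\<phi> x)"
      by (rule asymp_onI) (rule Z_orders_asym[OF Z])
    show "transp_on F (\<phi> x)"
      by (rule transp_onI) (rule Z_orders_trans[OF Z])
    show "totalp_on F (\<phi> x)"
      by (rule totalp_onI) (rule Z_orders_total[OF Z])
  qed
qed

lemma simple_order_gjoint:
  "finite F \<Longrightarrow> simple_function \<nu> q \<Longrightarrow> simple_function \<nu> (gjoint order_act q F)"
  unfolding gjoint_def
  by (intro simple_function_joint_const simple_function_comp[OF order_act_measurable])

lemma gjoint_phi:
  assumes "x \<in> \<Omega>"
  shows "gjoint T (\<lambda>x. q (\<phi> x)) F x = gjoint order_act q F (\<phi> x)"
  using assms by (auto simp: gjoint_def joint_def equivariant fun_eq_iff)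

text \<open>On a finite set \<open>H\<close> with nearly optimal relative entropy, the chain rule
  along the random order has a term, at some \<open>g\<close>, not exceeding the average.
  Translating this \<open>g\<close> to the unit turns \<open>H\<close> into
  \<open>K\<close>.\<close>

lemma ahead_le_gent_diff:
  fixes P :: "'x \<Rightarrow> 'b" and F :: "nat \<Rightarrow> 'g set"
  assumes F: "folner F" and P: "simple_function M P" and q: "simple_function \<nu> q" and "0 < \<epsilon>"
  obtains K and q' :: "('g \<Rightarrow> 'g \<Rightarrow> bool) \<Rightarrow> nat" where "finite K" "simple_function \<nu> q'"
    "cent M P (\<lambda>x. (ahead P K x, q' (\<phi> x))) \<le>
      gent M T (\<lambda>x. (P x, q (\<phi> x))) - gent M T (\<lambda>x. q (\<phi> x)) + \<epsilon>"
proof -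
  let ?Q = "\<lambda>x. q (\<phi> x)"
  let ?d = "gent M T (\<lambda>x. (P x, ?Q x)) - gent M T ?Q + \<epsilon>"
  note Q = simple_phi[OF q]
  obtain H where H: "finite H" "H \<noteq> {}" "cent M (gjoint T P H) (gjoint T ?Q H) \<le> real (card H) * ?d"
    by (rule gent_diff_approx[OF F P Q \<open>0 < \<epsilon>\<close>])
  \<comment> \<open>The chain rule along the random order requires the conditioning variable to
    determine the order on \<open>H\<close>; adding that information only lowers the conditional
    entropy.\<close>
  let ?Z = "\<lambda>x. (gjoint T ?Q H x, rel_code H (\<phi> x))"
  have Z: "simple_function M ?Z"
    by (intro simple_function_Pair simple_gjoint H Q simple_phi simple_rel_code)
  let ?t = "\<lambda>g. cent M (\<lambda>x. P (T g x)) (\<lambda>x. (ahead_in P H g x, ?Z x))"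
  have "\<exists>g\<in>H. ?t g \<le> ?d"
  proof (rule ccontr)
    assume neg: "\<not> ?thesis"
    have "(\<Sum>g\<in>H. ?d) < (\<Sum>g\<in>H. ?t g)"
      using neg H(1,2) by (intro sum_strict_mono) (auto simp: not_le)
    also have "\<dots> = cent M (gjoint T P H) ?Z"
      by (rule cent_gjoint_chain[OF P H(1) Z, symmetric]) (rule determinesI, simp)
    also have "\<dots> \<le> cent M (gjoint T P H) (gjoint T ?Q H)"
      by (intro cent_antimono simple_gjoint H P Q Z determinesI) simp
    finally show False
      using H(3) by simp
  qed
  then obtain g where g: "g \<in> H" "?t g \<le> ?d" by auto
  define K where "K = (\<lambda>h. h - g) ` H"
  have K: "finite K" by (simp add: K_def H)
  \<comment> \<open>Acting by \<open>- g\<close> recovers the order at \<open>x\<close> from the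
    order at \<open>T g x\<close>, so the conditioning on the block over \<open>H\<close> and on the
    order there remains a function of the order at the translated point.\<close>
  define q1 where "q1 r = (gjoint order_act q H (order_act (- g) r), rel_code H (order_act (- g) r))" for r
  have "simple_function \<nu> q1"
    unfolding q1_def
    by (intro simple_function_Pair
        simple_function_comp[OF order_act_measurable simple_order_gjoint[OF H(1) q]]
        simple_function_comp[OF order_act_measurable simple_rel_code[OF H(1)]])
  then obtain q' :: "('g \<Rightarrow> 'g \<Rightarrow> bool) \<Rightarrow> nat" where q': "simple_function \<nu> q'"
    "\<And>r s. r \<in> space \<nu> \<Longrightarrow> s \<in> space \<nu> \<Longrightarrow> q' r = q' s \<Longrightarrow> q1 r = q1 s"
    by (rule nat_code) blast
  have "cent M P (\<lambda>x. (ahead P K x, q' (\<phi> x))) =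
      cent M (\<lambda>x. P (T g x)) (\<lambda>x. (ahead P K (T g x), q' (\<phi> (T g x))))"
    by (rule cent_ahead_translate[OF P q'(1) K])
  also have "\<dots> \<le> ?t g"
  proof (intro cent_antimono simple_T[OF P] determinesI
      simple_function_Pair[OF simple_ahead_in[OF H(1) P] Z]
      simple_function_Pair[OF simple_T[OF simple_ahead[OF K P]] simple_T[OF simple_phi[OF q'(1)]]])
    fix x y assume xy: "x \<in> \<Omega>" "y \<in> \<Omega>"
      "(ahead P K (T g x), q' (\<phi> (T g x))) = (ahead P K (T g y), q' (\<phi> (T g y)))"
    have q1_T: "q1 (\<phi> (T g z)) = (gjoint T ?Q H z, rel_code H (\<phi> z))" if "z \<in> \<Omega>" for z
      using that by (simp add: q1_def equivariant order_act_act gjoint_phi)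
    have "q1 (\<phi> (T g x)) = q1 (\<phi> (T g y))"
      using xy by (intro q'(2) phi_nu T_space Omega_space) auto
    then have Z_eq: "?Z x = ?Z y"
      by (simp add: q1_T xy)
    have "P (T h x) = P (T h y)" if h: "h \<in> H" "\<phi> x g h" "\<phi> y g h" for h
    proof -
      have "ahead P K (T g x) (h - g) = ahead P K (T g y) (h - g)"
        using xy(3) by simp
      moreover have "h - g \<in> K"
        using h(1) by (simp add: K_def)
      ultimately show ?thesis
        using h by (simp add: ahead_translate xy)
    qed
    moreover have "\<phi> x g h \<longleftrightarrow> \<phi> y g h" if "h \<in> H" for h
      using Z_eq that g(1) by (simp add: rel_code_eq_iff)
    ultimately have "ahead_in P H g x = ahead_in P H g y"
      unfolding joint_eq_iff by auto
    with Z_eq show "(ahead_in P H g x, ?Z x) = (ahead_in P H g y, ?Z y)"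
      by simp
  qed
  finally show thesis
    by (rule that[OF K q'(1) order_trans[OF _ g(2)]])
qed

text \<open>In a large Foelner set \<open>H\<close>, all but a few \<open>g\<close> have the whole
  right translate of \<open>K\<close> by \<open>g\<close> inside \<open>H\<close>. For these, the
  values ahead of \<open>g\<close> in \<open>H\<close> determine, after translation, those ahead of
  the unit in \<open>K\<close>; each remaining \<open>g\<close> costs at most the entropy of
  \<open>P\<close>.\<close>

lemma gent_diff_le_ahead:
  fixes P :: "'x \<Rightarrow> 'b" and F :: "nat \<Rightarrow> 'g set"
  assumes F: "folner F" and P: "simple_function M P" and q: "simple_function \<nu> q"
    and K: "finite K" and "0 < \<epsilon>"
  obtains q' :: "('g \<Rightarrow> 'g \<Rightarrow> bool) \<Rightarrow> nat" where "simple_function \<nu> q'"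
    "gent M T (\<lambda>x. (P x, q' (\<phi> x))) - gent M T (\<lambda>x. q' (\<phi> x)) \<le>
      cent M P (\<lambda>x. (ahead P K x, q (\<phi> x))) + \<epsilon>"
proof -
  let ?A = "cent M P (\<lambda>x. (ahead P K x, q (\<phi> x)))"
  \<comment> \<open>Here \<open>k + g\<close> must stay in \<open>H\<close>, whereas the boundary
    estimate is stated for \<open>- k + g\<close>; hence it is applied to the set of inverses of
    \<open>K\<close>.\<close>
  define bad where "bad H = {g \<in> H. \<exists>k\<in>K. k + g \<notin> H}" for H
  have "bad H = {g \<in> H. \<exists>k\<in>uminus ` K. - k + g \<notin> H}" for H
    by (auto simp: bad_def)
  then have "(\<lambda>n. real (card (bad (F n))) / real (card (F n))) \<longlonglongrightarrow> 0"
    using folner_boundary[OF F, of "uminus ` K"] K by simp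
  then have "(\<lambda>n. real (card (bad (F n))) / real (card (F n)) * ent M P) \<longlonglongrightarrow> 0 * ent M P"
    by (intro tendsto_mult tendsto_const)
  then have "eventually (\<lambda>n. real (card (bad (F n))) / real (card (F n)) * ent M P < \<epsilon>) sequentially"
    by (rule order_tendstoD(2)) (use \<open>0 < \<epsilon>\<close> in simp)
  with folner_card_pos[OF F]
  have "eventually (\<lambda>n. 0 < card (F n) \<and> real (card (bad (F n))) / real (card (F n)) * ent M P < \<epsilon>) sequentially"
    by eventually_elim simp
  then obtain n where n: "0 < card (F n)" "real (card (bad (F n))) / real (card (F n)) * ent M P < \<epsilon>"
    by (auto simp: eventually_sequentially)
  define H where "H = F n"
  have H: "finite H" "H \<noteq> {}" "0 < real (card H)" "real (card (bad H)) * ent M P \<le> real (card H) * \<epsilon>"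
    using n folner_finite[OF F, of n] by (auto simp: H_def field_simps)
  \<comment> \<open>The new function of the order contains both the \<open>q\<close>-block over
    \<open>H\<close> and the order on \<open>H\<close>, so that \<open>gent_diff_le\<close> can be
    used with this single variable.\<close>
  have "simple_function \<nu> (\<lambda>r. (gjoint order_act q H r, rel_code H r))"
    by (intro simple_function_Pair simple_order_gjoint simple_rel_code H q)
  then obtain q' :: "('g \<Rightarrow> 'g \<Rightarrow> bool) \<Rightarrow> nat" where q': "simple_function \<nu> q'"
    "\<And>r s. r \<in> space \<nu> \<Longrightarrow> s \<in> space \<nu> \<Longrightarrow> q' r = q' s \<Longrightarrow>
      (gjoint order_act q H r, rel_code H r) = (gjoint order_act q H s, rel_code H s)"
    by (rule nat_code) blast
  let ?Z = "\<lambda>x. q' (\<phi> x)"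
  note Z = simple_phi[OF q'(1)]
  have Z_eq: "gjoint order_act q H (\<phi> x) = gjoint order_act q H (\<phi> y)"
      "rel_code H (\<phi> x) = rel_code H (\<phi> y)"
    if "x \<in> \<Omega>" "y \<in> \<Omega>" "?Z x = ?Z y" for x y
    using q'(2)[OF phi_nu_Omega[OF that(1)] phi_nu_Omega[OF that(2)] that(3)] by simp_all
  have A: "0 \<le> ?A"
    by (intro cent_nonneg P simple_function_Pair simple_ahead K simple_phi q)
  have E: "0 \<le> ent M P"
    by (rule ent_nonneg[OF P])
  let ?t = "\<lambda>g. cent M (\<lambda>x. P (T g x)) (\<lambda>x. (ahead_in P H g x, ?Z x))"
  have t: "?t g \<le> ?A + (if g \<in> bad H then ent M P else 0)" if g: "g \<in> H" for g
  proof (cases "g \<in> bad H")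
    case True
    have "?t g \<le> ent M (\<lambda>x. P (T g x))"
      by (intro cent_le_ent simple_T[OF P] simple_function_Pair simple_ahead_in H P Z)
    also have "\<dots> = ent M P"
      by (rule ent_comp[OF T_measurable T_distr P])
    finally show ?thesis using True A by simp
  next
    case False
    then have KH: "k + g \<in> H" if "k \<in> K" for k
      using g that by (auto simp: bad_def)
    have "?t g \<le> cent M (\<lambda>x. P (T g x)) (\<lambda>x. (ahead P K (T g x), q (\<phi> (T g x))))"
    proof (intro cent_antimono simple_T[OF P] simple_function_Pair Z determinesI
        simple_T[OF simple_ahead[OF K P]] simple_T[OF simple_phi[OF q]] simple_ahead_in[OF H(1) P])
      fix x y assume xy: "x \<in> \<Omega>" "y \<in> \<Omega>" "(ahead_in P H g x, ?Z x) = (ahead_in P H g y, ?Z y)"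
      have eqs: "gjoint order_act q H (\<phi> x) = gjoint order_act q H (\<phi> y)"
        "rel_code H (\<phi> x) = rel_code H (\<phi> y)"
        using Z_eq[OF xy(1,2)] xy(3) by simp_all
      have "P (T h x) = P (T h y)" if "h \<in> H" "\<phi> x g h" for h
        using xy(3) that unfolding prod.inject joint_eq_iff by blast
      moreover have "\<phi> x g h \<longleftrightarrow> \<phi> y g h" if "h \<in> H" for h
        using eqs(2) that g by (simp add: rel_code_eq_iff)
      ultimately have "ahead P K (T g x) = ahead P K (T g y)"
        using KH by (auto simp: ahead_translate xy fun_eq_iff)
      moreover have "q (\<phi> (T g x)) = q (\<phi> (T g y))"
        using eqs(1) g by (simp add: gjoint_eq_iff equivariant xy)
      ultimately show "(ahead P K (T g x), q (\<phi> (T g x))) = (ahead P K (T g y), q (\<phi> (T g y)))"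
        by simp
    qed
    also have "\<dots> = ?A"
      by (rule cent_ahead_translate[OF P q K, symmetric])
    finally show ?thesis using False by simp
  qed
  have "cent M (gjoint T P H) ?Z = (\<Sum>g\<in>H. ?t g)"
    by (rule cent_gjoint_chain[OF P H(1) Z]) (rule determinesI, rule Z_eq(2))
  also have "\<dots> \<le> (\<Sum>g\<in>H. ?A + (if g \<in> bad H then ent M P else 0))"
    by (intro sum_mono t)
  also have "\<dots> = real (card H) * ?A + real (card (bad H)) * ent M P"
  proof -
    have "H \<inter> bad H = bad H" by (auto simp: bad_def)
    then show ?thesis
      using H(1) by (simp add: sum.distrib sum.If_cases)
  qed
  also have "\<dots> \<le> real (card H) * (?A + \<epsilon>)"
    using H(4) by (simp add: algebra_simps)
  finally have "cent M (gjoint T P H) ?Z / real (card H) \<le> ?A + \<epsilon>"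
    using H(3) by (simp add: field_simps)
  then show thesis
    by (rule that[OF q'(1) order_trans[OF gent_diff_le[OF F P Z H(1,2)]]])
qed

text \<open>The passage goes from the group to the values ahead of the unit in a finite set, and
  from there to a finite future of \<open>S\<close>; each approximation costs half of \<epsilon> and
  changes \<open>q\<close>.\<close>

lemma sent_diff_le_gent_diff:
  fixes P :: "'x \<Rightarrow> 'b" and F :: "nat \<Rightarrow> 'g set"
  assumes F: "folner F" and P: "simple_function M P" and q: "simple_function \<nu> q" and e: "0 < \<epsilon>"
  obtains q' :: "('g \<Rightarrow> 'g \<Rightarrow> bool) \<Rightarrow> nat" where "simple_function \<nu> q'"
    "sent M S (\<lambda>x. (P x, q' (\<phi> x))) - sent M S (\<lambda>x. q' (\<phi> x)) \<le>
      gent M T (\<lambda>x. (P x, q (\<phi> x))) - gent M T (\<lambda>x. q (\<phi> x)) + \<epsilon>"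
proof -
  have e2: "0 < \<epsilon> / 2" using e by simp
  obtain K and q1 :: "('g \<Rightarrow> 'g \<Rightarrow> bool) \<Rightarrow> nat" where K: "finite K" "simple_function \<nu> q1"
    "cent M P (\<lambda>x. (ahead P K x, q1 (\<phi> x))) \<le>
      gent M T (\<lambda>x. (P x, q (\<phi> x))) - gent M T (\<lambda>x. q (\<phi> x)) + \<epsilon> / 2"
    by (rule ahead_le_gent_diff[OF F P q e2])
  obtain n and q' :: "('g \<Rightarrow> 'g \<Rightarrow> bool) \<Rightarrow> nat" where q': "simple_function \<nu> q'"
    "cent M P (\<lambda>x. (fut P n x, q' (\<phi> x))) \<le> cent M P (\<lambda>x. (ahead P K x, q1 (\<phi> x))) + \<epsilon> / 2"
    by (rule fut_le_ahead[OF P K(2,1) e2])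
  show thesis
    by (rule that[OF q'(1) order_trans[OF sent_diff_le[OF P simple_phi[OF q'(1)], of n]]])
       (use K(3) q'(2) in linarith)
qed

text \<open>The same passage in the opposite direction. There are three losses, because reducing the
  relative entropy of \<open>S\<close> to one finite future is itself only approximate.\<close>

lemma gent_diff_le_sent_diff:
  fixes P :: "'x \<Rightarrow> 'b" and F :: "nat \<Rightarrow> 'g set"
  assumes F: "folner F" and P: "simple_function M P" and q: "simple_function \<nu> q" and e: "0 < \<epsilon>"
  obtains q' :: "('g \<Rightarrow> 'g \<Rightarrow> bool) \<Rightarrow> nat" where "simple_function \<nu> q'"
    "gent M T (\<lambda>x. (P x, q' (\<phi> x))) - gent M T (\<lambda>x. q' (\<phi> x)) \<le>
      sent M S (\<lambda>x. (P x, q (\<phi> x))) - sent M S (\<lambda>x. q (\<phi> x)) + \<epsilon>"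
proof -
  have e3: "0 < \<epsilon> / 3" using e by simp
  obtain n and q1 :: "('g \<Rightarrow> 'g \<Rightarrow> bool) \<Rightarrow> nat" where q1: "simple_function \<nu> q1"
    "cent M P (\<lambda>x. (fut P n x, q1 (\<phi> x))) \<le>
      sent M S (\<lambda>x. (P x, q (\<phi> x))) - sent M S (\<lambda>x. q (\<phi> x)) + \<epsilon> / 3"
    by (rule sent_diff_approx[OF P q e3])
  obtain K and q2 :: "('g \<Rightarrow> 'g \<Rightarrow> bool) \<Rightarrow> nat" where K: "finite K" "simple_function \<nu> q2"
    "cent M P (\<lambda>x. (ahead P K x, q2 (\<phi> x))) \<le> cent M P (\<lambda>x. (fut P n x, q1 (\<phi> x))) + \<epsilon> / 3"
    by (rule ahead_le_fut[OF P q1(1) e3])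
  obtain q' :: "('g \<Rightarrow> 'g \<Rightarrow> bool) \<Rightarrow> nat" where q': "simple_function \<nu> q'"
    "gent M T (\<lambda>x. (P x, q' (\<phi> x))) - gent M T (\<lambda>x. q' (\<phi> x)) \<le>
      cent M P (\<lambda>x. (ahead P K x, q2 (\<phi> x))) + \<epsilon> / 3"
    by (rule gent_diff_le_ahead[OF F P K(2,1) e3])
  show thesis
    by (rule that[OF q'(1)]) (use q'(2) K(3) q1(2) in linarith)
qed

end

section \<open>Partitions and the addition formula\<close>

text \<open>Only values attained on the space are used, so no empty cell arises; this matches the
  removal of the empty set in the given joins and preimages of partitions.\<close>

definition gen_partition :: "'x measure \<Rightarrow> ('x \<Rightarrow> 'b) \<Rightarrow> 'x set set" where
  "gen_partition M X = (\<lambda>x. {y \<in> space M. X y = X x}) ` space M"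

lemma partition_generated:
  assumes P: "finite_measurable_partition M P"
  obtains X :: "'x \<Rightarrow> nat" where "simple_function M X" "gen_partition M X = P"
proof -
  have part: "partition_on (space M) P" and fin: "finite P" and meas: "P \<subseteq> sets M"
    using P by (auto simp: finite_measurable_partition_def)
  define cell where "cell x = (THE A. A \<in> P \<and> x \<in> A)" for x
  have cell_eq: "cell x = A" if "A \<in> P" "x \<in> A" for A x
    unfolding cell_def
  proof (rule the_equality)
    show "B = A" if "B \<in> P \<and> x \<in> B" for B
      using partition_onD2[OF part] that \<open>A \<in> P\<close> \<open>x \<in> A\<close> unfolding disjoint_def by blast
  qed (use that in simp)
  have cell: "cell x \<in> P" "x \<in> cell x" if x: "x \<in> space M" for x
  proof -
    obtain A where "A \<in> P" "x \<in> A"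
      using x partition_onD1[OF part] by blast
    then show "cell x \<in> P" "x \<in> cell x"
      using cell_eq by simp_all
  qed
  have sub: "A \<subseteq> space M" if "A \<in> P" for A
    using that partition_onD1[OF part] by blast
  have inj: "inj_on (to_nat_on P) P"
    by (rule inj_on_to_nat_on[OF countable_finite[OF fin]])
  define X where "X x = to_nat_on P (cell x)" for x
  have level: "{y \<in> space M. X y = X x} = cell x" if "x \<in> space M" for x
  proof (intro set_eqI iffI)
    fix y assume "y \<in> {y \<in> space M. X y = X x}"
    then have "cell y = cell x" "y \<in> space M"
      using inj_onD[OF inj] cell that by (auto simp: X_def)
    then show "y \<in> cell x" using cell(2)[of y] by simp
  next
    fix y assume "y \<in> cell x"
    then show "y \<in> {y \<in> space M. X y = X x}"
      using cell(1)[OF that] sub cell_eq by (auto simp: X_def)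
  qed
  show thesis
  proof
    show "simple_function M X"
      unfolding simple_function_def
    proof (intro conjI ballI)
      have "X ` space M \<subseteq> to_nat_on P ` P"
        using cell(1) by (auto simp: X_def)
      then show "finite (X ` space M)"
        using fin finite_subset by blast
      fix v assume "v \<in> X ` space M"
      then obtain x where x: "x \<in> space M" "v = X x" by auto
      then have "X -` {v} \<inter> space M = cell x"
        using level[OF x(1)] by auto
      then show "X -` {v} \<inter> space M \<in> sets M"
        using cell(1)[OF x(1)] meas by auto
    qed
    have "gen_partition M X = cell ` space M"
      unfolding gen_partition_def by (rule image_cong[OF refl level])
    also have "\<dots> = P"
    proof (intro set_eqI iffI)
      fix A assume A: "A \<in> P"
      then have "A \<noteq> {}"
        using partition_onD3[OF part] by auto
      then obtain x where "x \<in> A" by auto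
      then show "A \<in> cell ` space M"
        using A sub cell_eq[OF A] by (intro image_eqI[of _ _ x]) auto
    qed (use cell(1) in auto)
    finally show "gen_partition M X = P" .
  qed
qed

lemma finite_measurable_partition_generated:
  assumes "simple_function M X"
  shows "finite_measurable_partition M (gen_partition M X)"
  unfolding finite_measurable_partition_def
proof (intro conjI)
  show "partition_on (space M) (gen_partition M X)"
    by (rule partition_onI) (auto simp: gen_partition_def disjnt_def)
  have "gen_partition M X = (\<lambda>v. {y \<in> space M. X y = v}) ` X ` space M"
    by (auto simp: gen_partition_def)
  then show "finite (gen_partition M X)"
    using simple_functionD(1)[OF assms] by simp
  have "{y \<in> space M. X y = v} = X -` {v} \<inter> space M" for v
    by auto
  then show "gen_partition M X \<subseteq> sets M"
    using simple_functionD(2)[OF assms] by (auto simp: gen_partition_def)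
qed

lemma preimage_gen_partition:
  assumes "\<And>x. x \<in> space M \<Longrightarrow> f x \<in> space M"
  shows "preimage_partition M f (gen_partition M X) \<subseteq> gen_partition M (\<lambda>x. X (f x))"
    and "gen_partition M (\<lambda>x. X (f x)) \<subseteq> preimage_partition M f (gen_partition M X)"
proof -
  have level: "f -` {y \<in> space M. X y = v} \<inter> space M = {y \<in> space M. X (f y) = v}" for v
    using assms by auto
  show "preimage_partition M f (gen_partition M X) \<subseteq> gen_partition M (\<lambda>x. X (f x))"
  proof
    fix C assume "C \<in> preimage_partition M f (gen_partition M X)"
    then obtain v where "C = f -` {y \<in> space M. X y = v} \<inter> space M" and "C \<noteq> {}"
      by (auto simp: preimage_partition_def gen_partition_def)
    then have C: "C = {y \<in> space M. X (f y) = v}"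
      by (simp only: level)
    with \<open>C \<noteq> {}\<close> obtain x where "x \<in> space M" "v = X (f x)"
      by auto
    then show "C \<in> gen_partition M (\<lambda>x. X (f x))"
      unfolding C gen_partition_def by blast
  qed
  show "gen_partition M (\<lambda>x. X (f x)) \<subseteq> preimage_partition M f (gen_partition M X)"
  proof
    fix C assume "C \<in> gen_partition M (\<lambda>x. X (f x))"
    then obtain x where x: "x \<in> space M" "C = {y \<in> space M. X (f y) = X (f x)}"
      by (auto simp: gen_partition_def)
    then have "C = f -` {y \<in> space M. X y = X (f x)} \<inter> space M" "C \<noteq> {}"
      unfolding level by auto
    then show "C \<in> preimage_partition M f (gen_partition M X)"
      using assms[OF x(1)] unfolding preimage_partition_def gen_partition_def image_image by blast
  qed
qed

lemma partition_join_gen_partition: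
  "partition_join M I (\<lambda>i. gen_partition M (Y i)) = gen_partition M (joint Y (\<lambda>_. I))"
proof (intro set_eqI iffI)
  fix C assume "C \<in> partition_join M I (\<lambda>i. gen_partition M (Y i))"
  then obtain A where A: "C = space M \<inter> (\<Inter>i\<in>I. A i)" "\<And>i. i \<in> I \<Longrightarrow> A i \<in> gen_partition M (Y i)"
    and "C \<noteq> {}"
    by (auto simp: partition_join_def)
  then obtain x where x: "x \<in> C" by auto
  have "A i = {y \<in> space M. Y i y = Y i x}" if "i \<in> I" for i
    using A(2)[OF that] x that by (auto simp: A(1) gen_partition_def)
  then have "C = {y \<in> space M. joint Y (\<lambda>_. I) y = joint Y (\<lambda>_. I) x}"
    unfolding joint_eq_iff A(1) by auto
  then show "C \<in> gen_partition M (joint Y (\<lambda>_. I))"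
    using x by (auto simp: gen_partition_def A(1))
next
  fix C assume "C \<in> gen_partition M (joint Y (\<lambda>_. I))"
  then obtain x where x: "x \<in> space M" "C = {y \<in> space M. joint Y (\<lambda>_. I) y = joint Y (\<lambda>_. I) x}"
    by (auto simp: gen_partition_def)
  define A where "A i = {y \<in> space M. Y i y = Y i x}" for i
  have "C = space M \<inter> (\<Inter>i\<in>I. A i)"
    unfolding x(2) joint_eq_iff by (auto simp: A_def)
  moreover have "\<forall>i\<in>I. A i \<in> gen_partition M (Y i)"
    using x(1) by (auto simp: A_def gen_partition_def)
  moreover have "C \<noteq> {}"
    using x by auto
  ultimately show "C \<in> partition_join M I (\<lambda>i. gen_partition M (Y i))"
    unfolding partition_join_def by blast
qed

lemma partition_join_orbit:
  assumes "\<And>g x. x \<in> space M \<Longrightarrow> T g x \<in> space M"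
  shows "partition_join M F (\<lambda>g. preimage_partition M (T g) (gen_partition M X)) =
    gen_partition M (gjoint T X F)"
proof -
  have "preimage_partition M (T g) (gen_partition M X) = gen_partition M (\<lambda>x. X (T g x))" for g
    by (intro antisym preimage_gen_partition assms)
  then show ?thesis
    by (simp add: partition_join_gen_partition gjoint_def)
qed

lemma (in prob_space) partition_entropy_generated:
  assumes X: "simple_function M X"
  shows "partition_entropy M (gen_partition M X) = ent M X"
proof -
  have "gen_partition M X = (\<lambda>v. {y \<in> space M. X y = v}) ` X ` space M"
    by (auto simp: gen_partition_def)
  moreover have "inj_on (\<lambda>v. {y \<in> space M. X y = v}) (X ` space M)"
    by (rule inj_onI) auto
  ultimately show ?thesis
    unfolding partition_entropy_def ent_eq_sum[OF X]
    by (simp add: sum.reindex sum_negf)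
qed

text \<open>Natural-number labels suffice for finite partitions, so both kinds of entropy become
  suprema over variables of one type.\<close>

lemma entropy_SUP_generated:
  assumes "\<And>X. simple_function M X \<Longrightarrow> e (gen_partition M X) = h (X :: 'x \<Rightarrow> nat)"
  shows "(SUP P\<in>{P. finite_measurable_partition M P}. ereal (e P)) =
    (SUP X\<in>{X. simple_function M X}. ereal (h X))"
proof (rule antisym)
  show "(SUP P\<in>{P. finite_measurable_partition M P}. ereal (e P)) \<le>
      (SUP X\<in>{X. simple_function M X}. ereal (h X))"
  proof (rule SUP_least)
    fix P assume "P \<in> {P. finite_measurable_partition M P}"
    then obtain X :: "'x \<Rightarrow> nat" where X: "simple_function M X" "gen_partition M X = P"
      by (auto elim: partition_generated)
    then have "ereal (e P) = ereal (h X)"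
      using assms by auto
    then show "ereal (e P) \<le> (SUP X\<in>{X. simple_function M X}. ereal (h X))"
      using X(1) by (auto intro: SUP_upper)
  qed
  show "(SUP X\<in>{X. simple_function M X}. ereal (h X)) \<le>
      (SUP P\<in>{P. finite_measurable_partition M P}. ereal (e P))"
  proof (rule SUP_least)
    fix X :: "'x \<Rightarrow> nat" assume "X \<in> {X. simple_function M X}"
    then have X: "simple_function M X" by simp
    have "ereal (h X) = ereal (e (gen_partition M X))"
      using assms[OF X] by simp
    also have "\<dots> \<le> (SUP P\<in>{P. finite_measurable_partition M P}. ereal (e P))"
      using finite_measurable_partition_generated[OF X] by (intro SUP_upper) simp
    finally show "ereal (h X) \<le> (SUP P\<in>{P. finite_measurable_partition M P}. ereal (e P))" .
  qed
qed

section \<open>Entropies as suprema over finite-valued variables\<close>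

context full_measure_action
begin

text \<open>Convergence along every Foelner sequence gives existence of the described limit; the
  given sequence \<open>F\<close> gives its uniqueness.\<close>

lemma action_partition_entropy_generated:
  assumes F: "folner (F :: nat \<Rightarrow> 'g set)" and X: "simple_function M X"
  shows "action_partition_entropy M T (gen_partition M X) = gent M T X"
proof -
  have eq: "partition_entropy M (partition_join M H (\<lambda>g. preimage_partition M (T g) (gen_partition M X))) =
      ent M (gjoint T X H)" if "finite H" for H
    using that by (simp add: partition_join_orbit T_space partition_entropy_generated simple_gjoint X)
  show ?thesis
    unfolding action_partition_entropy_def
  proof (rule the_equality)
    show "\<forall>F. folner F \<longrightarrow> (\<lambda>n. partition_entropy M (partition_join M (F n)
        (\<lambda>g. preimage_partition M (T g) (gen_partition M X))) / real (card (F n))) \<longlonglongrightarrow> gent M T X"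
      by (auto simp: eq folner_finite intro: gent_tendsto X)
    fix L assume "\<forall>F. folner F \<longrightarrow> (\<lambda>n. partition_entropy M (partition_join M (F n)
        (\<lambda>g. preimage_partition M (T g) (gen_partition M X))) / real (card (F n))) \<longlonglongrightarrow> L"
    with F have "(\<lambda>n. ent M (gjoint T X (F n)) / real (card (F n))) \<longlonglongrightarrow> L"
      by (auto simp: eq folner_finite)
    then show "L = gent M T X"
      by (rule LIMSEQ_unique[OF _ gent_tendsto[OF F X]])
  qed
qed

lemma action_entropy_eq_SUP:
  assumes "folner (F :: nat \<Rightarrow> 'g set)"
  shows "action_entropy M T = (SUP X\<in>{X :: 'x \<Rightarrow> nat. simple_function M X}. ereal (gent M T X))"
  unfolding action_entropy_def
  by (rule entropy_SUP_generated) (rule action_partition_entropy_generated[OF assms])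

lemma gent_mono:
  assumes F: "folner (F :: nat \<Rightarrow> 'g set)" and X: "simple_function M X" and Y: "simple_function M Y"
    and det: "\<And>x y. Y x = Y y \<Longrightarrow> X x = X y"
  shows "gent M T X \<le> gent M T Y"
proof (rule LIMSEQ_le[OF gent_tendsto[OF F X] gent_tendsto[OF F Y]])
  have "ent M (gjoint T X (F n)) \<le> ent M (gjoint T Y (F n))" for n
  proof (intro ent_mono simple_gjoint folner_finite[OF F] X Y determinesI)
    fix x y assume "gjoint T Y (F n) x = gjoint T Y (F n) y"
    then show "gjoint T X (F n) x = gjoint T X (F n) y"
      unfolding gjoint_eq_iff using det[of "T _ x" "T _ y"] by blast
  qed
  then show "\<exists>N. \<forall>n\<ge>N. ent M (gjoint T X (F n)) / real (card (F n)) \<le>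
      ent M (gjoint T Y (F n)) / real (card (F n))"
    by (intro exI[of _ 0] allI impI divide_right_mono) simp_all
qed

end

text \<open>The order-theoretic core of both addition formulas: \<open>k\<close> is the entropy in
  the factor, \<open>c\<close> the relative entropy and \<open>h\<close> the entropy above.
  Isolating it allows one \<open>c\<close> to serve for the group and for \<open>S\<close>.
  Nonnegativity keeps the suprema away from minus infinity, where they could not be added.\<close>

lemma ereal_SUP_add_relative:
  fixes h :: "'p \<Rightarrow> real" and k :: "'q \<Rightarrow> real" and c :: "'p \<Rightarrow> real"
  assumes "A \<noteq> {}" "B \<noteq> {}" and k: "\<And>q. q \<in> B \<Longrightarrow> 0 \<le> k q" and c: "\<And>P. P \<in> A \<Longrightarrow> 0 \<le> c P"
    and lower: "\<And>P q. P \<in> A \<Longrightarrow> q \<in> B \<Longrightarrow> \<exists>P'\<in>A. k q + c P \<le> h P'"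
    and upper: "\<And>P \<epsilon>. P \<in> A \<Longrightarrow> 0 < \<epsilon> \<Longrightarrow> \<exists>q\<in>B. h P \<le> k q + c P + \<epsilon>"
  shows "(SUP P\<in>A. ereal (h P)) = (SUP q\<in>B. ereal (k q)) + (SUP P\<in>A. ereal (c P))"
proof (rule antisym)
  show "(SUP P\<in>A. ereal (h P)) \<le> (SUP q\<in>B. ereal (k q)) + (SUP P\<in>A. ereal (c P))"
  proof (rule SUP_least, rule ereal_le_epsilon2)
    fix P and \<epsilon> :: real assume P: "P \<in> A" and "0 < \<epsilon>"
    then obtain q where q: "q \<in> B" "h P \<le> k q + c P + \<epsilon>"
      using upper by blast
    have "ereal (h P) \<le> ereal (k q) + ereal (c P) + ereal \<epsilon>"
      using q(2) by simp
    also have "\<dots> \<le> (SUP q\<in>B. ereal (k q)) + (SUP P\<in>A. ereal (c P)) + ereal \<epsilon>"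
      using P q(1) by (intro add_mono SUP_upper order_refl)
    finally show "ereal (h P) \<le> (SUP q\<in>B. ereal (k q)) + (SUP P\<in>A. ereal (c P)) + ereal \<epsilon>" .
  qed
  show "(SUP q\<in>B. ereal (k q)) + (SUP P\<in>A. ereal (c P)) \<le> (SUP P\<in>A. ereal (h P))"
  proof -
    have "(SUP q\<in>B. ereal (k q)) + ereal (c P) \<le> (SUP P\<in>A. ereal (h P))" if P: "P \<in> A" for P
    proof -
      have "(SUP q\<in>B. ereal (k q)) + ereal (c P) = (SUP q\<in>B. ereal (k q) + ereal (c P))"
        using assms(2) by (intro SUP_ereal_add_left[symmetric]) auto
      also have "\<dots> \<le> (SUP P\<in>A. ereal (h P))"
      proof (rule SUP_least)
        fix q assume "q \<in> B"
        then obtain P' where "P' \<in> A" "k q + c P \<le> h P'"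
          using lower P by blast
        then show "ereal (k q) + ereal (c P) \<le> (SUP P\<in>A. ereal (h P))"
          by (intro SUP_upper2[of P']) auto
      qed
      finally show ?thesis .
    qed
    moreover have "(SUP q\<in>B. ereal (k q)) + (SUP P\<in>A. ereal (c P)) =
        (SUP P\<in>A. (SUP q\<in>B. ereal (k q)) + ereal (c P))"
    proof (rule SUP_ereal_add_right[symmetric, OF assms(1)])
      obtain q where "q \<in> B" using assms(2) by auto
      then have "ereal (k q) \<le> (SUP q\<in>B. ereal (k q))"
        by (rule SUP_upper)
      then show "(SUP q\<in>B. ereal (k q)) \<noteq> - \<infinity>" by auto
    qed
    ultimately show ?thesis
      by (auto intro: SUP_least)
  qed
qed

section \<open>Relative entropy over the order and the addition formulas\<close>

context multiorder_factor
begin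

lemma map_partition_entropy_generated:
  assumes X: "simple_function M X"
  shows "map_partition_entropy M S (gen_partition M X) = sent M S X"
proof -
  have "partition_entropy M (partition_join M {..<n} (\<lambda>i. preimage_partition M (S ^^ i) (gen_partition M X))) =
      ent M (gjoint iter X {..<n})" for n
    by (simp add: partition_join_orbit measurable_space[OF S_pow_measurable]
        partition_entropy_generated simple_iter_joint X)
  then show ?thesis
    unfolding map_partition_entropy_def using limI[OF sent_tendsto[OF X]] by simp
qed

lemma map_entropy_eq_SUP:
  "map_entropy M S = (SUP X\<in>{X :: 'x \<Rightarrow> nat. simple_function M X}. ereal (sent M S X))"
  unfolding map_entropy_def
  by (rule entropy_SUP_generated) (rule map_partition_entropy_generated)

lemma sent_mono:
  assumes X: "simple_function M X" and Y: "simple_function M Y"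
    and det: "\<And>x y. Y x = Y y \<Longrightarrow> X x = X y"
  shows "sent M S X \<le> sent M S Y"
proof (rule LIMSEQ_le[OF sent_tendsto[OF X] sent_tendsto[OF Y]])
  have "ent M (gjoint iter X {..<n}) \<le> ent M (gjoint iter Y {..<n})" for n
  proof (intro ent_mono simple_iter_joint finite_lessThan X Y determinesI)
    fix x y assume "gjoint iter Y {..<n} x = gjoint iter Y {..<n} y"
    then show "gjoint iter X {..<n} x = gjoint iter X {..<n} y"
      unfolding gjoint_eq_iff using det[of "iter _ x" "iter _ y"] by blast
  qed
  then show "\<exists>N. \<forall>n\<ge>N. ent M (gjoint iter X {..<n}) / real n \<le> ent M (gjoint iter Y {..<n}) / real n"
    by (intro exI[of _ 0] allI impI divide_right_mono) simp_all
qed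

lemma sent_nonneg:
  assumes "simple_function M X"
  shows "0 \<le> sent M S X"
  unfolding sent_def using assms
  by (intro cINF_greatest) (auto intro!: cent_nonneg simple_iter_joint)

lemma gent_factor:
  assumes q: "simple_function \<nu> q"
  shows "gent M T (\<lambda>x. q (\<phi> x)) = gent \<nu> order_act q"
proof -
  have "ent M (gjoint T (\<lambda>x. q (\<phi> x)) K) = ent \<nu> (gjoint order_act q K)" if K: "finite K" for K
  proof -
    have "ent M (gjoint T (\<lambda>x. q (\<phi> x)) K) = ent M (\<lambda>x. gjoint order_act q K (\<phi> x))"
      by (intro ent_cong simple_gjoint simple_phi[OF simple_order_gjoint] K q simple_phi[OF q] determinesI)
         (simp_all add: gjoint_phi)
    also have "\<dots> = ent \<nu> (gjoint order_act q K)"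
      by (rule ent_comp[OF phi_measurable phi_distr simple_order_gjoint[OF K q]])
    finally show ?thesis .
  qed
  then show ?thesis
    unfolding gent_def by (intro INF_cong refl) auto
qed

lemma sent_factor:
  assumes q: "simple_function \<nu> q"
  shows "sent M S (\<lambda>x. q (\<phi> x)) = sent \<nu> order_successor_map q"
proof -
  have "cent M (\<lambda>x. q (\<phi> x)) (fut (\<lambda>x. q (\<phi> x)) n) =
      cent \<nu> q (gjoint (\<lambda>i. order_successor_map ^^ i) q {1..n})" for n
  proof -
    let ?J = "gjoint (\<lambda>i. order_successor_map ^^ i) q {1..n}"
    have J: "simple_function \<nu> ?J"
      unfolding gjoint_def
      by (intro simple_function_joint_const
          simple_function_comp[OF measurable_funpow[OF order_successor_map_measurable] q]) simp
    have eq: "fut (\<lambda>x. q (\<phi> x)) n x = ?J (\<phi> x)" if "x \<in> \<Omega>" for x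
      using that by (simp add: gjoint_def joint_def phi_S_pow fun_eq_iff)
    have "cent M (\<lambda>x. q (\<phi> x)) (fut (\<lambda>x. q (\<phi> x)) n) = cent M (\<lambda>x. q (\<phi> x)) (\<lambda>x. ?J (\<phi> x))"
      by (intro cent_cong simple_phi[OF q] simple_phi[OF J] simple_iter_joint determinesI)
         (simp_all only: eq finite_atLeastAtMost prod.inject)
    also have "\<dots> = cent \<nu> q ?J"
      by (rule cent_comp[OF phi_measurable phi_distr q J])
    finally show ?thesis .
  qed
  then show ?thesis
    unfolding sent_def by simp
qed

text \<open>The entropy of \<open>P\<close> relative to the factor of orders. It is defined through
  \<open>S\<close>, but the two comparison lemmas give the same infimum for the group.\<close>

definition relent :: "('x \<Rightarrow> nat) \<Rightarrow> real" where
  "relent P = (INF q\<in>{q :: ('g \<Rightarrow> 'g \<Rightarrow> bool) \<Rightarrow> nat. simple_function \<nu> q}.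
    sent M S (\<lambda>x. (P x, q (\<phi> x))) - sent M S (\<lambda>x. q (\<phi> x)))"

lemma sent_le_pair:
  assumes "simple_function M P" "simple_function \<nu> q"
  shows "sent M S (\<lambda>x. q (\<phi> x)) \<le> sent M S (\<lambda>x. (P x, q (\<phi> x)))"
  by (intro sent_mono simple_function_Pair simple_phi assms) simp

lemma bdd_below_relent:
  assumes "simple_function M P"
  shows "bdd_below ((\<lambda>q :: ('g \<Rightarrow> 'g \<Rightarrow> bool) \<Rightarrow> nat.
    sent M S (\<lambda>x. (P x, q (\<phi> x))) - sent M S (\<lambda>x. q (\<phi> x))) ` {q. simple_function \<nu> q})"
proof (rule bdd_belowI[where m = 0])
  fix d assume "d \<in> (\<lambda>q :: ('g \<Rightarrow> 'g \<Rightarrow> bool) \<Rightarrow> nat.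
    sent M S (\<lambda>x. (P x, q (\<phi> x))) - sent M S (\<lambda>x. q (\<phi> x))) ` {q. simple_function \<nu> q}"
  then obtain q :: "('g \<Rightarrow> 'g \<Rightarrow> bool) \<Rightarrow> nat" where "simple_function \<nu> q"
    "d = sent M S (\<lambda>x. (P x, q (\<phi> x))) - sent M S (\<lambda>x. q (\<phi> x))"
    by auto
  then show "0 \<le> d"
    using sent_le_pair[OF assms] by simp
qed

lemma relent_le:
  fixes q :: "('g \<Rightarrow> 'g \<Rightarrow> bool) \<Rightarrow> nat"
  assumes "simple_function M P" "simple_function \<nu> q"
  shows "relent P \<le> sent M S (\<lambda>x. (P x, q (\<phi> x))) - sent M S (\<lambda>x. q (\<phi> x))"
  unfolding relent_def
  by (rule cINF_lower[OF bdd_below_relent[OF assms(1)]]) (simp add: assms(2))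

lemma relent_nonneg:
  assumes "simple_function M P"
  shows "0 \<le> relent P"
  unfolding relent_def
proof (rule cINF_greatest)
  have "(\<lambda>_. 0) \<in> {q :: ('g \<Rightarrow> 'g \<Rightarrow> bool) \<Rightarrow> nat. simple_function \<nu> q}" by simp
  then show "{q :: ('g \<Rightarrow> 'g \<Rightarrow> bool) \<Rightarrow> nat. simple_function \<nu> q} \<noteq> {}" by blast
qed (use sent_le_pair[OF assms] in simp)

lemma relent_approx:
  assumes P: "simple_function M P" and "0 < \<epsilon>"
  obtains q :: "('g \<Rightarrow> 'g \<Rightarrow> bool) \<Rightarrow> nat" where "simple_function \<nu> q"
    "sent M S (\<lambda>x. (P x, q (\<phi> x))) - sent M S (\<lambda>x. q (\<phi> x)) < relent P + \<epsilon>"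
proof -
  let ?A = "{q :: ('g \<Rightarrow> 'g \<Rightarrow> bool) \<Rightarrow> nat. simple_function \<nu> q}"
  have "(\<lambda>_. 0) \<in> ?A" by simp
  then have ne: "?A \<noteq> {}" by blast
  have "relent P < relent P + \<epsilon>"
    using \<open>0 < \<epsilon>\<close> by simp
  then show thesis
    unfolding relent_def cINF_less_iff[OF ne bdd_below_relent[OF P]]
    using that unfolding relent_def by blast
qed

text \<open>For the lower estimate \<open>P\<close> and \<open>q\<close> are merged into one
  variable, coded by \<open>prod_encode\<close> because the supremum ranges over variables with
  values in \<open>nat\<close>. For the upper one \<open>P\<close> is enlarged by a nearly optimal
  \<open>q\<close>.\<close>

lemma map_entropy_addition:
  "map_entropy M S = (SUP q\<in>{q :: ('g \<Rightarrow> 'g \<Rightarrow> bool) \<Rightarrow> nat. simple_function \<nu> q}.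
      ereal (sent \<nu> order_successor_map q)) + (SUP P\<in>{P. simple_function M P}. ereal (relent P))"
  unfolding map_entropy_eq_SUP
proof (rule ereal_SUP_add_relative)
  show "{P :: 'x \<Rightarrow> nat. simple_function M P} \<noteq> {}" "{q :: ('g \<Rightarrow> 'g \<Rightarrow> bool) \<Rightarrow> nat. simple_function \<nu> q} \<noteq> {}"
    by (auto intro: exI[of _ "\<lambda>_. 0"])
  show "0 \<le> sent \<nu> order_successor_map q" if "q \<in> {q. simple_function \<nu> q}" for q :: "('g \<Rightarrow> 'g \<Rightarrow> bool) \<Rightarrow> nat"
    using that sent_nonneg[OF simple_phi[of q]] by (simp add: sent_factor)
  show "0 \<le> relent P" if "P \<in> {P. simple_function M P}" for P
    using that by (simp add: relent_nonneg)
  show "\<exists>P'\<in>{P' :: 'x \<Rightarrow> nat. simple_function M P'}. sent \<nu> order_successor_map q + relent P \<le> sent M S P'"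
    if "P \<in> {P. simple_function M P}" "q \<in> {q. simple_function \<nu> q}" for P :: "'x \<Rightarrow> nat" and q :: "('g \<Rightarrow> 'g \<Rightarrow> bool) \<Rightarrow> nat"
  proof -
    have P: "simple_function M P" and q: "simple_function \<nu> q"
      using that by auto
    have PQ: "simple_function M (\<lambda>x. (P x, q (\<phi> x)))"
      by (intro simple_function_Pair P simple_phi q)
    have P': "simple_function M (\<lambda>x. prod_encode (P x, q (\<phi> x)))"
      by (rule simple_function_compose1[OF PQ])
    have "sent \<nu> order_successor_map q + relent P \<le> sent M S (\<lambda>x. (P x, q (\<phi> x)))"
      using relent_le[OF P q] by (simp add: sent_factor[OF q])
    also have "\<dots> \<le> sent M S (\<lambda>x. prod_encode (P x, q (\<phi> x)))"
      by (rule sent_mono[OF PQ P']) (simp add: prod_encode_eq)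
    finally show ?thesis using P' by blast
  qed
  show "\<exists>q\<in>{q :: ('g \<Rightarrow> 'g \<Rightarrow> bool) \<Rightarrow> nat. simple_function \<nu> q}.
      sent M S P \<le> sent \<nu> order_successor_map q + relent P + \<epsilon>"
    if "P \<in> {P. simple_function M P}" "0 < \<epsilon>" for P :: "'x \<Rightarrow> nat" and \<epsilon>
  proof -
    have P: "simple_function M P" and e: "0 < \<epsilon>" using that by simp_all
    obtain q :: "('g \<Rightarrow> 'g \<Rightarrow> bool) \<Rightarrow> nat" where q: "simple_function \<nu> q"
      "sent M S (\<lambda>x. (P x, q (\<phi> x))) - sent M S (\<lambda>x. q (\<phi> x)) < relent P + \<epsilon>"
      by (rule relent_approx[OF P e])
    have "sent M S P \<le> sent M S (\<lambda>x. (P x, q (\<phi> x)))"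
      by (intro sent_mono P simple_function_Pair simple_phi q) simp
    with q show ?thesis
      by (intro bexI[of _ q]) (simp_all add: sent_factor[OF q(1), symmetric])
  qed
qed

text \<open>The argument is that for \<open>S\<close>, with one extra exchange on each side:
  \<open>sent_diff_le_gent_diff\<close> bounds \<open>relent\<close> by the group difference for
  every \<open>q\<close>, and \<open>gent_diff_le_sent_diff\<close> turns a \<open>q\<close> that is
  nearly optimal for \<open>S\<close> into one that is nearly optimal for the group.\<close>

lemma action_entropy_addition:
  assumes F: "folner (F :: nat \<Rightarrow> 'g set)"
  shows "action_entropy M T = (SUP q\<in>{q :: ('g \<Rightarrow> 'g \<Rightarrow> bool) \<Rightarrow> nat. simple_function \<nu> q}.
      ereal (gent \<nu> order_act q)) + (SUP P\<in>{P. simple_function M P}. ereal (relent P))"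
  unfolding action_entropy_eq_SUP[OF F]
proof (rule ereal_SUP_add_relative)
  show "{P :: 'x \<Rightarrow> nat. simple_function M P} \<noteq> {}" "{q :: ('g \<Rightarrow> 'g \<Rightarrow> bool) \<Rightarrow> nat. simple_function \<nu> q} \<noteq> {}"
    by (auto intro: exI[of _ "\<lambda>_. 0"])
  show "0 \<le> gent \<nu> order_act q" if "q \<in> {q. simple_function \<nu> q}" for q :: "('g \<Rightarrow> 'g \<Rightarrow> bool) \<Rightarrow> nat"
    using that gent_nonneg[OF simple_phi[of q]] by (simp add: gent_factor)
  show "0 \<le> relent P" if "P \<in> {P. simple_function M P}" for P
    using that by (simp add: relent_nonneg)
  show "\<exists>P'\<in>{P' :: 'x \<Rightarrow> nat. simple_function M P'}. gent \<nu> order_act q + relent P \<le> gent M T P'"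
    if "P \<in> {P. simple_function M P}" "q \<in> {q. simple_function \<nu> q}" for P :: "'x \<Rightarrow> nat" and q :: "('g \<Rightarrow> 'g \<Rightarrow> bool) \<Rightarrow> nat"
  proof -
    have P: "simple_function M P" and q: "simple_function \<nu> q"
      using that by auto
    have PQ: "simple_function M (\<lambda>x. (P x, q (\<phi> x)))"
      by (intro simple_function_Pair P simple_phi q)
    have P': "simple_function M (\<lambda>x. prod_encode (P x, q (\<phi> x)))"
      by (rule simple_function_compose1[OF PQ])
    have "relent P \<le> gent M T (\<lambda>x. (P x, q (\<phi> x))) - gent M T (\<lambda>x. q (\<phi> x))"
    proof (rule field_le_epsilon)
      fix \<epsilon> :: real assume "0 < \<epsilon>"
      then obtain q' :: "('g \<Rightarrow> 'g \<Rightarrow> bool) \<Rightarrow> nat" where q': "simple_function \<nu> q'"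
        "sent M S (\<lambda>x. (P x, q' (\<phi> x))) - sent M S (\<lambda>x. q' (\<phi> x)) \<le>
          gent M T (\<lambda>x. (P x, q (\<phi> x))) - gent M T (\<lambda>x. q (\<phi> x)) + \<epsilon>"
        by (rule sent_diff_le_gent_diff[OF F P q])
      show "relent P \<le> gent M T (\<lambda>x. (P x, q (\<phi> x))) - gent M T (\<lambda>x. q (\<phi> x)) + \<epsilon>"
        by (rule order_trans[OF relent_le[OF P q'(1)] q'(2)])
    qed
    then have "gent \<nu> order_act q + relent P \<le> gent M T (\<lambda>x. (P x, q (\<phi> x)))"
      by (simp add: gent_factor[OF q])
    also have "\<dots> \<le> gent M T (\<lambda>x. prod_encode (P x, q (\<phi> x)))"
      by (rule gent_mono[OF F PQ P']) (simp add: prod_encode_eq)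
    finally show ?thesis using P' by blast
  qed
  show "\<exists>q\<in>{q :: ('g \<Rightarrow> 'g \<Rightarrow> bool) \<Rightarrow> nat. simple_function \<nu> q}.
      gent M T P \<le> gent \<nu> order_act q + relent P + \<epsilon>"
    if "P \<in> {P. simple_function M P}" "0 < \<epsilon>" for P :: "'x \<Rightarrow> nat" and \<epsilon>
  proof -
    have P: "simple_function M P" using that by simp
    have e2: "0 < \<epsilon> / 2" using that by simp
    obtain q :: "('g \<Rightarrow> 'g \<Rightarrow> bool) \<Rightarrow> nat" where q: "simple_function \<nu> q"
      "sent M S (\<lambda>x. (P x, q (\<phi> x))) - sent M S (\<lambda>x. q (\<phi> x)) < relent P + \<epsilon> / 2"
      by (rule relent_approx[OF P e2])
    obtain q' :: "('g \<Rightarrow> 'g \<Rightarrow> bool) \<Rightarrow> nat" where q': "simple_function \<nu> q'"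
      "gent M T (\<lambda>x. (P x, q' (\<phi> x))) - gent M T (\<lambda>x. q' (\<phi> x)) \<le>
        sent M S (\<lambda>x. (P x, q (\<phi> x))) - sent M S (\<lambda>x. q (\<phi> x)) + \<epsilon> / 2"
      by (rule gent_diff_le_sent_diff[OF F P q(1) e2])
    have "gent M T P \<le> gent M T (\<lambda>x. (P x, q' (\<phi> x)))"
      by (intro gent_mono[OF F] P simple_function_Pair simple_phi q') simp
    then have "gent M T P \<le> gent M T (\<lambda>x. q' (\<phi> x)) + relent P + \<epsilon>"
      using q(2) q'(2) by linarith
    with q'(1) show ?thesis
      by (intro bexI[of _ q']) (simp_all add: gent_factor)
  qed
qed

end

text \<open>Viewing the multiorder as a factor of itself makes every result about \<mu> and
  \<open>S\<close> available for \<nu> and its own successor map.\<close>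

lemma (in multiorder_measure) identity_factor:
  "multiorder_factor \<nu> (space \<nu>) order_act \<nu> (\<lambda>r. r)"
proof -
  interpret prob_space \<nu>
    using multiorder by (simp add: multiorder_def)
  show ?thesis
    by unfold_locales
      (use multiorder in \<open>auto simp: multiorder_def prob_space distr_id[unfolded id_def]\<close>)
qed

theorem corollary5p3:
  fixes M :: "'x measure"
    and T :: "'g::{group_add, countable} \<Rightarrow> 'x \<Rightarrow> 'x"
    and \<nu> :: "('g \<Rightarrow> 'g \<Rightarrow> bool) measure"
    and \<phi> :: "'x \<Rightarrow> ('g \<Rightarrow> 'g \<Rightarrow> bool)"
  assumes "infinite (UNIV :: 'g set)"
    and "\<exists>F :: nat \<Rightarrow> 'g set. folner F"
    and "standard_prob_space M"
    and "measure_preserving_action M T"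
    and "multiorder \<nu>"
    and "factor_map M T \<nu> order_act \<phi>"
    and "map_entropy M (successor_map T \<phi>) < \<infinity>"
  shows "map_entropy \<nu> order_successor_map < \<infinity> \<and>
         action_entropy M T - map_entropy M (successor_map T \<phi>) =
         action_entropy \<nu> order_act - map_entropy \<nu> order_successor_map"
proof -
  obtain F :: "nat \<Rightarrow> 'g set" where F: "folner F"
    using assms(2) by blast
  interpret M: prob_space M
    using assms(3) by (simp add: standard_prob_space_def)
  \<comment> \<open>Countability of the group merges the exceptional sets of the single elements
    into one null set, whose complement serves as \<Omega>.\<close>
  have "AE x in M. \<forall>g. \<phi> (T g x) = order_act g (\<phi> x)"
    using assms(6) unfolding factor_map_def AE_all_countable by blast
  then obtain N where N: "{x \<in> space M. \<not> (\<forall>g. \<phi> (T g x) = order_act g (\<phi> x))} \<subseteq> N"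
      "emeasure M N = 0" "N \<in> sets M"
    by (rule AE_E)
  interpret multiorder_factor M "space M - N" T \<nu> \<phi>
  proof unfold_locales
    show "M.prob (space M - N) = 1"
      using M.prob_compl[OF N(3)] N(2) by (simp add: measure_def)
    show "\<phi> (T g x) = order_act g (\<phi> x)" if "x \<in> space M - N" for g x
      using that N(1) by blast
  qed (use assms N(3) in \<open>auto simp: factor_map_def\<close>)
  interpret nu: multiorder_factor \<nu> "space \<nu>" order_act \<nu> "\<lambda>r. r"
    by (rule identity_factor)
  have succ_eq: "successor_map order_act (\<lambda>r. r) = order_successor_map"
    by (simp add: fun_eq_iff successor_map_def order_successor_map_def)
  have map_nu: "map_entropy \<nu> order_successor_map =
      (SUP q\<in>{q :: ('g \<Rightarrow> 'g \<Rightarrow> bool) \<Rightarrow> nat. simple_function \<nu> q}. ereal (sent \<nu> order_successor_map q))"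
    by (rule nu.map_entropy_eq_SUP[unfolded succ_eq])
  let ?c = "SUP P\<in>{P. simple_function M P}. ereal (relent P)"
  have map_M: "map_entropy M (successor_map T \<phi>) = map_entropy \<nu> order_successor_map + ?c"
    unfolding map_nu by (rule map_entropy_addition)
  have action_M: "action_entropy M T = action_entropy \<nu> order_act + ?c"
    unfolding nu.action_entropy_eq_SUP[OF F] by (rule action_entropy_addition[OF F])
  have "0 \<le> sent \<nu> order_successor_map (\<lambda>_. 0 :: nat)"
    using nu.sent_nonneg[of "\<lambda>_. 0 :: nat"] unfolding succ_eq by simp
  then have "0 \<le> map_entropy \<nu> order_successor_map"
    unfolding map_nu by (intro SUP_upper2[of "\<lambda>_. 0"]) auto
  moreover have "0 \<le> ?c"
    by (intro SUP_upper2[of "\<lambda>_. 0"]) (auto intro: relent_nonneg)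
  \<comment> \<open>Two nonnegative summands with finite sum are finite, so the subtraction in the
    extended reals cancels \<open>?c\<close> even if the group entropy is infinite.\<close>
  ultimately show ?thesis
    using assms(7) unfolding map_M action_M
    by (cases "map_entropy \<nu> order_successor_map"; cases ?c; cases "action_entropy \<nu> order_act") auto
qed

end
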